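(* Let $A$ be an allowed $k$-algebra and $\mathfrak g_A$ a Lie algebroid over $A$. (1) If $J$ is a maximal defining ideal, then $A/J$ is a regular ring; hence if $A$ is also a regular ring, then $J=(x_1,\dots,x_r)$, where $x_1,\dots,x_r$ are elements in $\mathfrak m_A$ that form a subset of a regular system of parameters of $A$. (2) If $J$ is a $\mathfrak g_A$-defining ideal in $A$, then its radical $J_m=\sqrt J$ is the unique maximal defining ideal containing $J$.
   Context: $k$ is an algebraically closed field of characteristic $0$; rings are commutative Noetherian $k$-algebras and $T_A$ is the $A$-module of $k$-linear derivations of $A$. A regular local $k$-algebra $(S,\mathfrak m_S)$ of dimension $n$ satisfies the weak Jacobian condition over $k$ if there exist $\partial_1,\dots,\partial_n\in T_S$ and $f_1,\dots,f_n\in\mathfrak m_S$ with $\det(\partial_i(f_j))\notin\mathfrak m_S$. An allowed $k$-algebra is a local ring $A=S/I$ with such $S$, where $I$ is an ideal and $k$ is a coefficient field (so $A=k+\mathfrak m_A$). A Lie algebroid over $A$ is an $A$-module $\mathfrak g_A$ of finite type with a $k$-Lie algebra structure and a homomorphism of Lie algebras and $A$-modules $\alpha:\mathfrak g_A\to T_A$ with $[\delta,r\eta]=\alpha(\delta)(r)\eta+r[\delta,\eta]$. $A$ and its quotients by ideals preserved by $\alpha(\mathfrak g_A)$ are $\mathfrak g_A$-modules via $\alpha$; $\ell_{\mathfrak g_A}$ denotes length (of chains of $\mathfrak g_A$-stable $A$-submodules). A ($\mathfrak g_A$-)defining ideal is an ideal $J\subsetneq A$ with $\alpha(\mathfrak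 g_A)\cdot J\subset J$ and $\ell_{\mathfrak g_A}(A/J)<\infty$. *)

theory Defs
  imports "HOL-Algebra.Algebra" "HOL-Combinatorics.Permutations" "HOL-Library.Extended_Nat"
begin

section \<open>Dimension and length\<close>

text \<open>The supremum of the lengths \<open>n\<close> of strict chains \<open>C 0 \<subset> C 1 \<subset> \<dots> \<subset> C n\<close>
  of members of a family of sets.\<close>

definition chain_length :: "'a set set \<Rightarrow> enat" where
  "chain_length F =
     Sup {enat n |n. \<exists>C. (\<forall>i\<le>n. C i \<in> F) \<and> (\<forall>i<n. C i \<subset> C (Suc i))}"

definition krull_dim :: "('a, 'b) ring_scheme \<Rightarrow> enat" where
  "krull_dim R = chain_length {P. primeideal P R}"


section \<open>Regular local rings\<close>

definition local_ring :: "('a, 'b) ring_scheme \<Rightarrow> bool" where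
  "local_ring R \<longleftrightarrow> cring R \<and> (\<exists>!M. maximalideal M R)"

text \<open>Only meaningful when \<open>R\<close> is local.\<close>

definition max_ideal :: "('a, 'b) ring_scheme \<Rightarrow> 'a set" where
  "max_ideal R = (THE M. maximalideal M R)"

definition regular_system_of_parameters :: "('a, 'b) ring_scheme \<Rightarrow> 'a list \<Rightarrow> bool" where
  "regular_system_of_parameters R xs \<longleftrightarrow>
     set xs \<subseteq> carrier R \<and> enat (length xs) = krull_dim R \<and> genideal R (set xs) = max_ideal R"

definition regular_local_ring :: "('a, 'b) ring_scheme \<Rightarrow> bool" where
  "regular_local_ring R \<longleftrightarrow>
     noetherian_ring R \<and> local_ring R \<and> (\<exists>xs. regular_system_of_parameters R xs)"

definition radical :: "('a, 'b) ring_scheme \<Rightarrow> 'a set \<Rightarrow> 'a set" where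
  "radical R I = {a \<in> carrier R. \<exists>n::nat. a [^]\<^bsub>R\<^esub> n \<in> I}"


section \<open>Derivations and allowed algebras\<close>

definition char_zero :: "('a, 'b) ring_scheme \<Rightarrow> bool" where
  "char_zero R \<longleftrightarrow> (\<forall>n::nat. n > 0 \<longrightarrow> add_pow R n \<one>\<^bsub>R\<^esub> \<noteq> \<zero>\<^bsub>R\<^esub>)"

text \<open>The derivations \<open>T\<^sub>A\<close>. Values outside \<open>carrier A\<close> are irrelevant, so two derivations
  are identified below when they agree on \<open>carrier A\<close>.\<close>

definition derivations :: "('k, 'z) ring_scheme \<Rightarrow> ('k, 'a, 'y) module_scheme \<Rightarrow> ('a \<Rightarrow> 'a) set" where
  "derivations K A = {D. D \<in> carrier A \<rightarrow> carrier A \<and>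
     (\<forall>a\<in>carrier A. \<forall>b\<in>carrier A. D (a \<oplus>\<^bsub>A\<^esub> b) = D a \<oplus>\<^bsub>A\<^esub> D b) \<and>
     (\<forall>c\<in>carrier K. \<forall>a\<in>carrier A. D (c \<odot>\<^bsub>A\<^esub> a) = c \<odot>\<^bsub>A\<^esub> D a) \<and>
     (\<forall>a\<in>carrier A. \<forall>b\<in>carrier A.
        D (a \<otimes>\<^bsub>A\<^esub> b) = (D a \<otimes>\<^bsub>A\<^esub> b) \<oplus>\<^bsub>A\<^esub> (a \<otimes>\<^bsub>A\<^esub> D b))}"

text \<open>The Leibniz formula for the determinant of \<open>(M i j)\<close> with \<open>i, j < n\<close>.\<close>

definition ring_det :: "('a, 'b) ring_scheme \<Rightarrow> nat \<Rightarrow> (nat \<Rightarrow> nat \<Rightarrow> 'a) \<Rightarrow> 'a" where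
  "ring_det R n M = finsum R
     (\<lambda>p. add_pow R (sign p :: int) (finprod R (\<lambda>i. M i (p i)) {..<n})) {p. p permutes {..<n}}"

definition weak_jacobian :: "('k, 'z) ring_scheme \<Rightarrow> ('k, 's, 'y) module_scheme \<Rightarrow> bool" where
  "weak_jacobian K S \<longleftrightarrow> (\<exists>n D f. enat n = krull_dim S \<and>
     (\<forall>i<n. D i \<in> derivations K S) \<and> (\<forall>j<n. f j \<in> max_ideal S) \<and>
     ring_det S n (\<lambda>i j. D i (f j)) \<notin> max_ideal S)"

text \<open>\<open>A\<close> is (isomorphic to) a quotient of \<open>S\<close>: it is the image of a surjective homomorphism
  of \<open>K\<close>-algebras, the ideal being the kernel. The algebra \<open>S\<close> is a parameter because its type
  cannot be quantified in the definition.\<close>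

definition allowed_algebra ::
  "('k, 'z) ring_scheme \<Rightarrow> ('k, 's, 'x) module_scheme \<Rightarrow> ('k, 'a, 'y) module_scheme \<Rightarrow> bool" where
  "allowed_algebra K S A \<longleftrightarrow>
     algebra K S \<and> regular_local_ring S \<and> weak_jacobian K S \<and>
     algebra K A \<and> local_ring A \<and>
     (\<exists>\<phi> \<in> ring_hom S A.
        (\<forall>c\<in>carrier K. \<forall>s\<in>carrier S. \<phi> (c \<odot>\<^bsub>S\<^esub> s) = c \<odot>\<^bsub>A\<^esub> \<phi> s) \<and>
        \<phi> ` carrier S = carrier A) \<and>
     (\<forall>a\<in>carrier A. \<exists>c\<in>carrier K. \<exists>m\<in>max_ideal A. a = (c \<odot>\<^bsub>A\<^esub> \<one>\<^bsub>A\<^esub>) \<oplus>\<^bsub>A\<^esub> m)"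


section \<open>Lie algebroids\<close>

locale lie_algebroid =
  fixes K :: "('k, 'z) ring_scheme"
    and A :: "('k, 'a, 'y) module_scheme"
    and g :: "('a, 'g, 'x) module_scheme"
    and br :: "'g \<Rightarrow> 'g \<Rightarrow> 'g"
    and \<alpha> :: "'g \<Rightarrow> 'a \<Rightarrow> 'a"
  assumes algebra: "algebra K A"
    and module: "module A g"
    and finite_type:
      "\<exists>Y \<subseteq> carrier g. finite Y \<and> (\<forall>N. submodule N A g \<and> Y \<subseteq> N \<longrightarrow> N = carrier g)"
    and br_closed: "\<lbrakk>x \<in> carrier g; y \<in> carrier g\<rbrakk> \<Longrightarrow> br x y \<in> carrier g"
    and br_add_left: "\<lbrakk>x \<in> carrier g; y \<in> carrier g; z \<in> carrier g\<rbrakk>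
      \<Longrightarrow> br (x \<oplus>\<^bsub>g\<^esub> y) z = br x z \<oplus>\<^bsub>g\<^esub> br y z"
    and br_add_right: "\<lbrakk>x \<in> carrier g; y \<in> carrier g; z \<in> carrier g\<rbrakk>
      \<Longrightarrow> br x (y \<oplus>\<^bsub>g\<^esub> z) = br x y \<oplus>\<^bsub>g\<^esub> br x z"
    and br_smult_left: "\<lbrakk>c \<in> carrier K; x \<in> carrier g; y \<in> carrier g\<rbrakk>
      \<Longrightarrow> br ((c \<odot>\<^bsub>A\<^esub> \<one>\<^bsub>A\<^esub>) \<odot>\<^bsub>g\<^esub> x) y = (c \<odot>\<^bsub>A\<^esub> \<one>\<^bsub>A\<^esub>) \<odot>\<^bsub>g\<^esub> br x y"
    and br_smult_right: "\<lbrakk>c \<in> carrier K; x \<in> carrier g; y \<in> carrier g\<rbrakk>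
      \<Longrightarrow> br x ((c \<odot>\<^bsub>A\<^esub> \<one>\<^bsub>A\<^esub>) \<odot>\<^bsub>g\<^esub> y) = (c \<odot>\<^bsub>A\<^esub> \<one>\<^bsub>A\<^esub>) \<odot>\<^bsub>g\<^esub> br x y"
    and br_alternating: "x \<in> carrier g \<Longrightarrow> br x x = \<zero>\<^bsub>g\<^esub>"
    and jacobi: "\<lbrakk>x \<in> carrier g; y \<in> carrier g; z \<in> carrier g\<rbrakk>
      \<Longrightarrow> br x (br y z) \<oplus>\<^bsub>g\<^esub> br y (br z x) \<oplus>\<^bsub>g\<^esub> br z (br x y) = \<zero>\<^bsub>g\<^esub>"
    and anchor_derivation: "x \<in> carrier g \<Longrightarrow> \<alpha> x \<in> derivations K A"
    and anchor_add: "\<lbrakk>x \<in> carrier g; y \<in> carrier g; a \<in> carrier A\<rbrakk>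
      \<Longrightarrow> \<alpha> (x \<oplus>\<^bsub>g\<^esub> y) a = \<alpha> x a \<oplus>\<^bsub>A\<^esub> \<alpha> y a"
    and anchor_smult: "\<lbrakk>r \<in> carrier A; x \<in> carrier g; a \<in> carrier A\<rbrakk>
      \<Longrightarrow> \<alpha> (r \<odot>\<^bsub>g\<^esub> x) a = r \<otimes>\<^bsub>A\<^esub> \<alpha> x a"
    and anchor_br: "\<lbrakk>x \<in> carrier g; y \<in> carrier g; a \<in> carrier A\<rbrakk>
      \<Longrightarrow> \<alpha> (br x y) a = \<alpha> x (\<alpha> y a) \<ominus>\<^bsub>A\<^esub> \<alpha> y (\<alpha> x a)"
    and leibniz: "\<lbrakk>x \<in> carrier g; r \<in> carrier A; y \<in> carrier g\<rbrakk>
      \<Longrightarrow> br x (r \<odot>\<^bsub>g\<^esub> y) = (\<alpha> x r \<odot>\<^bsub>g\<^esub> y) \<oplus>\<^bsub>g\<^esub> (r \<odot>\<^bsub>g\<^esub> br x y)"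

text \<open>Length of an \<open>A\<close>-module \<open>M\<close> with an action \<open>\<rho>\<close> of the Lie algebroid \<open>g\<close>.\<close>

definition lie_length ::
  "('a, 'y) ring_scheme \<Rightarrow> ('a, 'g, 'x) module_scheme \<Rightarrow> ('g \<Rightarrow> 'm \<Rightarrow> 'm)
    \<Rightarrow> ('a, 'm, 'w) module_scheme \<Rightarrow> enat" where
  "lie_length A g \<rho> M =
     chain_length {N. submodule N A M \<and> (\<forall>\<delta>\<in>carrier g. \<forall>x\<in>N. \<rho> \<delta> x \<in> N)}"

text \<open>\<open>A/J\<close> as an \<open>A\<close>-module, and the map \<open>J + a \<mapsto> J + D a\<close> which a derivation \<open>D\<close>
  preserving \<open>J\<close> induces on it; the union in the latter serves to avoid choosing a
  representative, as in \<^const>\<open>rcoset_mult\<close>.\<close>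

definition quotient_module :: "('a, 'y) ring_scheme \<Rightarrow> 'a set \<Rightarrow> ('a, 'a set) module" where
  "quotient_module A J =
     ring.extend (A Quot J) (module.fields (\<lambda>a Y. (J +>\<^bsub>A\<^esub> a) \<otimes>\<^bsub>A Quot J\<^esub> Y))"

definition quotient_map :: "('a, 'y) ring_scheme \<Rightarrow> 'a set \<Rightarrow> ('a \<Rightarrow> 'a) \<Rightarrow> 'a set \<Rightarrow> 'a set" where
  "quotient_map A J D Y = (\<Union>x\<in>Y. J +>\<^bsub>A\<^esub> D x)"

definition defining_ideal ::
  "('a, 'y) ring_scheme \<Rightarrow> ('a, 'g, 'x) module_scheme \<Rightarrow> ('g \<Rightarrow> 'a \<Rightarrow> 'a) \<Rightarrow> 'a set \<Rightarrow> bool" where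
  "defining_ideal A g \<alpha> J \<longleftrightarrow>
     ideal J A \<and> J \<noteq> carrier A \<and> (\<forall>\<delta>\<in>carrier g. \<forall>a\<in>J. \<alpha> \<delta> a \<in> J) \<and>
     lie_length A g (\<lambda>\<delta>. quotient_map A J (\<alpha> \<delta>)) (quotient_module A J) < \<infinity>"

definition maximal_defining_ideal ::
  "('a, 'y) ring_scheme \<Rightarrow> ('a, 'g, 'x) module_scheme \<Rightarrow> ('g \<Rightarrow> 'a \<Rightarrow> 'a) \<Rightarrow> 'a set \<Rightarrow> bool" where
  "maximal_defining_ideal A g \<alpha> J \<longleftrightarrow>
     defining_ideal A g \<alpha> J \<and> (\<forall>J'. defining_ideal A g \<alpha> J' \<and> J \<subseteq> J' \<longrightarrow> J' = J)"

end

theory Submission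
  imports Defs
begin

text \<open>
  Write \<open>A = S/I\<close> with \<open>S\<close> regular local of dimension \<open>n\<close> satisfying the weak Jacobian condition. The
  argument takes place in \<open>S\<close>. Gauss elimination turns the Jacobian condition into
  generators \<open>f\<^sub>0, \<dots>, f\<^bsub>n-1\<^esub>\<close> of the maximal ideal \<open>M\<close> with dual derivations, \<open>d\<^sub>i f\<^sub>j = \<delta>\<^sub>i\<^sub>j\<close>
  (\<open>coordinates_exist\<close>). For a set \<open>T\<close> of indices let \<open>I\<^sub>T\<close> be the ideal generated by the \<open>f\<^sub>i\<close> with
  \<open>i \<in> T\<close>. Krull's intersection theorem, the dual derivations and characteristic \<open>0\<close> show that \<open>I\<^sub>T\<close> is
  prime (\<open>coord_ideal_prime\<close>) and that it is the only proper ideal containing \<open>I\<^sub>T\<close> that is stable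
  under all \<open>d\<^sub>i\<close> with \<open>i \<notin> T\<close> (\<open>stable_ideal_eq_coord_ideal\<close>). Since the dimension of \<open>S\<close> is known to
  be \<open>n\<close>, chains of the primes \<open>I\<^sub>T\<close> suffice to compute the dimension of \<open>S/I\<^sub>T\<close> as \<open>n - |T|\<close>, so that
  this quotient is regular (\<open>coord_quotient_regular\<close>).

  The derivations in the image of the anchor lift to \<open>S\<close> (\<open>derivation_lift\<close>). Let \<open>P\<close> be the preimage
  in \<open>S\<close> of a maximal defining ideal \<open>J\<close>. It is maximal among the proper ideals stable under the lifted
  derivations, because any larger stable proper ideal of \<open>A\<close> would again be defining. By exchange one may
  choose the coordinates so that for some \<open>T\<close> the \<open>f\<^sub>i\<close> with \<open>i \<in> T\<close> are in \<open>P\<close>, while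
  \<open>d\<^sub>j P \<subseteq> M\<close> for \<open>j \<notin> T\<close>. The ideal generated by \<open>P\<close> and these \<open>d\<^sub>j P\<close> is proper and stable, since
  commutators of derivations are combinations of the \<open>d\<^sub>i\<close>; hence it is \<open>P\<close>, so \<open>P\<close> is
  stable under the \<open>d\<^sub>j\<close>, \<open>j \<notin> T\<close>, and \<open>P = I\<^sub>T\<close> (\<open>maximal_stable_eq_coord_ideal\<close>). Therefore
  \<open>A/J = S/I\<^sub>T\<close> is regular and \<open>J\<close> is prime.

  If \<open>A\<close> is regular, a count of dimensions shows that \<open>I\<close> itself is of the form \<open>I\<^sub>T\<close> for suitable
  coordinates (\<open>regular_quotient_kernel\<close>). The coordinates for \<open>P\<close> can be chosen to extend the
  generators of \<open>I\<close>, and the remaining coordinates in \<open>P\<close> give the generators of \<open>J\<close>.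

  For a defining ideal \<open>J\<close> and a maximal defining ideal \<open>J' \<supseteq> J\<close>, the stable ideals \<open>J'^k + J\<close> form a
  descending chain, which stops because the length of \<open>A/J\<close> is finite. By Nakayama's lemma a power of
  \<open>J'\<close> lies in \<open>J\<close>. As \<open>J'\<close> is prime, it is the radical of \<open>J\<close>.
\<close>

text \<open>The symbol \<open><+>\<close> always denotes the sum of ideals.\<close>

no_notation Sum_Type.Plus (infixr "<+>" 65)

section \<open>Ideals in commutative rings\<close>

context cring
begin

lemma ideal_cringI:
  assumes "I \<subseteq> carrier R" "\<zero> \<in> I"
    and add: "\<And>a b. a \<in> I \<Longrightarrow> b \<in> I \<Longrightarrow> a \<oplus> b \<in> I"
    and mult: "\<And>a x. a \<in> I \<Longrightarrow> x \<in> carrier R \<Longrightarrow> x \<otimes> a \<in> I"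
  shows "ideal I R"
proof (rule idealI)
  show "ring R" by (rule ring_axioms)
  have neg: "\<ominus> a \<in> I" if "a \<in> I" for a
  proof -
    have "\<ominus> a = (\<ominus> \<one>) \<otimes> a" using that assms(1) by (simp add: subsetD l_minus)
    then show ?thesis using mult[OF that, of "\<ominus> \<one>"] by simp
  qed
  show "subgroup I (add_monoid R)"
    by (rule add.subgroupI) (use assms neg in \<open>auto simp: a_inv_def[symmetric]\<close>)
  show "x \<otimes> a \<in> I" if "a \<in> I" "x \<in> carrier R" for a x using mult that by blast
  show "a \<otimes> x \<in> I" if "a \<in> I" "x \<in> carrier R" for a x
    using mult[OF that] m_comm[of a x] that assms(1) by auto
qed

lemma
  assumes "ideal I R"
  shows ideal_subset: "I \<subseteq> carrier R"
    and ideal_zero: "\<zero> \<in> I"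
    and ideal_add: "\<And>a b. a \<in> I \<Longrightarrow> b \<in> I \<Longrightarrow> a \<oplus> b \<in> I"
    and ideal_mult: "\<And>a x. a \<in> I \<Longrightarrow> x \<in> carrier R \<Longrightarrow> x \<otimes> a \<in> I"
    and ideal_mult_r: "\<And>a x. a \<in> I \<Longrightarrow> x \<in> carrier R \<Longrightarrow> a \<otimes> x \<in> I"
    and ideal_neg: "\<And>a. a \<in> I \<Longrightarrow> \<ominus> a \<in> I"
    and ideal_minus: "\<And>a b. a \<in> I \<Longrightarrow> b \<in> I \<Longrightarrow> a \<ominus> b \<in> I"
proof -
  interpret ideal I R by fact
  show "I \<subseteq> carrier R" by (rule a_subset)
  show "\<zero> \<in> I" by simp
  show "\<And>a b. a \<in> I \<Longrightarrow> b \<in> I \<Longrightarrow> a \<oplus> b \<in> I" by simp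
  show "\<And>a x. a \<in> I \<Longrightarrow> x \<in> carrier R \<Longrightarrow> x \<otimes> a \<in> I" by (rule I_l_closed)
  show "\<And>a x. a \<in> I \<Longrightarrow> x \<in> carrier R \<Longrightarrow> a \<otimes> x \<in> I" by (rule I_r_closed)
  show "\<And>a. a \<in> I \<Longrightarrow> \<ominus> a \<in> I" by simp
  then show "\<And>a b. a \<in> I \<Longrightarrow> b \<in> I \<Longrightarrow> a \<ominus> b \<in> I" by (simp add: minus_eq)
qed

lemma ideal_add_cancel:
  assumes "ideal I R" "a \<oplus> b \<in> I" "b \<in> I" "a \<in> carrier R"
  shows "a \<in> I"
proof -
  have "b \<in> carrier R" using assms ideal_subset by blast
  then have "a = (a \<oplus> b) \<ominus> b" using assms(4) by algebra
  then show ?thesis using ideal_minus[OF assms(1,2,3)] by simp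
qed

lemma ideal_unit:
  assumes "ideal I R" "u \<in> Units R" "a \<in> carrier R" "u \<otimes> a \<in> I"
  shows "a \<in> I"
proof -
  have "inv u \<otimes> (u \<otimes> a) = a"
    using assms by (metis Units_closed Units_inv_closed Units_l_inv l_one m_assoc)
  then show ?thesis using ideal_mult[OF assms(1,4), of "inv u"] assms(2) by auto
qed

lemma ideal_proper_iff: "ideal I R \<Longrightarrow> I \<noteq> carrier R \<longleftrightarrow> \<one> \<notin> I"
  using ideal.one_imp_carrier by blast

lemma set_add_iff: "x \<in> I <+> J \<longleftrightarrow> (\<exists>a\<in>I. \<exists>b\<in>J. x = a \<oplus> b)"
  by (auto simp: set_add_defs)

lemma ideal_sum_left:
  assumes "ideal I R" "ideal J R" shows "I \<subseteq> I <+> J"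
proof
  fix x assume "x \<in> I"
  then have "x = x \<oplus> \<zero>" "\<zero> \<in> J" using assms ideal_zero ideal_subset[OF assms(1)] by auto
  then show "x \<in> I <+> J" using \<open>x \<in> I\<close> set_add_iff by blast
qed

lemma ideal_sum_right:
  assumes "ideal I R" "ideal J R" shows "J \<subseteq> I <+> J"
proof
  fix x assume "x \<in> J"
  then have "x = \<zero> \<oplus> x" "\<zero> \<in> I" using assms ideal_zero ideal_subset[OF assms(2)] by auto
  then show "x \<in> I <+> J" using \<open>x \<in> J\<close> set_add_iff by blast
qed

lemma ideal_sum_least: "ideal L R \<Longrightarrow> I \<subseteq> L \<Longrightarrow> J \<subseteq> L \<Longrightarrow> I <+> J \<subseteq> L"
  by (fastforce simp: set_add_iff intro: ideal_add)

lemma ideal_prod_least: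
  "ideal L R \<Longrightarrow> (\<And>i j. i \<in> I \<Longrightarrow> j \<in> J \<Longrightarrow> i \<otimes> j \<in> L) \<Longrightarrow> I \<cdot> J \<subseteq> L"
proof
  fix x assume L: "ideal L R" "\<And>i j. i \<in> I \<Longrightarrow> j \<in> J \<Longrightarrow> i \<otimes> j \<in> L" and "x \<in> I \<cdot> J"
  from this(3) show "x \<in> L" by induct (auto intro: L ideal_add[OF L(1)])
qed

lemma add_cgenidealE:
  assumes "x \<in> I <+> PIdl a"
  obtains q c where "q \<in> I" "c \<in> carrier R" "x = q \<oplus> c \<otimes> a"
proof -
  obtain q p where "q \<in> I" "p \<in> PIdl a" "x = q \<oplus> p" using assms set_add_iff by blast
  then show ?thesis using that by (auto simp: cgenideal_def)
qed

text \<open>Passing from \<open>B\<close> to \<open>B \<union> {a}\<close> adds the multiples of \<open>a\<close> to the generated ideal.\<close>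

lemma genideal_insertE:
  assumes "B \<subseteq> carrier R" "a \<in> carrier R" "x \<in> Idl (insert a B)"
  obtains q c where "q \<in> Idl B" "c \<in> carrier R" "x = q \<oplus> c \<otimes> a"
proof -
  have 1: "ideal (Idl B) R" "ideal (PIdl a) R" using assms genideal_ideal cgenideal_ideal by auto
  have "insert a B \<subseteq> Idl B <+> PIdl a"
    using ideal_sum_left[OF 1] ideal_sum_right[OF 1] genideal_self[OF assms(1)]
      cgenideal_self[OF assms(2)] by blast
  then have "Idl (insert a B) \<subseteq> Idl B <+> PIdl a"
    using genideal_minimal[OF add_ideals[OF 1]] by blast
  then show ?thesis using assms(3) that add_cgenidealE by blast
qed

lemma genideal_mono: "B \<subseteq> Y \<Longrightarrow> Y \<subseteq> carrier R \<Longrightarrow> Idl B \<subseteq> Idl Y"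
  by (meson genideal_ideal genideal_minimal genideal_self order_trans)

end

lemma (in noetherian_ring) ideal_maximal_element:
  assumes "Q I\<^sub>0" "\<And>I. Q I \<Longrightarrow> ideal I R"
  shows "\<exists>L. Q L \<and> (\<forall>I. Q I \<longrightarrow> L \<subseteq> I \<longrightarrow> I = L)"
proof -
  let ?F = "Collect Q"
  have "\<exists>U\<in>?F. \<forall>I\<in>C. I \<subseteq> U" if C: "subset.chain ?F C" for C
  proof (cases "C = {}")
    case False
    have "subset.chain {I. ideal I R} C" using C assms(2) unfolding pred_on.chain_def by auto
    from ideal_chain_is_trivial[OF False this] have "\<Union>C \<in> ?F"
      using C unfolding pred_on.chain_def by (meson subsetD)
    then show ?thesis by (intro bexI[of _ "\<Union>C"]) auto
  qed (use assms in auto)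
  then have "\<exists>L\<in>?F. \<forall>I\<in>?F. L \<subseteq> I \<longrightarrow> I = L" by (rule subset_Zorn)
  then show ?thesis by simp
qed


section \<open>Noetherian local rings\<close>

text \<open>A Noetherian local ring together with its maximal ideal: every element outside the proper
  ideal \<open>M\<close> is a unit.\<close>

locale noetherian_local_ring = cring R + noetherian_ring R for R (structure) +
  fixes M :: "'a set"
  assumes M_ideal: "ideal M R"
    and one_notin_M: "\<one> \<notin> M"
    and unit_if_notin_M: "x \<in> carrier R \<Longrightarrow> x \<notin> M \<Longrightarrow> x \<in> Units R"
begin

lemma M_subset: "M \<subseteq> carrier R"
  using ideal_subset[OF M_ideal] .

lemma M_closed [simp]: "x \<in> M \<Longrightarrow> x \<in> carrier R"
  using M_subset by blast

lemma proper_ideal_subset_M: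
  assumes "ideal I R" "\<one> \<notin> I" shows "I \<subseteq> M"
proof
  fix x assume x: "x \<in> I"
  show "x \<in> M"
  proof (rule ccontr)
    assume "x \<notin> M"
    then have "x \<in> Units R" using unit_if_notin_M x ideal_subset[OF assms(1)] by blast
    then have "x \<otimes> \<one> \<in> I \<Longrightarrow> \<one> \<in> I" using ideal_unit[OF assms(1), of x \<one>] by simp
    then show False using x assms ideal_subset[OF assms(1)] by (simp add: subsetD)
  qed
qed

lemma add_M_unit:
  assumes "u \<in> carrier R" "u \<notin> M" "x \<in> M" shows "u \<oplus> x \<in> Units R"
  using ideal_add_cancel[OF M_ideal _ assms(3,1)] unit_if_notin_M[of "u \<oplus> x"] assms by auto

lemma one_minus_M_unit: "x \<in> M \<Longrightarrow> \<one> \<ominus> x \<in> Units R"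
  using add_M_unit[of \<one> "\<ominus> x"] one_notin_M ideal_neg[OF M_ideal] by (simp add: minus_eq)

text \<open>Nakayama's lemma. An ideal \<open>L \<supseteq> I\<close> maximal among those not containing \<open>N\<close> leads to a
  contradiction, since \<open>N \<subseteq> L + (b)\<close> for each \<open>b \<in> N - L\<close>.\<close>

lemma nakayama:
  assumes N: "ideal N R" and I: "ideal I R" and sub: "N \<subseteq> (M \<cdot> N) <+> I"
  shows "N \<subseteq> I"
proof (rule ccontr)
  assume nI: "\<not> N \<subseteq> I"
  obtain L where L: "ideal L R" "I \<subseteq> L" "\<not> N \<subseteq> L"
    and max: "\<forall>L'. ideal L' R \<and> I \<subseteq> L' \<and> \<not> N \<subseteq> L' \<longrightarrow> L \<subseteq> L' \<longrightarrow> L' = L"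
    using ideal_maximal_element[of "\<lambda>L. ideal L R \<and> I \<subseteq> L \<and> \<not> N \<subseteq> L", OF conjI[OF I conjI[OF order_refl nI]]]
    by (elim exE conjE meta_impE) simp
  obtain b where b: "b \<in> N" "b \<notin> L" using L by blast
  have bc: "b \<in> carrier R" using b ideal_subset[OF N] by blast
  have Lc: "L \<subseteq> carrier R" using ideal_subset[OF L(1)] .
  have iL: "ideal (L <+> PIdl b) R" using add_ideals[OF L(1) cgenideal_ideal[OF bc]] .
  have LL: "L \<subseteq> L <+> PIdl b" "b \<in> L <+> PIdl b"
    using ideal_sum_left[OF L(1) cgenideal_ideal[OF bc]]
      ideal_sum_right[OF L(1) cgenideal_ideal[OF bc]] cgenideal_self[OF bc] by blast+
  have NL: "N \<subseteq> L <+> PIdl b"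
    using max iL LL L(2) b(2) order_trans[OF L(2) LL(1)] by blast
  let ?Q = "{l \<oplus> \<mu> \<otimes> b | l \<mu>. l \<in> L \<and> \<mu> \<in> M}"
  have Qadd: "s \<oplus> t \<in> ?Q" if "s \<in> ?Q" "t \<in> ?Q" for s t
  proof -
    obtain l \<mu> l' \<mu>' where *: "l \<in> L" "\<mu> \<in> M" "l' \<in> L" "\<mu>' \<in> M" "s = l \<oplus> \<mu> \<otimes> b" "t = l' \<oplus> \<mu>' \<otimes> b"
      using \<open>s \<in> ?Q\<close> \<open>t \<in> ?Q\<close> by blast
    have "l \<in> carrier R" "l' \<in> carrier R" "\<mu> \<in> carrier R" "\<mu>' \<in> carrier R" using * Lc by auto
    then have "s \<oplus> t = (l \<oplus> l') \<oplus> (\<mu> \<oplus> \<mu>') \<otimes> b" using bc unfolding *(5,6) by algebra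
    then show ?thesis using * ideal_add[OF L(1)] ideal_add[OF M_ideal] by blast
  qed
  have Qprod: "s \<in> ?Q" if "s \<in> M \<cdot> N" for s
    using that
  proof induct
    case (prod i j)
    then obtain l r where *: "l \<in> L" "r \<in> carrier R" "j = l \<oplus> r \<otimes> b"
      using NL add_cgenidealE by blast
    have "l \<in> carrier R" "i \<in> carrier R" using * Lc prod(1) by auto
    then have "i \<otimes> j = i \<otimes> l \<oplus> (r \<otimes> i) \<otimes> b" using bc *(2) unfolding *(3) by algebra
    then show ?case
      using * prod(1) ideal_mult[OF L(1), of l i] ideal_mult[OF M_ideal, of i r] by auto
  qed (rule Qadd)
  obtain s i where s: "s \<in> M \<cdot> N" "i \<in> I" "b = s \<oplus> i" using sub b(1) set_add_iff by blast
  then obtain l \<mu> where *: "l \<in> L" "\<mu> \<in> M" "s = l \<oplus> \<mu> \<otimes> b" using Qprod[OF s(1)] by blast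
  have ic: "i \<in> L" "i \<in> carrier R" "l \<in> carrier R" using s(2) L(2) Lc * by auto
  have \<mu>c: "\<mu> \<in> carrier R" using * by simp
  have "b = l \<oplus> \<mu> \<otimes> b \<oplus> i" using s(3) unfolding *(3) .
  from arg_cong[OF this, of "\<lambda>z. z \<ominus> \<mu> \<otimes> b"]
  have "b \<ominus> \<mu> \<otimes> b = (l \<oplus> \<mu> \<otimes> b \<oplus> i) \<ominus> \<mu> \<otimes> b" .
  also have "\<dots> = l \<oplus> i" using bc \<mu>c ic by algebra
  also have "b \<ominus> \<mu> \<otimes> b = (\<one> \<ominus> \<mu>) \<otimes> b" using bc \<mu>c by algebra
  finally have "(\<one> \<ominus> \<mu>) \<otimes> b \<in> L" using ideal_add[OF L(1)] * ic by simp
  then show False using ideal_unit[OF L(1) one_minus_M_unit[OF *(2)] bc] b by blast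
qed

text \<open>The powers of the maximal ideal.\<close>

primrec M_pow :: "nat \<Rightarrow> 'a set" where
  "M_pow 0 = carrier R"
| "M_pow (Suc k) = M \<cdot> M_pow k"

lemma M_pow_ideal: "ideal (M_pow k) R"
  by (induct k) (auto simp: oneideal ideal_prod_is_ideal M_ideal)

lemma M_pow_closed: "x \<in> M_pow k \<Longrightarrow> x \<in> carrier R"
  using ideal_subset[OF M_pow_ideal] by blast

lemma M_pow_1: "M_pow (Suc 0) = M"
  using ideal_prod_one[OF M_ideal] by simp

lemma M_pow_SucI: "x \<in> M \<Longrightarrow> y \<in> M_pow k \<Longrightarrow> x \<otimes> y \<in> M_pow (Suc k)"
  by (simp add: ideal_prod.prod)

lemma M_pow_add: "M_pow (j + k) = M_pow j \<cdot> M_pow k"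
proof (induct j)
  case 0
  then show ?case
    using ideal_prod_one[OF M_pow_ideal] ideal_prod_commute[OF oneideal M_pow_ideal] by simp
next
  case (Suc j)
  then show ?case by (simp add: ideal_prod_assoc M_ideal M_pow_ideal)
qed

lemma M_pow_pow: "x \<in> M \<Longrightarrow> x [^] (k::nat) \<in> M_pow k"
proof (induct k)
  case (Suc k)
  then show ?case using M_pow_SucI[of x "x [^] k" k] by (simp add: m_comm)
qed simp

text \<open>An ideal containing a power of each element of \<open>M\<close> contains a power of \<open>M\<close>.\<close>

lemma M_pow_subset_if_nil:
  assumes L: "ideal L R" and nil: "\<And>x. x \<in> M \<Longrightarrow> \<exists>s::nat. x [^] s \<in> L"
  shows "\<exists>t. M_pow t \<subseteq> L"
proof (rule ccontr)
  assume "\<nexists>t. M_pow t \<subseteq> L"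
  then obtain P where P: "ideal P R" "L \<subseteq> P" "\<And>t. \<not> M_pow t \<subseteq> P"
    and max: "\<forall>I. ideal I R \<and> L \<subseteq> I \<and> (\<forall>t. \<not> M_pow t \<subseteq> I) \<longrightarrow> P \<subseteq> I \<longrightarrow> I = P"
    using ideal_maximal_element[of "\<lambda>I. ideal I R \<and> L \<subseteq> I \<and> (\<forall>t. \<not> M_pow t \<subseteq> I)" L] L
    by (elim exE conjE meta_impE) auto
  have big: "\<exists>t. M_pow t \<subseteq> P <+> PIdl x" if "x \<in> carrier R" "x \<notin> P" for x
  proof (rule ccontr)
    assume a: "\<nexists>t. M_pow t \<subseteq> P <+> PIdl x"
    have "P <+> PIdl x = P"
      using max add_ideals[OF P(1) cgenideal_ideal[OF that(1)]] a P(2)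
        ideal_sum_left[OF P(1) cgenideal_ideal[OF that(1)]] by (meson order_trans)
    then show False
      using that ideal_sum_right[OF P(1) cgenideal_ideal] cgenideal_self by blast
  qed
  obtain x where x: "x \<in> M" "x \<notin> P" using P(3)[of "Suc 0"] unfolding M_pow_1 by blast
  have xc: "x \<in> carrier R" using x by simp
  define s where "s = (LEAST s::nat. x [^] s \<in> P)"
  have s: "x [^] s \<in> P"
    unfolding s_def using nil[OF x(1)] P(2) by (meson LeastI_ex subsetD)
  have "s \<noteq> 0"
  proof
    assume "s = 0"
    then have "\<one> \<in> P" using s by simp
    then show False using P(3)[of 0] ideal.one_imp_carrier[OF P(1)] by simp
  qed
  then obtain s' where s': "s = Suc s'" by (cases s) auto
  define y where "y = x [^] s'"
  have y: "y \<notin> P" "y \<in> carrier R" "y \<otimes> x \<in> P"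
    using s s' not_less_Least[of s' "\<lambda>s. x [^] s \<in> P"] xc by (auto simp: s_def[symmetric] y_def)
  obtain t1 t2 where t: "M_pow t1 \<subseteq> P <+> PIdl y" "M_pow t2 \<subseteq> P <+> PIdl x"
    using big[OF y(2,1)] big[OF xc x(2)] by (elim exE)
  have "M_pow t1 \<cdot> M_pow t2 \<subseteq> P"
  proof (rule ideal_prod_least[OF P(1)])
    fix i j assume "i \<in> M_pow t1" "j \<in> M_pow t2"
    then obtain p a q b where *: "p \<in> P" "a \<in> carrier R" "i = p \<oplus> a \<otimes> y"
      "q \<in> P" "b \<in> carrier R" "j = q \<oplus> b \<otimes> x"
      using t by (meson add_cgenidealE subsetD)
    have pq: "p \<in> carrier R" "q \<in> carrier R" using * ideal_subset[OF P(1)] by auto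
    have "i \<otimes> j = (j \<otimes> p) \<oplus> (a \<otimes> y) \<otimes> q \<oplus> (a \<otimes> b) \<otimes> (y \<otimes> x)"
      using * pq xc y by (simp; algebra)
    moreover have "j \<in> carrier R" using * pq xc by simp
    ultimately show "i \<otimes> j \<in> P"
      using ideal_add[OF P(1)] ideal_mult[OF P(1)] * y by simp
  qed
  then show False using P(3)[of "t1 + t2"] by (simp add: M_pow_add)
qed

text \<open>Krull's intersection theorem, relative to an ideal \<open>I\<close>. With \<open>N\<close> the intersection, an ideal
  \<open>L\<close> maximal with \<open>L \<inter> N = M N + I\<close> contains a power of each \<open>x \<in> M\<close>: when the colon ideals
  \<open>L : x^s\<close> have become stationary, \<open>L + (x^s)\<close> still has the same intersection with \<open>N\<close>. Hence
  \<open>N \<subseteq> L\<close>, so that \<open>N = M N + I\<close>.\<close>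

theorem krull_intersection:
  assumes I: "ideal I R" and y: "y \<in> carrier R" "\<And>k. y \<in> I <+> M_pow k"
  shows "y \<in> I"
proof -
  define N where "N = (\<Inter>k. I <+> M_pow k)"
  have N: "ideal N R" unfolding N_def
    using i_Intersect[of "range (\<lambda>k. I <+> M_pow k)"] add_ideals[OF I M_pow_ideal] by auto
  have IN: "I \<subseteq> N" unfolding N_def using ideal_sum_left[OF I M_pow_ideal] by blast
  define Z where "Z = (M \<cdot> N) <+> I"
  have MN: "ideal (M \<cdot> N) R" by (rule ideal_prod_is_ideal[OF M_ideal N])
  have Z: "ideal Z R" "M \<cdot> N \<subseteq> Z" "I \<subseteq> Z" "Z \<subseteq> N"
    unfolding Z_def
    using add_ideals[OF MN I] ideal_sum_left[OF MN I] ideal_sum_right[OF MN I]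
      ideal_sum_least[OF N _ IN] ideal_prod_inter[OF M_ideal N] by auto
  obtain L where L: "ideal L R" "L \<inter> N = Z"
    and max: "\<forall>L'. ideal L' R \<and> L' \<inter> N = Z \<longrightarrow> L \<subseteq> L' \<longrightarrow> L' = L"
    using ideal_maximal_element[of "\<lambda>L. ideal L R \<and> L \<inter> N = Z" Z] Z
    by (elim exE conjE meta_impE) auto
  have Lc: "L \<subseteq> carrier R" using ideal_subset[OF L(1)] .
  have "\<exists>s::nat. x [^] s \<in> L" if x: "x \<in> M" for x
  proof -
    have xc: "x \<in> carrier R" using x by simp
    define Q where "Q s = {r \<in> carrier R. x [^] (s::nat) \<otimes> r \<in> L}" for s
    have Q: "ideal (Q s) R" for s
      unfolding Q_def using xc
      by (intro ideal_cringI)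
        (auto simp: r_distr ideal_add[OF L(1)] ideal_zero[OF L(1)] m_lcomm ideal_mult[OF L(1)])
    have "\<exists>L. (\<exists>s. L = Q s) \<and> (\<forall>I. (\<exists>s. I = Q s) \<longrightarrow> L \<subseteq> I \<longrightarrow> I = L)"
      by (rule ideal_maximal_element) (use Q in blast)+
    then obtain L' s where s: "L' = Q s" "\<forall>I. (\<exists>s. I = Q s) \<longrightarrow> L' \<subseteq> I \<longrightarrow> I = L'"
      by (elim exE conjE)
    have "Q s \<subseteq> Q (Suc s)"
    proof
      fix r assume "r \<in> Q s"
      then have r: "r \<in> carrier R" "x [^] s \<otimes> r \<in> L" by (auto simp: Q_def)
      have "x [^] Suc s \<otimes> r = x \<otimes> (x [^] s \<otimes> r)"
        using r(1) xc nat_pow_closed[OF xc, of s] unfolding nat_pow_Suc by algebra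
      then show "r \<in> Q (Suc s)" using r ideal_mult[OF L(1) r(2) xc] by (simp add: Q_def)
    qed
    then have Qs: "Q (Suc s) = Q s"
      using s(2)[rule_format, of "Q (Suc s)"] unfolding s(1) by blast
    let ?L = "L <+> PIdl (x [^] s)"
    have iL: "ideal ?L R" "L \<subseteq> ?L" "x [^] s \<in> ?L"
      using add_ideals[OF L(1) cgenideal_ideal] ideal_sum_left[OF L(1) cgenideal_ideal]
        ideal_sum_right[OF L(1) cgenideal_ideal] cgenideal_self[of "x [^] s"] xc nat_pow_closed
      by blast+
    have "?L \<inter> N \<subseteq> Z"
    proof
      fix w assume w: "w \<in> ?L \<inter> N"
      then obtain l r where *: "l \<in> L" "r \<in> carrier R" "w = l \<oplus> r \<otimes> x [^] s"
        using add_cgenidealE by blast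
      have lc: "l \<in> carrier R" using * Lc by auto
      have "x \<otimes> w \<in> L" using ideal_prod.prod[OF x, of w N R] w Z(2) L(2) by blast
      moreover have "x \<otimes> w = x [^] Suc s \<otimes> r \<oplus> x \<otimes> l"
        using *(2) xc lc nat_pow_closed[OF xc, of s] unfolding *(3) nat_pow_Suc by algebra
      ultimately have "x [^] Suc s \<otimes> r \<in> L"
        using ideal_add_cancel[OF L(1), of "x [^] Suc s \<otimes> r" "x \<otimes> l"]
          ideal_mult[OF L(1) *(1) xc] * xc by simp
      then have "r \<in> Q s" using Qs * unfolding Q_def by auto
      then have "x [^] s \<otimes> r \<in> L" unfolding Q_def by auto
      then have "w \<in> L" using * ideal_add[OF L(1)] xc by (simp add: m_comm)
      then show "w \<in> Z" using w L by blast
    qed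
    then have "?L \<inter> N = Z" using iL L by blast
    then show ?thesis using max iL by blast
  qed
  then obtain t where t: "M_pow t \<subseteq> L" using M_pow_subset_if_nil[OF L(1)] by blast
  have "I \<subseteq> L" using Z L by blast
  then have "N \<subseteq> L" unfolding N_def using ideal_sum_least[OF L(1) _ t] by blast
  then have "N \<subseteq> (M \<cdot> N) <+> I" using L(2) unfolding Z_def by blast
  then have "N \<subseteq> I" by (rule nakayama[OF N I])
  then show ?thesis using y unfolding N_def by blast
qed

end


section \<open>Derivations\<close>

text \<open>The derivations of \<open>R\<close> that vanish on a set \<open>C\<close> of constants.\<close>

definition derivs :: "('a, 'b) ring_scheme \<Rightarrow> 'a set \<Rightarrow> ('a \<Rightarrow> 'a) set" where
  "derivs R C = {D. D \<in> carrier R \<rightarrow> carrier R \<and>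
     (\<forall>a\<in>carrier R. \<forall>b\<in>carrier R. D (a \<oplus>\<^bsub>R\<^esub> b) = D a \<oplus>\<^bsub>R\<^esub> D b) \<and>
     (\<forall>a\<in>carrier R. \<forall>b\<in>carrier R. D (a \<otimes>\<^bsub>R\<^esub> b) = (D a \<otimes>\<^bsub>R\<^esub> b) \<oplus>\<^bsub>R\<^esub> (a \<otimes>\<^bsub>R\<^esub> D b)) \<and>
     (\<forall>c\<in>C. D c = \<zero>\<^bsub>R\<^esub>)}"

lemma
  assumes "D \<in> derivs R C"
  shows deriv_closed: "\<And>a. a \<in> carrier R \<Longrightarrow> D a \<in> carrier R"
    and deriv_add: "\<And>a b. a \<in> carrier R \<Longrightarrow> b \<in> carrier R \<Longrightarrow> D (a \<oplus>\<^bsub>R\<^esub> b) = D a \<oplus>\<^bsub>R\<^esub> D b"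
    and deriv_mult: "\<And>a b. a \<in> carrier R \<Longrightarrow> b \<in> carrier R \<Longrightarrow>
      D (a \<otimes>\<^bsub>R\<^esub> b) = (D a \<otimes>\<^bsub>R\<^esub> b) \<oplus>\<^bsub>R\<^esub> (a \<otimes>\<^bsub>R\<^esub> D b)"
    and deriv_const: "\<And>c. c \<in> C \<Longrightarrow> D c = \<zero>\<^bsub>R\<^esub>"
  using assms by (auto simp: derivs_def)

context cring
begin

lemma derivsI:
  assumes "\<And>a. a \<in> carrier R \<Longrightarrow> D a \<in> carrier R"
    and "\<And>a b. a \<in> carrier R \<Longrightarrow> b \<in> carrier R \<Longrightarrow> D (a \<oplus> b) = D a \<oplus> D b"
    and "\<And>a b. a \<in> carrier R \<Longrightarrow> b \<in> carrier R \<Longrightarrow> D (a \<otimes> b) = (D a \<otimes> b) \<oplus> (a \<otimes> D b)"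
    and "\<And>c. c \<in> C \<Longrightarrow> D c = \<zero>"
  shows "D \<in> derivs R C"
  using assms by (auto simp: derivs_def)

lemma deriv_zero: "D \<in> derivs R C \<Longrightarrow> D \<zero> = \<zero>"
  using deriv_add[of D R C \<zero> \<zero>] deriv_closed[of D R C \<zero>] by (simp add: add.r_cancel_one')

lemma deriv_pow_Suc:
  assumes D: "D \<in> derivs R C" and a: "a \<in> carrier R"
  shows "D (a [^] Suc k) = a [^] k \<otimes> ([Suc k] \<cdot> D a)"
proof (induct k)
  case 0
  then show ?case using a deriv_closed[OF D] by simp
next
  case (Suc k)
  have Da: "D a \<in> carrier R" "[Suc k] \<cdot> D a \<in> carrier R" "a [^] k \<in> carrier R"
    using a deriv_closed[OF D] by auto
  have "D (a [^] Suc (Suc k)) = D (a [^] Suc k) \<otimes> a \<oplus> a [^] Suc k \<otimes> D a"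
    using deriv_mult[OF D, of "a [^] Suc k" a] a by simp
  also have "\<dots> = (a [^] k \<otimes> ([Suc k] \<cdot> D a)) \<otimes> a \<oplus> a [^] k \<otimes> a \<otimes> D a" using Suc by simp
  also have "\<dots> = (a [^] k \<otimes> a) \<otimes> (([Suc k] \<cdot> D a) \<oplus> D a)" using a Da by algebra
  finally show ?case by simp
qed

lemma deriv_cmult:
  assumes "D \<in> derivs R C" "u \<in> carrier R"
  shows "(\<lambda>x. u \<otimes> D x) \<in> derivs R C"
proof (rule derivsI)
  fix a b assume ab: "a \<in> carrier R" "b \<in> carrier R"
  note D = deriv_closed[OF assms(1)]
  show "u \<otimes> D (a \<oplus> b) = u \<otimes> D a \<oplus> u \<otimes> D b"
    using ab D assms by (simp add: deriv_add r_distr)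
  have "u \<otimes> (D a \<otimes> b \<oplus> a \<otimes> D b) = (u \<otimes> D a) \<otimes> b \<oplus> a \<otimes> (u \<otimes> D b)"
    using ab D[OF ab(1)] D[OF ab(2)] assms(2) by algebra
  then show "u \<otimes> D (a \<otimes> b) = (u \<otimes> D a) \<otimes> b \<oplus> a \<otimes> (u \<otimes> D b)"
    using ab assms by (simp add: deriv_mult)
qed (use assms deriv_closed[OF assms(1)] deriv_const[OF assms(1)] in auto)

lemma deriv_plus:
  assumes "D \<in> derivs R C" "E \<in> derivs R C"
  shows "(\<lambda>x. D x \<oplus> E x) \<in> derivs R C"
proof (rule derivsI)
  fix a b assume ab: "a \<in> carrier R" "b \<in> carrier R"
  note c = deriv_closed[OF assms(1) ab(1)] deriv_closed[OF assms(1) ab(2)]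
    deriv_closed[OF assms(2) ab(1)] deriv_closed[OF assms(2) ab(2)]
  have "(D a \<oplus> D b) \<oplus> (E a \<oplus> E b) = (D a \<oplus> E a) \<oplus> (D b \<oplus> E b)" using c by algebra
  then show "D (a \<oplus> b) \<oplus> E (a \<oplus> b) = (D a \<oplus> E a) \<oplus> (D b \<oplus> E b)"
    using ab assms by (simp add: deriv_add)
  have "(D a \<otimes> b \<oplus> a \<otimes> D b) \<oplus> (E a \<otimes> b \<oplus> a \<otimes> E b) = (D a \<oplus> E a) \<otimes> b \<oplus> a \<otimes> (D b \<oplus> E b)"
    using c ab by algebra
  then show "D (a \<otimes> b) \<oplus> E (a \<otimes> b) = (D a \<oplus> E a) \<otimes> b \<oplus> a \<otimes> (D b \<oplus> E b)"
    using ab assms by (simp add: deriv_mult)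
qed (use assms in \<open>auto simp: deriv_closed deriv_const\<close>)

lemma deriv_null: "(\<lambda>x. \<zero>) \<in> derivs R C"
  by (rule derivsI) auto

lemma deriv_sub:
  assumes "D \<in> derivs R C" "E \<in> derivs R C" "u \<in> carrier R"
  shows "(\<lambda>x. D x \<ominus> u \<otimes> E x) \<in> derivs R C"
proof (rule derivsI)
  fix a b assume ab: "a \<in> carrier R" "b \<in> carrier R"
  note c = deriv_closed[OF assms(1) ab(1)] deriv_closed[OF assms(1) ab(2)]
    deriv_closed[OF assms(2) ab(1)] deriv_closed[OF assms(2) ab(2)] assms(3)
  have "(D a \<oplus> D b) \<ominus> u \<otimes> (E a \<oplus> E b) = (D a \<ominus> u \<otimes> E a) \<oplus> (D b \<ominus> u \<otimes> E b)"
    using c by algebra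
  then show "D (a \<oplus> b) \<ominus> u \<otimes> E (a \<oplus> b) = (D a \<ominus> u \<otimes> E a) \<oplus> (D b \<ominus> u \<otimes> E b)"
    using ab assms by (simp add: deriv_add)
  have "(D a \<otimes> b \<oplus> a \<otimes> D b) \<ominus> u \<otimes> (E a \<otimes> b \<oplus> a \<otimes> E b)
      = (D a \<ominus> u \<otimes> E a) \<otimes> b \<oplus> a \<otimes> (D b \<ominus> u \<otimes> E b)"
    using c ab by algebra
  then show "D (a \<otimes> b) \<ominus> u \<otimes> E (a \<otimes> b) = (D a \<ominus> u \<otimes> E a) \<otimes> b \<oplus> a \<otimes> (D b \<ominus> u \<otimes> E b)"
    using ab assms by (simp add: deriv_mult)
next
  show "\<And>c. c \<in> C \<Longrightarrow> D c \<ominus> u \<otimes> E c = \<zero>" using assms by (simp add: deriv_const minus_eq)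
qed (use assms in \<open>auto simp: deriv_closed\<close>)

lemma deriv_finsum:
  assumes "finite T" "\<And>i. i \<in> T \<Longrightarrow> D i \<in> derivs R C" "\<And>i. i \<in> T \<Longrightarrow> u i \<in> carrier R"
  shows "(\<lambda>x. \<Oplus>i\<in>T. u i \<otimes> D i x) \<in> derivs R C"
  using assms
proof (induct T)
  case empty
  then show ?case by (simp add: deriv_null)
next
  case (insert j T)
  have T: "(\<lambda>x. \<Oplus>i\<in>T. u i \<otimes> D i x) \<in> derivs R C" using insert by auto
  have 1: "(\<lambda>x. u j \<otimes> D j x \<oplus> (\<Oplus>i\<in>T. u i \<otimes> D i x)) \<in> derivs R C"
    using deriv_plus[OF deriv_cmult T] insert.prems by blast
  have c: "u i \<otimes> D i x \<in> carrier R" if "x \<in> carrier R" "i \<in> insert j T" for i x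
    using insert.prems deriv_closed that by (metis m_closed)
  have eq: "(\<Oplus>i\<in>insert j T. u i \<otimes> D i x) = u j \<otimes> D j x \<oplus> (\<Oplus>i\<in>T. u i \<otimes> D i x)"
    if "x \<in> carrier R" for x
    using insert.hyps c[OF that] by (intro finsum_insert) auto
  show ?case
  proof (rule derivsI)
    fix b assume "b \<in> C"
    have "D i b = \<zero>" if "i \<in> insert j T" for i using deriv_const insert.prems that \<open>b \<in> C\<close> by metis
    then have "(\<Oplus>i\<in>insert j T. u i \<otimes> D i b) = (\<Oplus>i\<in>insert j T. \<zero>)"
      using insert.prems by (intro finsum_cong') auto
    then show "(\<Oplus>i\<in>insert j T. u i \<otimes> D i b) = \<zero>" by simp
  qed (use eq deriv_closed[OF 1] deriv_add[OF 1] deriv_mult[OF 1] in simp_all)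
qed

lemma deriv_genideal:
  assumes D: "D \<in> derivs R C" and B: "B \<subseteq> carrier R"
    and Q: "ideal Q R" "B \<subseteq> Q" "\<And>b. b \<in> B \<Longrightarrow> D b \<in> Q" and a: "a \<in> Idl B"
  shows "D a \<in> Q"
proof -
  note Qc = subsetD[OF ideal_subset[OF Q(1)]]
  have "ideal {a \<in> Q. D a \<in> Q} R"
  proof (rule ideal_cringI)
    fix a x assume *: "a \<in> {a \<in> Q. D a \<in> Q}" "x \<in> carrier R"
    then show "x \<otimes> a \<in> {a \<in> Q. D a \<in> Q}"
      using Qc deriv_closed[OF D] ideal_mult[OF Q(1)] ideal_add[OF Q(1)] by (auto simp: deriv_mult[OF D])
  qed (use Qc ideal_zero[OF Q(1)] ideal_add[OF Q(1)] in \<open>auto simp: deriv_zero[OF D] deriv_add[OF D]\<close>)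
  then have "Idl B \<subseteq> {a \<in> Q. D a \<in> Q}" using Q by (intro genideal_minimal) auto
  then show ?thesis using a by blast
qed

lemma finsum_delta:
  assumes "finite T" "j \<in> T" "\<And>i. i \<in> T \<Longrightarrow> u i \<in> carrier R"
  shows "(\<Oplus>i\<in>T. u i \<otimes> (if i = j then \<one> else \<zero>)) = u j"
proof -
  have "(\<Oplus>i\<in>T. u i \<otimes> (if i = j then \<one> else \<zero>)) = (\<Oplus>i\<in>T. if j = i then u i else \<zero>)"
    using assms by (intro finsum_cong') auto
  then show ?thesis using add.finprod_singleton[OF assms(2,1), of u] assms(3) by simp
qed

lemma ideal_finsum:
  assumes "ideal I R" "finite T" "\<And>i. i \<in> T \<Longrightarrow> u i \<in> I"
  shows "(\<Oplus>i\<in>T. u i) \<in> I"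
  using assms(2,3)
proof (induct T)
  case (insert j T)
  have "(\<Oplus>i\<in>insert j T. u i) = u j \<oplus> (\<Oplus>i\<in>T. u i)"
    using insert ideal_subset[OF assms(1)] by (intro finsum_insert) auto
  then show ?case using insert ideal_add[OF assms(1)] by simp
qed (simp add: ideal_zero[OF assms(1)])

end


section \<open>Coordinates with dual derivations\<close>

text \<open>A Noetherian local ring of residue characteristic zero (the positive integers are units) with
  a set \<open>C\<close> of constants that represents the residue field.\<close>

locale local_algebra = noetherian_local_ring R M for R (structure) and M +
  fixes C :: "'a set"
  assumes C_subset: "C \<subseteq> carrier R"
    and decompose: "x \<in> carrier R \<Longrightarrow> \<exists>c\<in>C. \<exists>y\<in>M. x = c \<oplus> y"
    and nat_unit: "[Suc n] \<cdot> \<one> \<in> Units R"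
begin

lemma add_pow_Suc_ideal:
  assumes "ideal I R" "x \<in> carrier R" "[Suc k] \<cdot> x \<in> I" shows "x \<in> I"
proof -
  have "[Suc k] \<cdot> x = ([Suc k] \<cdot> \<one>) \<otimes> x" using add_pow_ldistr[of \<one> x "Suc k"] assms(2) by (simp only: one_closed l_one)
  then show ?thesis using ideal_unit[OF assms(1) nat_unit assms(2)] assms(3) by simp
qed

text \<open>A derivation along a local homomorphism \<open>\<phi>\<close> of Noetherian local rings is determined by its
  values on the constants and on generators of \<open>M\<close>: the difference \<open>\<Delta>\<close> of two of them takes values
  in every power of the maximal ideal of the target.\<close>

lemma derivation_unique:
  assumes B: "noetherian_local_ring B N" and \<phi>: "\<phi> \<in> ring_hom R B" "\<phi> ` M \<subseteq> N"
    and \<Delta>: "\<And>a. a \<in> carrier R \<Longrightarrow> \<Delta> a \<in> carrier B"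
      "\<And>a b. a \<in> carrier R \<Longrightarrow> b \<in> carrier R \<Longrightarrow> \<Delta> (a \<oplus> b) = \<Delta> a \<oplus>\<^bsub>B\<^esub> \<Delta> b"
      "\<And>a b. a \<in> carrier R \<Longrightarrow> b \<in> carrier R \<Longrightarrow> \<Delta> (a \<otimes> b) = \<Delta> a \<otimes>\<^bsub>B\<^esub> \<phi> b \<oplus>\<^bsub>B\<^esub> \<phi> a \<otimes>\<^bsub>B\<^esub> \<Delta> b"
      "\<And>c. c \<in> C \<Longrightarrow> \<Delta> c = \<zero>\<^bsub>B\<^esub>"
    and gen: "M = Idl Y" "Y \<subseteq> carrier R" "\<And>y. y \<in> Y \<Longrightarrow> \<Delta> y = \<zero>\<^bsub>B\<^esub>"
    and a: "a \<in> carrier R"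
  shows "\<Delta> a = \<zero>\<^bsub>B\<^esub>"
proof -
  interpret B: noetherian_local_ring B N by fact
  note \<phi>c = ring_hom_closed[OF \<phi>(1)]
  have pow: "\<forall>a\<in>carrier R. \<Delta> a \<in> B.M_pow k" for k
  proof (induct k)
    case 0
    then show ?case using \<Delta>(1) by simp
  next
    case (Suc k)
    have "\<Delta> \<zero> \<oplus>\<^bsub>B\<^esub> \<Delta> \<zero> = \<Delta> \<zero>" using \<Delta>(2)[of \<zero> \<zero>] by simp
    then have \<Delta>0: "\<Delta> \<zero> = \<zero>\<^bsub>B\<^esub>" using \<Delta>(1)[of \<zero>] by (simp add: B.add.r_cancel_one')
    let ?Q = "{y \<in> M. \<Delta> y \<in> B.M_pow (Suc k)}"
    have "ideal ?Q R"
    proof (rule ideal_cringI)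
      fix y x assume *: "y \<in> ?Q" "x \<in> carrier R"
      have "\<phi> y \<otimes>\<^bsub>B\<^esub> \<Delta> x \<in> B.M_pow (Suc k)"
        using B.M_pow_SucI[of "\<phi> y" "\<Delta> x" k] Suc * \<phi>(2) by blast
      then have "\<Delta> x \<otimes>\<^bsub>B\<^esub> \<phi> y \<in> B.M_pow (Suc k)"
        using B.m_comm[of "\<phi> y" "\<Delta> x"] * \<phi>c \<Delta>(1) by simp
      moreover have "\<phi> x \<otimes>\<^bsub>B\<^esub> \<Delta> y \<in> B.M_pow (Suc k)"
        using B.ideal_mult[OF B.M_pow_ideal, of "\<Delta> y" "Suc k" "\<phi> x"] * \<phi>c by blast
      ultimately have "\<Delta> (x \<otimes> y) \<in> B.M_pow (Suc k)"
        using \<Delta>(3)[of x y] * B.ideal_add[OF B.M_pow_ideal, of _ "Suc k"] by auto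
      then show "x \<otimes> y \<in> ?Q" using * ideal_mult[OF M_ideal] by blast
    next
      show "\<zero> \<in> ?Q" using \<Delta>0 ideal_zero[OF M_ideal] B.ideal_zero[OF B.M_pow_ideal, of "Suc k"] by auto
    next
      fix y z assume "y \<in> ?Q" "z \<in> ?Q"
      then show "y \<oplus> z \<in> ?Q"
        using \<Delta>(2)[of y z] ideal_add[OF M_ideal] B.ideal_add[OF B.M_pow_ideal, of _ "Suc k"] by auto
    qed auto
    moreover have "Y \<subseteq> ?Q"
      using gen genideal_self[OF gen(2)] B.ideal_zero[OF B.M_pow_ideal, of "Suc k"] by auto
    ultimately have M: "M \<subseteq> ?Q" using gen(1) genideal_minimal by metis
    show ?case
    proof
      fix a assume "a \<in> carrier R"
      then obtain c y where cy: "c \<in> C" "y \<in> M" "a = c \<oplus> y" using decompose by blast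
      then have "\<Delta> a = \<Delta> y" using \<Delta>(2)[of c y] \<Delta>(4)[of c] \<Delta>(1)[of y] C_subset by auto
      then show "\<Delta> a \<in> B.M_pow (Suc k)" using M cy by auto
    qed
  qed
  show ?thesis
  proof -
    have "\<Delta> a \<in> {\<zero>\<^bsub>B\<^esub>} <+>\<^bsub>B\<^esub> B.M_pow k" for k
      using B.ideal_sum_right[OF B.zeroideal B.M_pow_ideal] pow a by blast
    then show ?thesis using B.krull_intersection[OF B.zeroideal \<Delta>(1)[OF a]] by blast
  qed
qed

text \<open>Generators \<open>f\<^sub>0, \<dots>, f\<^bsub>n-1\<^esub>\<close> of \<open>M\<close> with derivations \<open>d\<^sub>i\<close> such that \<open>d\<^sub>i f\<^sub>j\<close> is \<open>1\<close> for
  \<open>i = j\<close> and \<open>0\<close> otherwise.\<close>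

definition coordinates :: "nat \<Rightarrow> (nat \<Rightarrow> 'a) \<Rightarrow> (nat \<Rightarrow> 'a \<Rightarrow> 'a) \<Rightarrow> bool" where
  "coordinates n f d \<longleftrightarrow>
     (\<forall>i<n. f i \<in> M \<and> d i \<in> derivs R C) \<and>
     (\<forall>i<n. \<forall>j<n. d i (f j) = (if i = j then \<one> else \<zero>)) \<and>
     M = Idl (f ` {..<n})"

abbreviation coord_ideal :: "(nat \<Rightarrow> 'a) \<Rightarrow> nat set \<Rightarrow> 'a set" where
  "coord_ideal f T \<equiv> Idl (f ` T)"

lemma
  assumes "coordinates n f d"
  shows coordD: "\<And>i. i < n \<Longrightarrow> f i \<in> M"
    and coord_closed: "\<And>i. i < n \<Longrightarrow> f i \<in> carrier R"
    and coord_deriv: "\<And>i. i < n \<Longrightarrow> d i \<in> derivs R C"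
    and coord_dual: "\<And>i j. i < n \<Longrightarrow> j < n \<Longrightarrow> d i (f j) = (if i = j then \<one> else \<zero>)"
    and coord_gen: "M = Idl (f ` {..<n})"
  using assms by (auto simp: coordinates_def)

lemma coord_ideal_ideal:
  assumes "coordinates n f d" "T \<subseteq> {..<n}"
  shows "ideal (coord_ideal f T) R" "f ` T \<subseteq> coord_ideal f T" "f ` T \<subseteq> carrier R"
    "coord_ideal f T \<subseteq> M"
proof -
  show *: "f ` T \<subseteq> carrier R" using assms coord_closed by blast
  show "ideal (coord_ideal f T) R" "f ` T \<subseteq> coord_ideal f T"
    using genideal_ideal[OF *] genideal_self[OF *] by auto
  show "coord_ideal f T \<subseteq> M"
    using genideal_minimal[OF M_ideal, of "f ` T"] assms coordD by blast
qed

lemma deriv_coord_ideal: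
  assumes c: "coordinates n f d" and T: "T \<subseteq> {..<n}" and i: "i < n" "i \<notin> T"
    and a: "a \<in> coord_ideal f T"
  shows "d i a \<in> coord_ideal f T"
proof (rule deriv_genideal[OF coord_deriv[OF c i(1)] _ _ _ _ a])
  fix b assume "b \<in> f ` T"
  then obtain j where "j \<in> T" "b = f j" by blast
  then have "d i b = \<zero>" using coord_dual[OF c i(1), of j] T i by auto
  then show "d i b \<in> coord_ideal f T" using ideal_zero coord_ideal_ideal[OF c T] by simp
qed (use coord_ideal_ideal[OF c T] in auto)

text \<open>A proper ideal containing \<open>f\<^sub>i\<close> for \<open>i \<in> T\<close> and stable under the other \<open>d\<^sub>i\<close> is generated by
  these \<open>f\<^sub>i\<close>. Modulo them, the Euler operator \<open>E = \<Sum> f\<^sub>i d\<^sub>i\<close> acts on \<open>M^k / M^(k+1)\<close> as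
  multiplication by \<open>k\<close>. As \<open>E a \<in> M P\<close> for \<open>a \<in> P\<close>, the ideal \<open>P\<close> lies in all powers of \<open>M\<close>.\<close>

lemma stable_ideal_eq_coord_ideal:
  assumes c: "coordinates n f d" and T: "T \<subseteq> {..<n}"
    and P: "ideal P R" "P \<subseteq> M" "coord_ideal f T \<subseteq> P"
    and stable: "\<And>i a. i < n \<Longrightarrow> i \<notin> T \<Longrightarrow> a \<in> P \<Longrightarrow> d i a \<in> P"
  shows "P = coord_ideal f T"
proof
  define I where "I = coord_ideal f T"
  define U where "U = {..<n} - T"
  have U: "finite U" "\<And>i. i \<in> U \<Longrightarrow> i < n \<and> i \<notin> T" by (auto simp: U_def)
  have I: "ideal I R" "f ` T \<subseteq> I" using coord_ideal_ideal[OF c T] by (auto simp: I_def)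
  define E where "E x = (\<Oplus>i\<in>U. f i \<otimes> d i x)" for x
  have E: "E \<in> derivs R C" unfolding E_def
    using U coord_deriv[OF c] coord_closed[OF c] by (intro deriv_finsum) auto
  note Ec = deriv_closed[OF E]
  have EM: "E x \<in> M" if "x \<in> carrier R" for x
    unfolding E_def
  proof (rule ideal_finsum[OF M_ideal U(1)])
    fix i assume "i \<in> U"
    then show "f i \<otimes> d i x \<in> M"
      using U(2) ideal_mult_r[OF M_ideal] coordD[OF c] deriv_closed[OF coord_deriv[OF c] that] by simp
  qed
  have Ef: "E (f j) = (if j \<in> U then f j else \<zero>)" if "j < n" for j
  proof -
    have *: "E (f j) = (\<Oplus>i\<in>U. f i \<otimes> (if i = j then \<one> else \<zero>))"
      unfolding E_def using U(2) coord_dual[OF c _ that] coord_closed[OF c]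
      by (intro finsum_cong') auto
    show ?thesis
    proof (cases "j \<in> U")
      case True
      then show ?thesis unfolding * using finsum_delta[OF U(1) True] U(2) coord_closed[OF c] by simp
    next
      case False
      have "(\<Oplus>i\<in>U. f i \<otimes> (if i = j then \<one> else \<zero>)) = (\<Oplus>i\<in>U. \<zero>)"
        using False U(2) coord_closed[OF c] by (intro finsum_cong') auto
      then show ?thesis unfolding * using False by simp
    qed
  qed
  define G where "G k = I <+> M_pow k" for k
  have G: "ideal (G k) R" "I \<subseteq> G k" "M_pow k \<subseteq> G k" for k
    unfolding G_def using add_ideals[OF I(1) M_pow_ideal] ideal_sum_left[OF I(1) M_pow_ideal]
      ideal_sum_right[OF I(1) M_pow_ideal] by auto
  note Gc = subsetD[OF ideal_subset[OF G(1)]]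
  have GM: "a \<otimes> b \<in> G (j + k)" if "a \<in> G j" "b \<in> M_pow k" for a b j k
  proof -
    obtain i m where *: "i \<in> I" "m \<in> M_pow j" "a = i \<oplus> m"
      using \<open>a \<in> G j\<close> set_add_iff unfolding G_def by blast
    have cc: "i \<in> carrier R" "m \<in> carrier R" "b \<in> carrier R"
      using * that M_pow_closed ideal_subset[OF I(1)] by auto
    have "m \<otimes> b \<in> M_pow (j + k)" using * that unfolding M_pow_add by (simp add: ideal_prod.prod)
    moreover have "i \<otimes> b \<in> I" using ideal_mult_r[OF I(1)] * cc by simp
    moreover have "a \<otimes> b = i \<otimes> b \<oplus> m \<otimes> b" unfolding * using cc by algebra
    ultimately show ?thesis unfolding G_def set_add_iff by blast
  qed
  have EI: "E a \<in> I" if "a \<in> I" for a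
  proof (rule deriv_genideal[OF E _ I(1) I(2) _ that[unfolded I_def]])
    fix b assume "b \<in> f ` T"
    then obtain j where j: "j \<in> T" "b = f j" by blast
    have "j < n" "j \<notin> U" using j T U(2)[of j] by auto
    then have "E b = \<zero>" using Ef[of j] j by auto
    then show "E b \<in> I" using ideal_zero[OF I(1)] by simp
  qed (use coord_ideal_ideal[OF c T] in auto)
  have E1: "E y \<ominus> y \<in> G 2" if "y \<in> M" for y
  proof -
    let ?Q = "{y \<in> M. E y \<ominus> y \<in> G 2}"
    have "ideal ?Q R"
    proof (rule ideal_cringI)
      fix y z assume *: "y \<in> ?Q" "z \<in> ?Q"
      have cc: "y \<in> carrier R" "z \<in> carrier R" "E y \<in> carrier R" "E z \<in> carrier R" using * Ec by auto
      then have "(E y \<oplus> E z) \<ominus> (y \<oplus> z) = (E y \<ominus> y) \<oplus> (E z \<ominus> z)" by algebra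
      then show "y \<oplus> z \<in> ?Q"
        using * cc ideal_add[OF M_ideal] ideal_add[OF G(1)] by (simp add: deriv_add[OF E])
    next
      fix y x assume *: "y \<in> ?Q" "x \<in> carrier R"
      have cc: "y \<in> carrier R" "x \<in> carrier R" "E y \<in> carrier R" "E x \<in> carrier R" using * Ec by auto
      have "E x \<otimes> y \<in> M_pow (Suc (Suc 0))"
        using M_pow_SucI[of "E x" y "Suc 0"] EM * unfolding M_pow_1 by blast
      then have "E x \<otimes> y \<in> G 2" using G(3)[of 2] by (auto simp: numeral_2_eq_2)
      moreover have "(E x \<otimes> y \<oplus> x \<otimes> E y) \<ominus> x \<otimes> y = E x \<otimes> y \<oplus> x \<otimes> (E y \<ominus> y)"
        using cc by algebra
      ultimately show "x \<otimes> y \<in> ?Q"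
        using * cc ideal_mult[OF M_ideal] ideal_mult[OF G(1)] ideal_add[OF G(1)]
        by (simp add: deriv_mult[OF E])
    qed (use ideal_zero[OF M_ideal] ideal_zero[OF G(1)] in \<open>auto simp: deriv_zero[OF E] minus_eq\<close>)
    moreover have "f ` {..<n} \<subseteq> ?Q"
    proof
      fix y assume "y \<in> f ` {..<n}"
      then obtain j where j: "j < n" "y = f j" by blast
      have yc: "y \<in> carrier R" using j coord_closed[OF c] by simp
      have "E y \<ominus> y \<in> G 2"
      proof (cases "j \<in> U")
        case True
        then have "E y \<ominus> y = \<zero>" using Ef j yc by (simp add: r_neg minus_eq)
        then show ?thesis using ideal_zero[OF G(1)] by simp
      next
        case False
        then have "j \<in> T" using j by (simp add: U_def)
        then have "y \<in> I" using I j by blast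
        then have "\<ominus> y \<in> G 2" using G(2) ideal_neg[OF G(1)] by blast
        moreover have "E y \<ominus> y = \<ominus> y" using Ef j yc False by (simp add: minus_eq)
        ultimately show ?thesis by simp
      qed
      then show "y \<in> ?Q" using coordD[OF c] j by simp
    qed
    ultimately have "M \<subseteq> ?Q" using coord_gen[OF c] genideal_minimal by metis
    then show ?thesis using that by blast
  qed
  have Ek: "E y \<ominus> [k] \<cdot> y \<in> G (Suc k)" if "y \<in> M_pow k" for y k
    using that
  proof (induct k arbitrary: y)
    case 0
    then have "y \<in> carrier R" by simp
    then have "E y \<in> G (Suc 0)" using EM G(3)[of "Suc 0"] unfolding M_pow_1 by blast
    then show ?case using \<open>y \<in> carrier R\<close> Ec by (simp add: minus_eq)
  next
    case (Suc k)
    from Suc.prems[unfolded M_pow.simps] show ?case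
    proof induct
      case (prod x y)
      have cc: "x \<in> carrier R" "y \<in> carrier R" "E x \<in> carrier R" "E y \<in> carrier R" "[k] \<cdot> y \<in> carrier R"
        using prod M_pow_closed Ec by auto
      have 1: "(E x \<ominus> x) \<otimes> y \<in> G (Suc (Suc k))" using GM[OF E1[OF prod(1)] prod(2)] by simp
      have "(E y \<ominus> [k] \<cdot> y) \<otimes> x \<in> G (Suc k + Suc 0)"
        using GM[OF Suc.hyps[OF prod(2)], of x "Suc 0"] prod(1) unfolding M_pow_1 by blast
      then have 2: "(E y \<ominus> [k] \<cdot> y) \<otimes> x \<in> G (Suc (Suc k))" by simp
      have "[Suc k] \<cdot> (x \<otimes> y) = x \<otimes> ([k] \<cdot> y) \<oplus> x \<otimes> y"
        using cc by (simp add: add_pow_rdistr)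
      moreover have "(E x \<otimes> y \<oplus> x \<otimes> E y) \<ominus> (x \<otimes> ([k] \<cdot> y) \<oplus> x \<otimes> y)
          = (E x \<ominus> x) \<otimes> y \<oplus> (E y \<ominus> [k] \<cdot> y) \<otimes> x" using cc by algebra
      ultimately show ?case
        using ideal_add[OF G(1) 1 2] cc by (simp add: deriv_mult[OF E])
    next
      case (sum s t)
      have cc: "s \<in> carrier R" "t \<in> carrier R" "E s \<in> carrier R" "E t \<in> carrier R"
        "[Suc k] \<cdot> s \<in> carrier R" "[Suc k] \<cdot> t \<in> carrier R"
        using sum M_pow_closed[of _ "Suc k"] Ec by auto
      have "[Suc k] \<cdot> (s \<oplus> t) = [Suc k] \<cdot> s \<oplus> [Suc k] \<cdot> t"
        using add.nat_pow_distrib[OF cc(1,2), of "Suc k"] .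
      moreover have "(E s \<oplus> E t) \<ominus> ([Suc k] \<cdot> s \<oplus> [Suc k] \<cdot> t)
        = (E s \<ominus> [Suc k] \<cdot> s) \<oplus> (E t \<ominus> [Suc k] \<cdot> t)" using cc by algebra
      ultimately show ?case
        using ideal_add[OF G(1) sum(2,4)] cc by (simp add: deriv_add[OF E])
    qed
  qed
  have PG: "P \<subseteq> G (Suc k)" for k
  proof (induct k)
    case 0
    then show ?case using P(2) G(3)[of "Suc 0"] unfolding M_pow_1 by blast
  next
    case (Suc k)
    show ?case
    proof
      fix a assume a: "a \<in> P"
      then have aG: "a \<in> G (Suc k)" using Suc by blast
      then obtain i y where iy: "i \<in> I" "y \<in> M_pow (Suc k)" "a = i \<oplus> y"
        unfolding G_def set_add_iff by blast
      have cc: "i \<in> carrier R" "y \<in> carrier R" "E i \<in> carrier R" "E y \<in> carrier R" "[Suc k] \<cdot> y \<in> carrier R"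
        using iy(1) M_pow_closed[OF iy(2)] Ec ideal_subset[OF I(1)] by auto
      have "E a \<in> G (Suc (Suc k))" unfolding E_def
      proof (rule ideal_finsum[OF G(1) U(1)])
        fix j assume j: "j \<in> U"
        then have "d j a \<in> G (Suc k)" using stable a Suc U(2) by blast
        moreover have "f j \<in> M_pow (Suc 0)" using coordD[OF c] U(2) j unfolding M_pow_1 by blast
        ultimately have "d j a \<otimes> f j \<in> G (Suc k + Suc 0)" by (rule GM)
        then show "f j \<otimes> d j a \<in> G (Suc (Suc k))"
          using m_comm[of "d j a" "f j"] Gc[OF \<open>d j a \<in> G (Suc k)\<close>] coord_closed[OF c] U(2)[OF j] by simp
      qed
      moreover have "E a = E i \<oplus> E y" using iy cc by (simp add: deriv_add[OF E])
      moreover have "E i \<in> G (Suc (Suc k))" using EI iy G by blast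
      ultimately have "E y \<in> G (Suc (Suc k))"
        using ideal_add_cancel[OF G(1), of "E y" "E i"] cc by (simp add: a_comm)
      then have "E y \<ominus> (E y \<ominus> [Suc k] \<cdot> y) \<in> G (Suc (Suc k))"
        using ideal_minus[OF G(1)] Ek[OF iy(2)] by blast
      moreover have "E y \<ominus> (E y \<ominus> [Suc k] \<cdot> y) = [Suc k] \<cdot> y" using cc by algebra
      ultimately have "y \<in> G (Suc (Suc k))" using add_pow_Suc_ideal[OF G(1) cc(2)] by simp
      then show "a \<in> G (Suc (Suc k))" using iy G(2) ideal_add[OF G(1)] by blast
    qed
  qed
  show "P \<subseteq> coord_ideal f T"
  proof
    fix a assume a: "a \<in> P"
    have "a \<in> I <+> M_pow k" for k
    proof (cases k)
      case 0
      then show ?thesis using G(3)[of 0] a ideal_subset[OF P(1)] unfolding G_def by auto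
    next
      case (Suc k')
      then show ?thesis using PG[of k'] a unfolding G_def by auto
    qed
    then show "a \<in> coord_ideal f T"
      using krull_intersection[OF I(1), of a] a ideal_subset[OF P(1)] unfolding I_def by blast
  qed
qed (rule P)

text \<open>The ideal generated by some of the coordinates is prime. Adding a coordinate \<open>f\<^sub>i\<close> to \<open>T\<close>
  gives an ideal that is prime by induction. Modulo \<open>coord_ideal f T\<close> each nonzero element is a
  power of \<open>f\<^sub>i\<close> times an element outside of this prime, and a power of \<open>f\<^sub>i\<close> does not annihilate
  such an element, as one sees by applying \<open>d\<^sub>i\<close>.\<close>

lemma coord_ideal_prime:
  assumes c: "coordinates n f d" and T: "T \<subseteq> {..<n}"
  shows "primeideal (coord_ideal f T) R"
  using T
proof (induct "card ({..<n} - T)" arbitrary: T)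
  case 0
  then have "T = {..<n}" by auto
  then have eq: "coord_ideal f T = M" using coord_gen[OF c] by simp
  show ?case unfolding eq
  proof (rule primeidealI[OF M_ideal is_cring])
    show "carrier R \<noteq> M" using one_notin_M by auto
    fix a b assume "a \<in> carrier R" "b \<in> carrier R" "a \<otimes> b \<in> M"
    then show "a \<in> M \<or> b \<in> M" using unit_if_notin_M ideal_unit[OF M_ideal] by blast
  qed
next
  case (Suc r)
  then obtain i where i: "i < n" "i \<notin> T" by (metis Diff_eq_empty_iff card.empty lessThan_iff nat.distinct(1) subsetI)
  define x I I' where "x = f i" and "I = coord_ideal f T" and "I' = coord_ideal f (insert i T)"
  have "insert i T \<subseteq> {..<n}" using Suc.prems i by auto
  have "{..<n} - insert i T = ({..<n} - T) - {i}" by auto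
  then have "r = card ({..<n} - insert i T)" using Suc.hyps(2) i by simp
  then have prime': "primeideal I' R" unfolding I'_def using Suc.hyps(1) \<open>insert i T \<subseteq> {..<n}\<close> by blast
  interpret I': primeideal I' R by fact
  have I: "ideal I R" "I \<subseteq> M" using coord_ideal_ideal[OF c Suc.prems] by (auto simp: I_def)
  note Ic = subsetD[OF ideal_subset[OF I(1)]]
  have I': "ideal I' R" "x \<in> I'" "I \<subseteq> I'"
    using coord_ideal_ideal[OF c \<open>insert i T \<subseteq> {..<n}\<close>]
      genideal_mono[of "f ` T" "f ` insert i T"] by (auto simp: I_def I'_def x_def)
  have xM: "x \<in> M" and xc: "x \<in> carrier R" using coordD[OF c i(1)] by (auto simp: x_def)
  have di: "d i \<in> derivs R C" "d i x = \<one>"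
    using coord_deriv[OF c i(1)] coord_dual[OF c i(1) i(1)] by (auto simp: x_def)
  have in_I': "\<exists>q\<in>I. \<exists>b\<in>carrier R. a = q \<oplus> b \<otimes> x" if "a \<in> I'" for a
  proof -
    have "a \<in> Idl (insert x (f ` T))" using that by (simp add: I'_def x_def)
    then show ?thesis
      using genideal_insertE[OF coord_ideal_ideal(3)[OF c Suc.prems] xc] unfolding I_def by metis
  qed
  have nzd: "z \<in> I'" if "z \<in> carrier R" "x [^] (k::nat) \<otimes> z \<in> I" for z k
    using that
  proof (induct k arbitrary: z)
    case 0
    then show ?case using I' by auto
  next
    case (Suc k)
    define e where "e = [Suc k] \<cdot> \<one>"
    have e: "e \<in> Units R" unfolding e_def by (rule nat_unit)
    have cc: "x [^] k \<in> carrier R" "d i z \<in> carrier R" "e \<in> carrier R" "z \<in> carrier R"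
      using xc deriv_closed[OF di(1)] Suc.prems e by auto
    have "d i (x [^] Suc k \<otimes> z) \<in> I"
      using deriv_coord_ideal[OF c \<open>T \<subseteq> {..<n}\<close> i] Suc.prems(2) unfolding I_def by blast
    moreover have "d i (x [^] Suc k \<otimes> z) = d i (x [^] Suc k) \<otimes> z \<oplus> x [^] Suc k \<otimes> d i z"
      using deriv_mult[OF di(1) nat_pow_closed[OF xc] cc(4)] .
    moreover have "d i (x [^] Suc k) = x [^] k \<otimes> e"
      using deriv_pow_Suc[OF di(1) xc, of k] unfolding di(2) e_def .
    moreover have "x [^] k \<otimes> e \<otimes> z \<oplus> x [^] Suc k \<otimes> d i z = x [^] k \<otimes> (e \<otimes> z \<oplus> d i z \<otimes> x)"
      using cc xc unfolding nat_pow_Suc by algebra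
    ultimately have "e \<otimes> z \<oplus> d i z \<otimes> x \<in> I'"
      using Suc.hyps[of "e \<otimes> z \<oplus> d i z \<otimes> x"] cc xc by simp
    then have "e \<otimes> z \<in> I'"
      using ideal_add_cancel[OF I'(1), of "e \<otimes> z" "d i z \<otimes> x"] ideal_mult[OF I'(1,2)] cc by simp
    then show ?case using ideal_unit[OF I'(1) e cc(4)] by blast
  qed
  have factor: "\<exists>k b. b \<in> carrier R \<and> b \<notin> I' \<and> a \<ominus> x [^] (k::nat) \<otimes> b \<in> I"
    if a: "a \<in> carrier R" "a \<notin> I" for a
  proof -
    let ?P = "\<lambda>k. \<exists>b\<in>carrier R. a \<ominus> x [^] (k::nat) \<otimes> b \<in> I"
    have nP: "\<exists>k. \<not> ?P k"
    proof (rule ccontr)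
      assume "\<nexists>k. \<not> ?P k"
      then have *: "?P k" for k by blast
      have "a \<in> I <+> M_pow k" for k
      proof -
        obtain b where b: "b \<in> carrier R" "a \<ominus> x [^] k \<otimes> b \<in> I" using * by blast
        have "x [^] k \<otimes> b \<in> M_pow k" using ideal_mult_r[OF M_pow_ideal M_pow_pow[OF xM] b(1)] .
        moreover have "a = (a \<ominus> x [^] k \<otimes> b) \<oplus> x [^] k \<otimes> b"
          using a b nat_pow_closed[OF xc, of k] by algebra
        ultimately show ?thesis using b unfolding set_add_iff by blast
      qed
      then show False using krull_intersection[OF I(1) a(1)] a(2) by blast
    qed
    have P0: "?P 0"
      using a ideal_zero[OF I(1)] by (intro bexI[of _ a]) (auto simp: minus_eq r_neg)
    have "\<exists>k. ?P k \<and> \<not> ?P (Suc k)"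
    proof (rule ccontr)
      assume *: "\<nexists>k. ?P k \<and> \<not> ?P (Suc k)"
      have "?P k" for k by (induct k) (use P0 * in \<open>blast+\<close>)
      then show False using nP by blast
    qed
    then obtain k where k: "?P k" "\<not> ?P (Suc k)" by blast
    then obtain b where b: "b \<in> carrier R" "a \<ominus> x [^] k \<otimes> b \<in> I" by blast
    have "b \<notin> I'"
    proof
      assume "b \<in> I'"
      then obtain q b' where q: "q \<in> I" "b' \<in> carrier R" "b = q \<oplus> b' \<otimes> x" using in_I' by blast
      have "a \<ominus> x [^] Suc k \<otimes> b' = (a \<ominus> x [^] k \<otimes> b) \<oplus> x [^] k \<otimes> q"
        using q(2) Ic[OF q(1)] a xc nat_pow_closed[OF xc, of k] unfolding q(3) nat_pow_Suc by algebra
      then have "a \<ominus> x [^] Suc k \<otimes> b' \<in> I"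
        using b ideal_add[OF I(1)] ideal_mult[OF I(1) q(1)] xc by simp
      then show False using k q by blast
    qed
    then show ?thesis using b by blast
  qed
  show ?case unfolding I_def[symmetric]
  proof (rule primeidealI[OF I(1) is_cring])
    show "carrier R \<noteq> I" using I one_notin_M by auto
    fix a b assume ab: "a \<in> carrier R" "b \<in> carrier R" "a \<otimes> b \<in> I"
    show "a \<in> I \<or> b \<in> I"
    proof (rule ccontr)
      assume "\<not> (a \<in> I \<or> b \<in> I)"
      then obtain k a' l b' where
        *: "a' \<in> carrier R" "a' \<notin> I'" "a \<ominus> x [^] (k::nat) \<otimes> a' \<in> I"
        "b' \<in> carrier R" "b' \<notin> I'" "b \<ominus> x [^] (l::nat) \<otimes> b' \<in> I"
        using factor[of a] factor[of b] ab by blast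
      define y z where "y = x [^] k" and "z = x [^] l"
      have yz: "y \<in> carrier R" "z \<in> carrier R" using xc by (auto simp: y_def z_def)
      have "(y \<otimes> z) \<otimes> (a' \<otimes> b') = a \<otimes> b \<ominus> (b \<otimes> (a \<ominus> y \<otimes> a') \<oplus> (y \<otimes> a') \<otimes> (b \<ominus> z \<otimes> b'))"
        using yz *(1,4) ab(1,2) by algebra
      moreover have "b \<otimes> (a \<ominus> y \<otimes> a') \<in> I" "(y \<otimes> a') \<otimes> (b \<ominus> z \<otimes> b') \<in> I"
        using * ab yz ideal_mult[OF I(1)] by (auto simp: y_def z_def)
      ultimately have "(y \<otimes> z) \<otimes> (a' \<otimes> b') \<in> I"
        using ab ideal_minus[OF I(1)] ideal_add[OF I(1)] by simp
      then have "x [^] (k + l) \<otimes> (a' \<otimes> b') \<in> I" using xc by (simp add: y_def z_def nat_pow_mult)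
      then have "a' \<otimes> b' \<in> I'" using nzd * by blast
      then show False using I'.I_prime * by blast
    qed
  qed
qed

text \<open>An element \<open>x\<close> with \<open>d\<^sub>j x\<close> a unit can take the place of \<open>f\<^sub>j\<close>.\<close>

lemma coord_replace:
  assumes c: "coordinates n f d" and j: "j < n" and x: "x \<in> M" and djx: "d j x \<notin> M"
  shows "\<exists>d'. coordinates n (f(j := x)) d'"
proof -
  have xc: "x \<in> carrier R" using x by simp
  note dc = deriv_closed[OF coord_deriv[OF c]]
  define u where "u = inv (d j x)"
  have djU: "d j x \<in> Units R" using unit_if_notin_M djx dc[OF j xc] by blast
  then have u: "u \<in> carrier R" "u \<otimes> d j x = \<one>" by (auto simp: u_def)
  define D where "D y = u \<otimes> d j y" for y
  have D: "D \<in> derivs R C" "D x = \<one>" "\<And>i. i < n \<Longrightarrow> i \<noteq> j \<Longrightarrow> D (f i) = \<zero>"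
    unfolding D_def using deriv_cmult[OF coord_deriv[OF c j] u(1)] u coord_dual[OF c j] by auto
  define d' where "d' i = (if i = j then D else (\<lambda>y. d i y \<ominus> d i x \<otimes> D y))" for i
  let ?f = "f(j := x)"
  have 1: "d' i \<in> derivs R C" if "i < n" for i
    using D(1) deriv_sub[OF coord_deriv[OF c that] D(1) dc[OF that xc]] by (auto simp: d'_def)
  have 2: "d' i (?f l) = (if i = l then \<one> else \<zero>)" if "i < n" "l < n" for i l
    using D(1,2) D(3)[OF that(2)] coord_dual[OF c that] dc[OF that(1) xc] coord_closed[OF c that(2)]
    by (auto simp: d'_def r_neg minus_eq)
  have 3: "M = Idl (?f ` {..<n})"
  proof
    have fc: "?f ` {..<n} \<subseteq> M" using coordD[OF c] x by auto
    then show "Idl (?f ` {..<n}) \<subseteq> M" by (rule genideal_minimal[OF M_ideal])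
    have fcc: "?f ` {..<n} \<subseteq> carrier R" using fc M_subset by blast
    note F = genideal_ideal[OF fcc] genideal_self[OF fcc]
    let ?B = "f ` ({..<n} - {j})"
    have T: "{..<n} - {j} \<subseteq> {..<n}" by blast
    have BF: "Idl ?B \<subseteq> Idl (?f ` {..<n})"
      by (rule genideal_mono) (use fcc in \<open>auto simp: image_iff\<close>)
    have "insert (f j) ?B = f ` {..<n}" using j by auto
    then have "x \<in> Idl (insert (f j) ?B)" using x coord_gen[OF c] by simp
    then obtain q b where q: "q \<in> Idl ?B" "b \<in> carrier R" "x = q \<oplus> b \<otimes> f j"
      using genideal_insertE[OF coord_ideal_ideal(3)[OF c T] coord_closed[OF c j]] by blast
    have qc: "q \<in> carrier R" "q \<in> M" using q coord_ideal_ideal(4)[OF c T] by auto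
    have fj: "f j \<in> carrier R" "f j \<in> M" using coord_closed[OF c j] coordD[OF c j] by auto
    \<comment> \<open>The coefficient of \<open>f\<^sub>j\<close> in \<open>x\<close> is a unit, being congruent to \<open>d\<^sub>j x\<close> modulo \<open>M\<close>.\<close>
    have "b \<notin> M"
    proof
      assume "b \<in> M"
      have "d j q \<in> M" using deriv_coord_ideal[OF c T j _ q(1)] coord_ideal_ideal(4)[OF c T] by blast
      moreover have "d j b \<otimes> f j \<in> M" using ideal_mult[OF M_ideal fj(2)] dc[OF j q(2)] by blast
      moreover have "d j x = d j q \<oplus> (d j b \<otimes> f j \<oplus> b)"
        unfolding q(3) using deriv_add[OF coord_deriv[OF c j], of q "b \<otimes> f j"] qc q(2) fj
          deriv_mult[OF coord_deriv[OF c j] q(2) fj(1)] coord_dual[OF c j j] by simp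
      ultimately show False using djx \<open>b \<in> M\<close> ideal_add[OF M_ideal] by simp
    qed
    then have bU: "b \<in> Units R" using unit_if_notin_M q by blast
    have "x \<in> Idl (?f ` {..<n})" using F(2) j by force
    then have "x \<ominus> q \<in> Idl (?f ` {..<n})" using ideal_minus[OF F(1)] q(1) BF by blast
    moreover have "x \<ominus> q = b \<otimes> f j" unfolding q(3) using qc(1) q(2) fj(1) by algebra
    ultimately have "f j \<in> Idl (?f ` {..<n})" using ideal_unit[OF F(1) bU fj(1)] by simp
    moreover have "f i \<in> Idl (?f ` {..<n})" if "i < n" "i \<noteq> j" for i
      using F(2) that by force
    ultimately have "f ` {..<n} \<subseteq> Idl (?f ` {..<n})" by blast
    then show "M \<subseteq> Idl (?f ` {..<n})" using coord_gen[OF c] genideal_minimal[OF F(1)] by simp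
  qed
  have 4: "?f i \<in> M" if "i < n" for i using x coordD[OF c that] by simp
  show ?thesis
    unfolding coordinates_def using 1 2 3 4 by (intro exI[of _ d'] conjI allI impI) blast+
qed

text \<open>Steinitz exchange: beyond a set \<open>T\<close> of coordinates that are kept, as many coordinates as
  possible are replaced by elements of \<open>B\<close>.\<close>

lemma coord_exchange:
  assumes "coordinates n f d" "T \<subseteq> {..<n}" "B \<subseteq> M"
  shows "\<exists>f' d' T'. coordinates n f' d' \<and> T \<subseteq> T' \<and> T' \<subseteq> {..<n} \<and> (\<forall>i\<in>T. f' i = f i) \<and>
    (\<forall>i\<in>T' - T. f' i \<in> B) \<and> (\<forall>j<n. j \<notin> T' \<longrightarrow> (\<forall>x\<in>B. d' j x \<in> M))"
  using assms
proof (induct "card ({..<n} - T)" arbitrary: T f d rule: less_induct)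
  case less
  note c = less.prems(1)
  show ?case
  proof (cases "\<forall>j<n. j \<notin> T \<longrightarrow> (\<forall>x\<in>B. d j x \<in> M)")
    case True
    then show ?thesis using less.prems by (intro exI[of _ f] exI[of _ d] exI[of _ T]) auto
  next
    case False
    then obtain j x where j: "j < n" "j \<notin> T" "x \<in> B" "d j x \<notin> M" by blast
    obtain d1 where d1: "coordinates n (f(j := x)) d1"
      using coord_replace[OF c j(1) _ j(4)] j(3) less.prems(3) by blast
    have card: "card ({..<n} - insert j T) < card ({..<n} - T)"
      by (rule psubset_card_mono) (use j in auto)
    have ins: "insert j T \<subseteq> {..<n}" using less.prems j by auto
    from less.hyps[OF card d1 ins less.prems(3)] obtain f' d' T' where
      *: "coordinates n f' d'" "insert j T \<subseteq> T'" "T' \<subseteq> {..<n}"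
        "\<forall>i\<in>insert j T. f' i = (f(j := x)) i" "\<forall>i\<in>T' - insert j T. f' i \<in> B"
        "\<forall>j<n. j \<notin> T' \<longrightarrow> (\<forall>x\<in>B. d' j x \<in> M)"
      by blast
    have "f' i = f i" if "i \<in> T" for i using * that j by auto
    moreover have "f' i \<in> B" if "i \<in> T' - T" for i
      using * that j by (cases "i = j") auto
    ultimately show ?thesis using * by blast
  qed
qed

end


section \<open>Ideals stable under a family of derivations\<close>

context local_algebra
begin

lemma deriv_commutator:
  assumes D: "D \<in> derivs R C" and E: "E \<in> derivs R C"
  shows "(\<lambda>x. E (D x) \<ominus> D (E x)) \<in> derivs R C"
proof (rule derivsI)
  note Dc = deriv_closed[OF D] and Ec = deriv_closed[OF E]
  fix a b assume ab: "a \<in> carrier R" "b \<in> carrier R"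
  have cc: "D a \<in> carrier R" "D b \<in> carrier R" "E a \<in> carrier R" "E b \<in> carrier R"
    "E (D a) \<in> carrier R" "E (D b) \<in> carrier R" "D (E a) \<in> carrier R" "D (E b) \<in> carrier R"
    using ab Dc Ec by auto
  have "(E (D a) \<oplus> E (D b)) \<ominus> (D (E a) \<oplus> D (E b)) = (E (D a) \<ominus> D (E a)) \<oplus> (E (D b) \<ominus> D (E b))"
    using cc by algebra
  then show "E (D (a \<oplus> b)) \<ominus> D (E (a \<oplus> b)) = (E (D a) \<ominus> D (E a)) \<oplus> (E (D b) \<ominus> D (E b))"
    using ab cc by (simp add: deriv_add[OF D] deriv_add[OF E])
  have "((E (D a) \<otimes> b \<oplus> D a \<otimes> E b) \<oplus> (E a \<otimes> D b \<oplus> a \<otimes> E (D b)))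
      \<ominus> ((D (E a) \<otimes> b \<oplus> E a \<otimes> D b) \<oplus> (D a \<otimes> E b \<oplus> a \<otimes> D (E b)))
      = (E (D a) \<ominus> D (E a)) \<otimes> b \<oplus> a \<otimes> (E (D b) \<ominus> D (E b))"
    using ab cc by algebra
  then show "E (D (a \<otimes> b)) \<ominus> D (E (a \<otimes> b)) = (E (D a) \<ominus> D (E a)) \<otimes> b \<oplus> a \<otimes> (E (D b) \<ominus> D (E b))"
    using ab cc by (simp add: deriv_add[OF D] deriv_add[OF E] deriv_mult[OF D] deriv_mult[OF E])
next
  fix c assume "c \<in> C"
  then show "E (D c) \<ominus> D (E c) = \<zero>"
    by (simp add: deriv_const[OF D] deriv_const[OF E] deriv_zero[OF D] deriv_zero[OF E] minus_eq)
qed (use deriv_closed[OF D] deriv_closed[OF E] in auto)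

lemma deriv_expand:
  assumes c: "coordinates n f d" and D: "D \<in> derivs R C" and x: "x \<in> carrier R"
  shows "D x = (\<Oplus>i\<in>{..<n}. D (f i) \<otimes> d i x)"
proof -
  define E where "E x = (\<Oplus>i\<in>{..<n}. D (f i) \<otimes> d i x)" for x
  note fc = coord_closed[OF c]
  have Df: "D (f i) \<in> carrier R" if "i < n" for i using deriv_closed[OF D] fc that by blast
  have E: "E \<in> derivs R C" unfolding E_def
    using coord_deriv[OF c] Df by (intro deriv_finsum) auto
  have Ef: "E (f j) = D (f j)" if "j < n" for j
  proof -
    have "E (f j) = (\<Oplus>i\<in>{..<n}. D (f i) \<otimes> (if i = j then \<one> else \<zero>))"
      unfolding E_def using Df coord_dual[OF c _ that] by (intro finsum_cong') auto
    also have "\<dots> = D (f j)" using finsum_delta[of "{..<n}" j "\<lambda>i. D (f i)"] Df that by simp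
    finally show ?thesis .
  qed
  have \<Delta>: "(\<lambda>x. D x \<ominus> \<one> \<otimes> E x) \<in> derivs R C" using deriv_sub[OF D E one_closed] .
  have "D x \<ominus> \<one> \<otimes> E x = \<zero>"
  proof (rule derivation_unique[where \<phi> = "\<lambda>x. x" and Y = "f ` {..<n}" and \<Delta> = "\<lambda>x. D x \<ominus> \<one> \<otimes> E x"])
    show "noetherian_local_ring R M" by unfold_locales
    show "(\<lambda>x. x) \<in> ring_hom R R" by (rule ring_hom_memI) auto
    show "D y \<ominus> \<one> \<otimes> E y = \<zero>" if "y \<in> f ` {..<n}" for y
      using that Ef Df by (auto simp: minus_eq r_neg)
  qed (use deriv_closed[OF \<Delta>] deriv_add[OF \<Delta>] deriv_mult[OF \<Delta>] deriv_const[OF \<Delta>] coord_gen[OF c] fc x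
        in auto)
  then show ?thesis using deriv_closed[OF D x] deriv_closed[OF E x] unfolding E_def[symmetric] by simp
qed

text \<open>Let \<open>P\<close> be maximal among the proper ideals stable under a family \<open>\<L>\<close> of derivations. Once the
  coordinates are chosen so that those in \<open>P\<close> span the image of \<open>P\<close> in \<open>M / M\<^sup>2\<close>, they generate
  \<open>P\<close>: the ideal generated by \<open>P\<close> and by the first-order derivatives \<open>d\<^sub>j P\<close> in the remaining
  directions, an ideal of \<open>1 \<times> 1\<close> minors of a Jacobian matrix, is proper and \<open>\<L>\<close>-stable, so it is
  \<open>P\<close> itself, and \<open>P\<close> is stable under these \<open>d\<^sub>j\<close>.\<close>

lemma maximal_stable_eq_coord_ideal:
  assumes c: "coordinates n f d" and T: "T \<subseteq> {..<n}"
    and P: "ideal P R" "P \<subseteq> M" "f ` T \<subseteq> P"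
    and dP: "\<And>j p. j < n \<Longrightarrow> j \<notin> T \<Longrightarrow> p \<in> P \<Longrightarrow> d j p \<in> M"
    and \<L>: "\<L> \<subseteq> derivs R C" "\<And>E p. E \<in> \<L> \<Longrightarrow> p \<in> P \<Longrightarrow> E p \<in> P"
    and max: "\<And>Q. ideal Q R \<Longrightarrow> P \<subseteq> Q \<Longrightarrow> Q \<subseteq> M \<Longrightarrow> (\<And>E q. E \<in> \<L> \<Longrightarrow> q \<in> Q \<Longrightarrow> E q \<in> Q) \<Longrightarrow> Q = P"
  shows "P = coord_ideal f T"
proof -
  note Pc = subsetD[OF ideal_subset[OF P(1)]]
  define B where "B = P \<union> {d j p | j p. j < n \<and> j \<notin> T \<and> p \<in> P}"
  have BM: "B \<subseteq> M" using P(2) dP by (auto simp: B_def)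
  then have Bc: "B \<subseteq> carrier R" using M_subset by blast
  define F where "F = Idl B"
  have F: "ideal F R" "B \<subseteq> F" "F \<subseteq> M"
    using genideal_ideal[OF Bc] genideal_self[OF Bc] genideal_minimal[OF M_ideal BM] by (auto simp: F_def)
  have PF: "P \<subseteq> F" using F(2) by (auto simp: B_def)
  have dF: "d j p \<in> F" if "j < n" "j \<notin> T" "p \<in> P" for j p using F(2) that by (auto simp: B_def)
  have "E q \<in> F" if E: "E \<in> \<L>" and q: "q \<in> F" for E q
  proof -
    have ED: "E \<in> derivs R C" using E \<L> by blast
    note Ec = deriv_closed[OF ED] and dc = deriv_closed[OF coord_deriv[OF c]]
    show ?thesis
    proof (rule deriv_genideal[OF ED Bc F(1,2) _ q[unfolded F_def]])
      fix b assume "b \<in> B"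
      then consider "b \<in> P" | j p where "j < n" "j \<notin> T" "p \<in> P" "b = d j p" by (auto simp: B_def)
      then show "E b \<in> F"
      proof cases
        case 1
        then show ?thesis using \<L>(2)[OF E] PF by blast
      next
        case 2
        have pc: "p \<in> carrier R" using Pc 2 by blast
        let ?K = "\<lambda>x. E (d j x) \<ominus> d j (E x)"
        have K: "?K \<in> derivs R C" by (rule deriv_commutator[OF coord_deriv[OF c 2(1)] ED])
        have "?K p = (\<Oplus>l\<in>{..<n}. ?K (f l) \<otimes> d l p)" by (rule deriv_expand[OF c K pc])
        moreover have "(\<Oplus>l\<in>{..<n}. ?K (f l) \<otimes> d l p) \<in> F"
        proof (rule ideal_finsum[OF F(1)])
          fix l assume "l \<in> {..<n}"
          then have l: "l < n" by simp
          have Kl: "?K (f l) \<in> carrier R" using deriv_closed[OF K] coord_closed[OF c l] by blast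
          have dlp: "d l p \<in> carrier R" using dc[OF l pc] .
          show "?K (f l) \<otimes> d l p \<in> F"
          proof (cases "l \<in> T")
            case False
            then show ?thesis using ideal_mult[OF F(1) dF[OF l _ 2(3)] Kl] by blast
          next
            case True
            \<comment> \<open>Here \<open>d\<^sub>j f\<^sub>l = 0\<close> and \<open>E f\<^sub>l \<in> P\<close>, so the coefficient \<open>[E, d\<^sub>j] f\<^sub>l\<close> is in \<open>F\<close>.\<close>
            then have "d j (f l) = \<zero>" using coord_dual[OF c 2(1) l] 2 by auto
            moreover have "E (f l) \<in> P" using \<L>(2)[OF E] P(3) True by blast
            then have "d j (E (f l)) \<in> F" using dF 2 by blast
            ultimately have "?K (f l) \<in> F"
              using ideal_minus[OF F(1) ideal_zero[OF F(1)]] deriv_zero[OF ED] by simp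
            then show ?thesis using ideal_mult_r[OF F(1)] dlp by blast
          qed
        qed simp
        moreover have "d j (E p) \<in> F" using dF 2 \<L>(2)[OF E] by blast
        ultimately have "?K p \<oplus> d j (E p) \<in> F" using ideal_add[OF F(1)] by simp
        moreover have "E (d j p) \<in> carrier R" "d j (E p) \<in> carrier R" using dc Ec 2 pc by auto
        then have "?K p \<oplus> d j (E p) = E b" unfolding 2(4) by algebra
        ultimately show ?thesis by simp
      qed
    qed
  qed
  then have "F = P" using max[OF F(1) PF F(3)] by blast
  have cT: "coord_ideal f T \<subseteq> P" using genideal_minimal[OF P(1,3)] .
  show ?thesis
    by (rule stable_ideal_eq_coord_ideal[OF c T P(1,2) cT]) (use dF \<open>F = P\<close> in blast)
qed

end


section \<open>Surjective ring homomorphisms\<close>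

text \<open>A surjective homomorphism of commutative rings, that is, a quotient up to isomorphism.\<close>

locale surjective_ring_hom = ring_hom_cring R S h for R (structure) and S (structure) and h +
  assumes surj: "h ` carrier R = carrier S"
begin

abbreviation ker :: "'a set" where "ker \<equiv> {x \<in> carrier R. h x = \<zero>\<^bsub>S\<^esub>}"

lemma surjE:
  assumes "y \<in> carrier S" obtains x where "x \<in> carrier R" "y = h x"
  using assms unfolding surj[symmetric] by blast

lemma ideal_image:
  assumes "ideal I R" shows "ideal (h ` I) S"
proof (rule S.ideal_cringI)
  note Ic = subsetD[OF R.ideal_subset[OF assms]]
  show "h ` I \<subseteq> carrier S" using Ic by auto
  show "\<zero>\<^bsub>S\<^esub> \<in> h ` I" using R.ideal_zero[OF assms] by (metis hom_zero image_eqI)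
  fix a b assume "a \<in> h ` I" "b \<in> h ` I"
  then obtain x y where "x \<in> I" "y \<in> I" "a = h x" "b = h y" by blast
  moreover from this have "h (x \<oplus> y) = a \<oplus>\<^bsub>S\<^esub> b" using Ic by simp
  ultimately show "a \<oplus>\<^bsub>S\<^esub> b \<in> h ` I" using R.ideal_add[OF assms] by (metis image_eqI)
next
  note Ic = subsetD[OF R.ideal_subset[OF assms]]
  fix a b assume "a \<in> h ` I" "b \<in> carrier S"
  then obtain x y where "x \<in> I" "y \<in> carrier R" "a = h x" "b = h y" by (metis imageE surjE)
  moreover from this have "h (y \<otimes> x) = b \<otimes>\<^bsub>S\<^esub> a" using Ic by simp
  ultimately show "b \<otimes>\<^bsub>S\<^esub> a \<in> h ` I" using R.ideal_mult[OF assms] by (metis image_eqI)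
qed

lemma mem_image_iff:
  assumes "ideal I R" "ker \<subseteq> I" "x \<in> carrier R"
  shows "h x \<in> h ` I \<longleftrightarrow> x \<in> I"
proof
  assume "h x \<in> h ` I"
  then obtain y where y: "y \<in> I" "h x = h y" by blast
  have yc: "y \<in> carrier R" using y R.ideal_subset[OF assms(1)] by blast
  have "h (x \<ominus> y) = \<zero>\<^bsub>S\<^esub>" using y yc assms(3) by (simp add: R.minus_eq S.r_neg)
  then have "x \<ominus> y \<in> I" using assms yc by auto
  then have "(x \<ominus> y) \<oplus> y \<in> I" using R.ideal_add[OF assms(1)] y by blast
  moreover have "(x \<ominus> y) \<oplus> y = x" using assms(3) yc by algebra
  ultimately show "x \<in> I" by simp
qed simp

lemma image_vimage: "Q \<subseteq> carrier S \<Longrightarrow> h ` {x \<in> carrier R. h x \<in> Q} = Q"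
proof
  assume Q: "Q \<subseteq> carrier S"
  show "Q \<subseteq> h ` {x \<in> carrier R. h x \<in> Q}"
  proof
    fix y assume y: "y \<in> Q"
    then obtain x where "x \<in> carrier R" "y = h x" using Q surjE by (metis subsetD)
    then show "y \<in> h ` {x \<in> carrier R. h x \<in> Q}" using y by blast
  qed
qed blast

lemma ker_subset_vimage: "ideal Q S \<Longrightarrow> ker \<subseteq> {x \<in> carrier R. h x \<in> Q}"
  using S.ideal_zero by auto

lemma image_mono_strict:
  assumes "ideal I R" "ideal J R" "ker \<subseteq> I" "I \<subset> J"
  shows "h ` I \<subset> h ` J"
proof -
  obtain x where x: "x \<in> J" "x \<notin> I" using assms(4) by blast
  then have "h x \<notin> h ` I"
    using mem_image_iff[OF assms(1,3)] R.ideal_subset[OF assms(2)] by blast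
  then show ?thesis using assms(4) x by blast
qed

lemma vimage_mono_strict:
  assumes "ideal J S" "I \<subset> J"
  shows "{x \<in> carrier R. h x \<in> I} \<subset> {x \<in> carrier R. h x \<in> J}"
proof -
  obtain y where y: "y \<in> J" "y \<notin> I" using assms by blast
  then have "y \<in> carrier S" using S.ideal_subset[OF assms(1)] by blast
  then obtain x where "x \<in> carrier R" "y = h x" by (rule surjE)
  then show ?thesis using y assms(2) by auto
qed

lemma primeideal_image:
  assumes "primeideal I R" "ker \<subseteq> I"
  shows "primeideal (h ` I) S"
proof -
  interpret I: primeideal I R by fact
  note * = mem_image_iff[OF I.is_ideal assms(2)]
  show ?thesis
  proof (rule primeidealI[OF ideal_image[OF I.is_ideal] S.is_cring])
    show "carrier S \<noteq> h ` I"
    proof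
      assume "carrier S = h ` I"
      then have "h \<one> \<in> h ` I" by (metis S.one_closed hom_one)
      then have "\<one> \<in> I" using * by blast
      then show False using I.one_imp_carrier I.I_notcarr by simp
    qed
    fix a b assume "a \<in> carrier S" "b \<in> carrier S" and ab: "a \<otimes>\<^bsub>S\<^esub> b \<in> h ` I"
    then obtain x y where xy: "x \<in> carrier R" "y \<in> carrier R" "a = h x" "b = h y" by (metis surjE)
    then have "x \<otimes> y \<in> I" using *[of "x \<otimes> y"] ab by simp
    then show "a \<in> h ` I \<or> b \<in> h ` I" using I.I_prime xy by blast
  qed
qed

lemma primeideal_vimage:
  assumes "primeideal Q S"
  shows "primeideal {x \<in> carrier R. h x \<in> Q} R"
proof -
  interpret Q: primeideal Q S by fact
  show ?thesis
  proof (rule primeidealI[OF ring.ideal_vimage[OF Q.is_ideal] R.is_cring])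
    have "\<one>\<^bsub>S\<^esub> \<notin> Q" using Q.one_imp_carrier Q.I_notcarr by blast
    then have "\<one> \<notin> {x \<in> carrier R. h x \<in> Q}" by simp
    then show "carrier R \<noteq> {x \<in> carrier R. h x \<in> Q}" using R.one_closed by blast
  qed (use Q.I_prime in auto)
qed

lemma image_genideal:
  assumes "Y \<subseteq> carrier R"
  shows "h ` genideal R Y = genideal S (h ` Y)"
proof
  have Y: "h ` Y \<subseteq> carrier S" using assms by auto
  note 1 = S.genideal_ideal[OF Y] S.genideal_self[OF Y]
  have "genideal R Y \<subseteq> {x \<in> carrier R. h x \<in> genideal S (h ` Y)}"
    by (rule R.genideal_minimal[OF ring.ideal_vimage[OF 1(1)]]) (use 1 assms in auto)
  then show "h ` genideal R Y \<subseteq> genideal S (h ` Y)" by blast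
  show "genideal S (h ` Y) \<subseteq> h ` genideal R Y"
    using S.genideal_minimal[OF ideal_image[OF R.genideal_ideal[OF assms]]] R.genideal_self[OF assms]
    by blast
qed

lemma noetherian_image:
  assumes "noetherian_ring R" shows "noetherian_ring S"
proof (rule S.noetherian_ringI)
  fix I assume I: "ideal I S"
  then have "ideal {x \<in> carrier R. h x \<in> I} R" by (rule ring.ideal_vimage)
  then obtain Y where Y: "Y \<subseteq> carrier R" "finite Y" "{x \<in> carrier R. h x \<in> I} = genideal R Y"
    using noetherian_ring.finetely_gen[OF assms] by blast
  then have "I = genideal S (h ` Y)"
    using image_vimage[OF S.ideal_subset[OF I]] image_genideal[OF Y(1)] by simp
  then show "\<exists>A\<subseteq>carrier S. finite A \<and> I = genideal S A" using Y by (intro exI[of _ "h ` Y"]) auto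
qed

lemma noetherian_local_image:
  assumes "noetherian_local_ring R M" "ker \<subseteq> M"
  shows "noetherian_local_ring S (h ` M)"
proof -
  interpret M: noetherian_local_ring R M by fact
  interpret S': noetherian_ring S by (rule noetherian_image[OF M.noetherian_ring_axioms])
  show ?thesis
  proof (rule noetherian_local_ring.intro[OF S.is_cring S'.noetherian_ring_axioms
        noetherian_local_ring_axioms.intro])
    show "ideal (h ` M) S" by (rule ideal_image[OF M.M_ideal])
    have "h \<one> \<notin> h ` M" using mem_image_iff[OF M.M_ideal assms(2)] M.one_notin_M by blast
    then show "\<one>\<^bsub>S\<^esub> \<notin> h ` M" by simp
    fix y assume "y \<in> carrier S" "y \<notin> h ` M"
    then obtain x where x: "x \<in> carrier R" "y = h x" "x \<notin> M" by (metis surjE image_eqI)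
    then obtain w where w: "w \<in> carrier R" "w \<otimes> x = \<one>" "x \<otimes> w = \<one>"
      using M.unit_if_notin_M unfolding Units_def by blast
    have "h w \<otimes>\<^bsub>S\<^esub> y = \<one>\<^bsub>S\<^esub>" "y \<otimes>\<^bsub>S\<^esub> h w = \<one>\<^bsub>S\<^esub>"
      using w x by (metis hom_mult hom_one)+
    then show "y \<in> Units S" using \<open>y \<in> carrier S\<close> hom_closed[OF w(1)] unfolding Units_def by blast
  qed
qed

end

context noetherian_local_ring
begin

lemma maximalideal_iff: "maximalideal N R \<longleftrightarrow> N = M"
proof
  assume "maximalideal N R"
  then interpret N: maximalideal N R .
  have "N \<subseteq> M" using proper_ideal_subset_M[OF N.is_ideal] N.one_imp_carrier N.I_notcarr by blast
  then show "N = M" using N.I_maximal[OF M_ideal _ M_subset] one_notin_M by blast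
next
  assume "N = M"
  moreover have "maximalideal M R"
  proof (rule maximalidealI[OF M_ideal])
    show "carrier R \<noteq> M" using one_notin_M by blast
    fix J assume "ideal J R" "M \<subseteq> J" "J \<subseteq> carrier R"
    then show "J = M \<or> J = carrier R"
      using proper_ideal_subset_M[of J] ideal.one_imp_carrier[of J R] by blast
  qed
  ultimately show "maximalideal N R" by simp
qed

lemma local_ring: "local_ring R"
  using maximalideal_iff is_cring unfolding local_ring_def by auto

lemma max_ideal_eq: "max_ideal R = M"
  using maximalideal_iff unfolding max_ideal_def by simp

end

lemma noetherian_local_ringI:
  assumes "noetherian_ring R" "local_ring R"
  shows "noetherian_local_ring R (max_ideal R)"
proof -
  interpret noetherian_ring R by fact
  interpret cring R using assms by (simp add: local_ring_def)
  have ex1: "\<exists>!M. maximalideal M R" using assms by (simp add: local_ring_def)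
  then have max: "maximalideal (max_ideal R) R" unfolding max_ideal_def by (rule theI')
  then interpret M: maximalideal "max_ideal R" R .
  have sub: "I \<subseteq> max_ideal R" if I: "ideal I R" "\<one>\<^bsub>R\<^esub> \<notin> I" for I
  proof -
    let ?Q = "\<lambda>L. ideal L R \<and> I \<subseteq> L \<and> \<one>\<^bsub>R\<^esub> \<notin> L"
    have "\<exists>L. ?Q L \<and> (\<forall>I'. ?Q I' \<longrightarrow> L \<subseteq> I' \<longrightarrow> I' = L)"
      by (rule ideal_maximal_element[of ?Q I]) (use I in auto)
    then obtain L where L: "ideal L R" "I \<subseteq> L" "\<one>\<^bsub>R\<^esub> \<notin> L" "\<forall>I'. ?Q I' \<longrightarrow> L \<subseteq> I' \<longrightarrow> I' = L"
      by (elim exE conjE)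
    have "maximalideal L R"
    proof (rule maximalidealI[OF L(1)])
      show "carrier R \<noteq> L" using L(3) by blast
      fix J assume J: "ideal J R" "L \<subseteq> J" "J \<subseteq> carrier R"
      show "J = L \<or> J = carrier R"
        using L(4)[rule_format, of J] J L(2) ideal.one_imp_carrier[OF J(1)] by (meson order_trans)
    qed
    then show ?thesis using ex1 max L(2) by blast
  qed
  show ?thesis
  proof (rule noetherian_local_ring.intro[OF is_cring noetherian_ring_axioms
        noetherian_local_ring_axioms.intro])
    show "ideal (max_ideal R) R" by (rule M.is_ideal)
    show "\<one>\<^bsub>R\<^esub> \<notin> max_ideal R" using M.one_imp_carrier M.I_notcarr by blast
    fix x assume x: "x \<in> carrier R" "x \<notin> max_ideal R"
    have "\<one>\<^bsub>R\<^esub> \<in> PIdl\<^bsub>R\<^esub> x"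
      using sub[OF cgenideal_ideal[OF x(1)]] cgenideal_self[OF x(1)] x(2) by blast
    then obtain y where "y \<in> carrier R" "\<one>\<^bsub>R\<^esub> = y \<otimes>\<^bsub>R\<^esub> x" by (auto simp: cgenideal_def)
    then show "x \<in> Units R" using x(1) m_comm[of x y] unfolding Units_def by force
  qed
qed


section \<open>Krull dimension\<close>

text \<open>Strictly increasing chains \<open>c 0 \<subset> \<dots> \<subset> c n\<close> in \<open>F\<close>; their lengths \<open>n\<close> have the supremum
  \<open>chain_length F\<close>.\<close>

definition strict_chain :: "'a set set \<Rightarrow> nat \<Rightarrow> (nat \<Rightarrow> 'a set) \<Rightarrow> bool" where
  "strict_chain F n c \<longleftrightarrow> (\<forall>i\<le>n. c i \<in> F) \<and> (\<forall>i<n. c i \<subset> c (Suc i))"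

lemma chain_length_ge: "strict_chain F n c \<Longrightarrow> enat n \<le> chain_length F"
  unfolding chain_length_def strict_chain_def by (intro Sup_upper) blast

lemma chain_length_le: "(\<And>n c. strict_chain F n c \<Longrightarrow> enat n \<le> b) \<Longrightarrow> chain_length F \<le> b"
  unfolding chain_length_def strict_chain_def by (intro Sup_least) blast

lemma chain_length_attained:
  assumes "F \<noteq> {}" "chain_length F = enat n"
  obtains c where "strict_chain F n c"
proof -
  let ?A = "{enat n |n. \<exists>c. strict_chain F n c}"
  have eq: "chain_length F = Sup ?A" unfolding chain_length_def strict_chain_def ..
  obtain P where "P \<in> F" using assms by blast
  then have "strict_chain F 0 (\<lambda>i. P)" by (simp add: strict_chain_def)
  then have ne: "?A \<noteq> {}" by blast
  then have "finite ?A" using eq assms(2) unfolding Sup_enat_def by (auto split: if_splits)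
  then have "Sup ?A \<in> ?A" using ne unfolding Sup_enat_def by (auto dest: Max_in)
  then show ?thesis using that eq assms(2) by auto
qed

lemma strict_chain_append:
  assumes "strict_chain F p c" "strict_chain F q e" "c p \<subset> e 0"
  shows "strict_chain F (Suc (p + q)) (\<lambda>i. if i \<le> p then c i else e (i - Suc p))"
  unfolding strict_chain_def
proof (intro conjI allI impI)
  fix i assume "i \<le> Suc (p + q)"
  then show "(if i \<le> p then c i else e (i - Suc p)) \<in> F"
    using assms by (auto simp: strict_chain_def)
next
  fix i assume i: "i < Suc (p + q)"
  consider "i < p" | "i = p" | "i > p" by linarith
  then show "(if i \<le> p then c i else e (i - Suc p)) \<subset> (if Suc i \<le> p then c (Suc i) else e (Suc i - Suc p))"
  proof cases
    case 3
    then have "i - p = Suc (i - Suc p)" "i - Suc p < q" using i by auto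
    then show ?thesis using 3 assms by (simp add: strict_chain_def)
  qed (use assms in \<open>auto simp: strict_chain_def\<close>)
qed

lemma strict_chain_join:
  assumes "strict_chain F p c" "strict_chain F q e" "c p = e 0"
  shows "strict_chain F (p + q) (\<lambda>i. if i \<le> p then c i else e (i - p))"
  unfolding strict_chain_def
proof (intro conjI allI impI)
  fix i assume "i \<le> p + q"
  then show "(if i \<le> p then c i else e (i - p)) \<in> F"
    using assms by (auto simp: strict_chain_def)
next
  fix i assume i: "i < p + q"
  consider "i < p" | "i \<ge> p" by linarith
  then show "(if i \<le> p then c i else e (i - p)) \<subset> (if Suc i \<le> p then c (Suc i) else e (Suc i - p))"
  proof cases
    case 2
    then have "Suc i - p = Suc (i - p)" "i - p < q" using i by auto
    moreover have "(if i \<le> p then c i else e (i - p)) = e (i - p)" using 2 assms(3) by (cases "i = p") auto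
    ultimately show ?thesis using 2 assms by (simp add: strict_chain_def)
  qed (use assms in \<open>auto simp: strict_chain_def\<close>)
qed

context local_algebra
begin

text \<open>Adding coordinates one at a time gives a chain of prime ideals.\<close>

lemma coord_chain:
  assumes c: "coordinates n f d" and "T \<subseteq> U" "U \<subseteq> {..<n}"
  shows "\<exists>e. strict_chain {P. primeideal P R \<and> coord_ideal f T \<subseteq> P} (card (U - T)) e \<and>
    e 0 = coord_ideal f T \<and> e (card (U - T)) = coord_ideal f U"
  using assms(2,3)
proof (induct "card (U - T)" arbitrary: U)
  case 0
  have "finite (U - T)" using 0(3) finite_subset[OF _ finite_lessThan[of n]] by blast
  then have "U = T" using 0 by auto
  then show ?case using coord_ideal_prime[OF c 0(3)]
    by (intro exI[of _ "\<lambda>i. coord_ideal f U"]) (auto simp: strict_chain_def)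
next
  case (Suc r)
  then obtain i where i: "i \<in> U" "i \<notin> T" by (metis DiffE all_not_in_conv card.empty nat.distinct(1))
  have fin: "finite (U - T)" using Suc.prems finite_subset[OF _ finite_lessThan[of n]] by blast
  define V where "V = U - {i}"
  have V: "V \<subseteq> {..<n}" "T \<subseteq> V" using Suc.prems i by (auto simp: V_def)
  have "V - T = (U - T) - {i}" by (auto simp: V_def)
  then have r: "r = card (V - T)" using Suc.hyps(2) fin i by simp
  from Suc.hyps(1)[OF r V(2,1)] obtain e where
    e: "strict_chain {P. primeideal P R \<and> coord_ideal f T \<subseteq> P} r e"
      "e 0 = coord_ideal f T" "e r = coord_ideal f V" unfolding r by blast
  have fU: "f ` U \<subseteq> carrier R" using coord_ideal_ideal[OF c Suc.prems(2)] by blast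
  have sub: "coord_ideal f V \<subseteq> coord_ideal f U" "coord_ideal f T \<subseteq> coord_ideal f U"
    by (rule genideal_mono; use fU Suc.prems V_def in auto)+
  have "f i \<notin> coord_ideal f V"
  proof
    assume "f i \<in> coord_ideal f V"
    then have "d i (f i) \<in> coord_ideal f V"
      using deriv_coord_ideal[OF c V(1), of i] i Suc.prems by (auto simp: V_def)
    moreover have "i < n" using i Suc.prems by auto
    ultimately have "\<one> \<in> M"
      using coord_ideal_ideal(4)[OF c V(1)] coord_dual[OF c, of i i] by auto
    then show False using one_notin_M by blast
  qed
  moreover have "f i \<in> coord_ideal f U" using coord_ideal_ideal(2)[OF c Suc.prems(2)] i by blast
  ultimately have ss: "coord_ideal f V \<subset> coord_ideal f U" using sub by blast
  have 1: "strict_chain {P. primeideal P R \<and> coord_ideal f T \<subseteq> P} 0 (\<lambda>i. coord_ideal f U)"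
    using coord_ideal_prime[OF c Suc.prems(2)] sub by (simp add: strict_chain_def)
  from strict_chain_append[OF e(1) 1] ss e show ?case
    unfolding Suc.hyps(2)[symmetric] by (intro exI) auto
qed

text \<open>A chain of prime ideals in a quotient of \<open>R\<close> by an ideal that contains \<open>coord_ideal f T\<close>
  lifts to \<open>R\<close>, where it can be prolonged downwards by \<open>|T|\<close> steps. If its first ideal is larger than
  \<open>coord_ideal f T\<close>, there is room for one more.\<close>

lemma quotient_chain_bound:
  assumes c: "coordinates n f d" and dim: "krull_dim R = enat n" and T: "T \<subseteq> {..<n}"
    and B: "surjective_ring_hom R B h" and ker: "coord_ideal f T \<subseteq> {x \<in> carrier R. h x = \<zero>\<^bsub>B\<^esub>}"
    and ch: "strict_chain {P. primeideal P B} m e"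
  shows "m + card T \<le> n" "m + card T = n \<Longrightarrow> {x \<in> carrier R. h x = \<zero>\<^bsub>B\<^esub>} = coord_ideal f T"
proof -
  interpret h: surjective_ring_hom R B h by fact
  define v where "v i = {x \<in> carrier R. h x \<in> e i}" for i
  have eP: "primeideal (e i) B" if "i \<le> m" for i using ch that by (auto simp: strict_chain_def)
  have "v i \<subset> v (Suc i)" if "i < m" for i
    unfolding v_def using h.vimage_mono_strict primeideal.axioms(1)[OF eP] ch that
    by (auto simp: strict_chain_def)
  then have v: "strict_chain {P. primeideal P R} m v"
    using h.primeideal_vimage eP by (auto simp: strict_chain_def v_def)
  have k0: "{x \<in> carrier R. h x = \<zero>\<^bsub>B\<^esub>} \<subseteq> v 0"
    unfolding v_def using h.ker_subset_vimage[OF primeideal.axioms(1)[OF eP]] by blast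
  obtain w where w: "strict_chain {P. primeideal P R \<and> coord_ideal f {} \<subseteq> P} (card T) w"
    "w (card T) = coord_ideal f T"
    using coord_chain[OF c, of "{}" T] T by auto
  then have w1: "strict_chain {P. primeideal P R} (card T) w" by (auto simp: strict_chain_def)
  have bound: "k \<le> n" if "strict_chain {P. primeideal P R} k u" for k u
    using chain_length_ge[OF that] dim unfolding krull_dim_def by simp
  have "m + card T \<le> n \<and> (m + card T = n \<longrightarrow> {x \<in> carrier R. h x = \<zero>\<^bsub>B\<^esub>} = coord_ideal f T)"
  proof (cases "v 0 = coord_ideal f T")
    case True
    then show ?thesis using bound[OF strict_chain_join[OF w1 v]] w(2) k0 ker by (auto simp: add.commute)
  next
    case False
    then have "w (card T) \<subset> v 0" using w(2) k0 ker by blast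
    then show ?thesis using bound[OF strict_chain_append[OF w1 v]] by auto
  qed
  then show "m + card T \<le> n" "m + card T = n \<Longrightarrow> {x \<in> carrier R. h x = \<zero>\<^bsub>B\<^esub>} = coord_ideal f T"
    by auto
qed

theorem coord_quotient_regular:
  assumes c: "coordinates n f d" and dim: "krull_dim R = enat n" and T: "T \<subseteq> {..<n}"
    and B: "surjective_ring_hom R B h" and ker: "{x \<in> carrier R. h x = \<zero>\<^bsub>B\<^esub>} = coord_ideal f T"
    and l: "distinct l" "set l = {..<n} - T"
  shows "regular_local_ring B" "regular_system_of_parameters B (map (\<lambda>i. h (f i)) l)"
proof -
  interpret h: surjective_ring_hom R B h by fact
  have kerM: "{x \<in> carrier R. h x = \<zero>\<^bsub>B\<^esub>} \<subseteq> M" using ker coord_ideal_ideal[OF c T] by blast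
  have "noetherian_local_ring R M" by unfold_locales
  then interpret B: noetherian_local_ring B "h ` M" using h.noetherian_local_image kerM by blast
  have fc: "f ` {..<n} \<subseteq> carrier R" using coord_closed[OF c] by blast
  have finT: "finite T" using T finite_subset by blast
  have len: "length l = n - card T"
    using distinct_card[OF l(1)] l(2) T finT by (simp add: card_Diff_subset)
  have cT: "card T \<le> n" using card_mono[OF _ T] by simp
  have dimB: "krull_dim B = enat (n - card T)"
    unfolding krull_dim_def
  proof (rule antisym)
    show "chain_length {P. primeideal P B} \<le> enat (n - card T)"
    proof (rule chain_length_le)
      fix m e assume "strict_chain {P. primeideal P B} m e"
      from quotient_chain_bound(1)[OF c dim T B _ this] show "enat m \<le> enat (n - card T)"
        using ker by simp
    qed
    obtain e where e: "strict_chain {P. primeideal P R \<and> coord_ideal f T \<subseteq> P} (n - card T) e"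
      using coord_chain[OF c T order_refl] T finT by (auto simp: card_Diff_subset)
    then have eP: "primeideal (e i) R" "h.ker \<subseteq> e i" if "i \<le> n - card T" for i
      using that ker by (auto simp: strict_chain_def)
    have "h ` e i \<subset> h ` e (Suc i)" if i: "i < n - card T" for i
    proof (rule h.image_mono_strict)
      show "ideal (e i) R" "ideal (e (Suc i)) R" "h.ker \<subseteq> e i"
        using primeideal.axioms(1)[OF eP(1)] eP(2) i by auto
      show "e i \<subset> e (Suc i)" using e i by (simp add: strict_chain_def)
    qed
    then have "strict_chain {P. primeideal P B} (n - card T) (\<lambda>i. h ` e i)"
      using h.primeideal_image eP by (simp add: strict_chain_def)
    then show "enat (n - card T) \<le> chain_length {P. primeideal P B}" by (rule chain_length_ge)
  qed
  have "genideal B (set (map (\<lambda>i. h (f i)) l)) = h ` M"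
  proof
    let ?Y = "set (map (\<lambda>i. h (f i)) l)"
    have Y: "?Y = (\<lambda>i. h (f i)) ` ({..<n} - T)" using l by simp
    have Yc: "?Y \<subseteq> carrier B" unfolding Y using coord_closed[OF c] by auto
    have YM: "?Y \<subseteq> h ` M" unfolding Y using coordD[OF c] by auto
    show "genideal B ?Y \<subseteq> h ` M" by (rule h.S.genideal_minimal[OF B.M_ideal YM])
    have "h (f i) \<in> genideal B ?Y" if i: "i < n" for i
    proof (cases "i \<in> T")
      case True
      then have "f i \<in> coord_ideal f T" using coord_ideal_ideal(2)[OF c T] by blast
      then have "h (f i) = \<zero>\<^bsub>B\<^esub>" using ker by blast
      then show ?thesis using h.S.ideal_zero[OF h.S.genideal_ideal[OF Yc]] by simp
    next
      case False
      then show ?thesis using h.S.genideal_self[OF Yc] i unfolding Y by blast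
    qed
    then have "h ` (f ` {..<n}) \<subseteq> genideal B ?Y" by blast
    then have "genideal B (h ` (f ` {..<n})) \<subseteq> genideal B ?Y"
      by (rule h.S.genideal_minimal[OF h.S.genideal_ideal[OF Yc]])
    then show "h ` M \<subseteq> genideal B ?Y"
      using h.image_genideal[OF fc] coord_gen[OF c] by simp
  qed
  then show rsp: "regular_system_of_parameters B (map (\<lambda>i. h (f i)) l)"
    unfolding regular_system_of_parameters_def B.max_ideal_eq
    using dimB len l coord_closed[OF c] by auto
  show "regular_local_ring B"
    unfolding regular_local_ring_def using B.noetherian_ring_axioms B.local_ring rsp by blast
qed

text \<open>If a quotient \<open>B\<close> of \<open>R\<close> is regular, its kernel is generated by coordinates: choose these
  among the elements of the kernel and preimages of a regular system of parameters of \<open>B\<close>. Those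
  that are in the kernel are at least \<open>dim R - dim B\<close> in number, and a larger kernel would make the
  dimension of \<open>B\<close> too small.\<close>

theorem regular_quotient_kernel:
  assumes c: "coordinates n f d" and dim: "krull_dim R = enat n"
    and B: "surjective_ring_hom R B h" and reg: "regular_local_ring B"
  shows "\<exists>f' d' T. coordinates n f' d' \<and> T \<subseteq> {..<n} \<and> {x \<in> carrier R. h x = \<zero>\<^bsub>B\<^esub>} = coord_ideal f' T"
proof -
  interpret h: surjective_ring_hom R B h by fact
  define I where "I = h.ker"
  interpret B: noetherian_local_ring B "max_ideal B"
    using reg noetherian_local_ringI by (auto simp: regular_local_ring_def)
  have I: "ideal I R" unfolding I_def
    using h.ring.ideal_vimage[OF h.S.zeroideal] by simp
  have "\<one> \<notin> I" unfolding I_def using B.one_notin_M h.S.ideal_zero[OF B.M_ideal] by auto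
  then have IM: "I \<subseteq> M" by (rule proper_ideal_subset_M[OF I])
  interpret hM: noetherian_local_ring B "h ` M"
    using h.noetherian_local_image[of M] IM noetherian_local_ring_axioms unfolding I_def by blast
  have maxB: "max_ideal B = h ` M" by (rule hM.max_ideal_eq)
  obtain ys where ys: "set ys \<subseteq> carrier B" "enat (length ys) = krull_dim B" "genideal B (set ys) = h ` M"
    using reg maxB by (auto simp: regular_local_ring_def regular_system_of_parameters_def)
  have "\<forall>y\<in>set ys. \<exists>x\<in>M. y = h x" using ys(3) h.S.genideal_self[OF ys(1)] by blast
  then obtain s where s: "\<And>y. y \<in> set ys \<Longrightarrow> s y \<in> M \<and> y = h (s y)" by metis
  define Y where "Y = s ` set ys"
  have Y: "Y \<subseteq> M" "h ` Y = set ys" using s by (force simp: Y_def)+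
  have cY: "card Y \<le> length ys" unfolding Y_def by (meson card_image_le card_length finite_set le_trans)
  have YI: "Y \<union> I \<subseteq> M" using Y IM by blast
  then have YIc: "Y \<union> I \<subseteq> carrier R" using M_subset by blast
  note J = genideal_ideal[OF YIc] genideal_self[OF YIc]
  have MJ: "M \<subseteq> Idl (Y \<union> I)"
  proof
    fix x assume x: "x \<in> M"
    have kJ: "h.ker \<subseteq> Idl (Y \<union> I)" using J(2) unfolding I_def by blast
    have "set ys \<subseteq> h ` (Idl (Y \<union> I))" using J(2) Y(2) by blast
    then have "h ` M \<subseteq> h ` (Idl (Y \<union> I))"
      unfolding ys(3)[symmetric] by (rule h.S.genideal_minimal[OF h.ideal_image[OF J(1)]])
    then have "h x \<in> h ` (Idl (Y \<union> I))" using x by blast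
    then show "x \<in> Idl (Y \<union> I)" using h.mem_image_iff[OF J(1) kJ] x by simp
  qed
  obtain f' d' T' where *: "coordinates n f' d'" "T' \<subseteq> {..<n}" "\<forall>i\<in>T'. f' i \<in> Y \<union> I"
    "\<forall>j<n. j \<notin> T' \<longrightarrow> (\<forall>x\<in>Y \<union> I. d' j x \<in> M)"
    using coord_exchange[OF c _ YI, of "{}"] by auto
  have T': "T' = {..<n}"
  proof (rule ccontr)
    assume "T' \<noteq> {..<n}"
    then obtain j where j: "j < n" "j \<notin> T'" using *(2) by blast
    have "d' j (f' j) \<in> M"
    proof (rule deriv_genideal[OF coord_deriv[OF *(1) j(1)] YIc M_ideal YI])
      show "f' j \<in> Idl (Y \<union> I)" using MJ coordD[OF *(1) j(1)] by blast
    qed (use * j in blast)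
    then show False using coord_dual[OF *(1) j(1) j(1)] one_notin_M by simp
  qed
  define T where "T = {i. i < n \<and> f' i \<in> I}"
  have T: "T \<subseteq> {..<n}" "finite T" "f' ` T \<subseteq> I" by (auto simp: T_def)
  have "card ({..<n} - T) \<le> card Y"
  proof (rule card_inj_on_le[of f'])
    show "inj_on f' ({..<n} - T)"
    proof (rule inj_onI, rule ccontr)
      fix i j assume ij: "i \<in> {..<n} - T" "j \<in> {..<n} - T" "f' i = f' j" "i \<noteq> j"
      then have "\<one> = \<zero>" using coord_dual[OF *(1), of i i] coord_dual[OF *(1), of i j] by auto
      then show False using one_notin_M ideal_zero[OF M_ideal] by simp
    qed
    show "f' ` ({..<n} - T) \<subseteq> Y" using *(3) T' by (auto simp: T_def)
    show "finite Y" by (simp add: Y_def)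
  qed
  then have n: "n \<le> length ys + card T" using cY T by (simp add: card_Diff_subset)
  have "{P. primeideal P B} \<noteq> {}" using B.maximalideal_iff h.S.maximalideal_prime by blast
  then obtain e where e: "strict_chain {P. primeideal P B} (length ys) e"
    using chain_length_attained ys(2) unfolding krull_dim_def by metis
  have ker: "coord_ideal f' T \<subseteq> {x \<in> carrier R. h x = \<zero>\<^bsub>B\<^esub>}"
    using genideal_minimal[OF I T(3)] unfolding I_def .
  have "{x \<in> carrier R. h x = \<zero>\<^bsub>B\<^esub>} = coord_ideal f' T"
    using quotient_chain_bound[OF *(1) dim T(1) B ker e] n by linarith
  then show ?thesis using * T(1) by blast
qed

end


section \<open>Determinants and the existence of coordinates\<close>

lemma (in ring) add_pow_int_closed: "x \<in> carrier R \<Longrightarrow> add_pow R (k :: int) x \<in> carrier R"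
  by (rule add.int_pow_closed)

context local_algebra
begin

context
  fixes n :: nat and A :: "nat \<Rightarrow> nat \<Rightarrow> 'a"
begin

text \<open>The determinant of \<open>A\<close> with row \<open>i\<close> replaced by \<open>v\<close>.\<close>

definition row_det :: "nat \<Rightarrow> (nat \<Rightarrow> 'a) \<Rightarrow> 'a" where
  "row_det i v = ring_det R n (A(i := v))"

text \<open>The factor of \<open>v (p i)\<close> in the summand of \<open>row_det i v\<close> that belongs to \<open>p\<close>.\<close>

definition cofactor_term :: "nat \<Rightarrow> (nat \<Rightarrow> nat) \<Rightarrow> 'a" where
  "cofactor_term i p = add_pow R (sign p :: int) \<one> \<otimes> (\<Otimes>k\<in>{..<n} - {i}. A k (p k))"

context
  assumes A: "\<And>i j. i < n \<Longrightarrow> j < n \<Longrightarrow> A i j \<in> carrier R"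
begin

lemma permutes_less: "p permutes {..<n} \<Longrightarrow> k < n \<Longrightarrow> p k < n"
  using permutes_in_image[of p "{..<n}" k] by simp

lemma cofactor_closed: "p permutes {..<n} \<Longrightarrow> cofactor_term i p \<in> carrier R"
  unfolding cofactor_term_def using A permutes_less
  by (intro m_closed finprod_closed) (auto simp: add_pow_int_closed)

lemma finite_perms: "finite {p. p permutes {..<n}}"
  by (rule finite_permutations) simp

lemma row_det_eq:
  assumes i: "i < n" and v: "\<And>l. l < n \<Longrightarrow> v l \<in> carrier R"
  shows "row_det i v = (\<Oplus>p\<in>{p. p permutes {..<n}}. cofactor_term i p \<otimes> v (p i))"
  unfolding row_det_def ring_det_def
proof (rule finsum_cong'[OF refl])
  show "(\<lambda>p. cofactor_term i p \<otimes> v (p i)) \<in> {p. p permutes {..<n}} \<rightarrow> carrier R"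
    using cofactor_closed v permutes_less i by auto
  fix p assume "p \<in> {p. p permutes {..<n}}"
  then have p: "p permutes {..<n}" by simp
  have pk: "p k < n" if "k < n" for k using permutes_less[OF p that] .
  let ?r = "\<Otimes>k\<in>{..<n} - {i}. A k (p k)"
  have rc: "?r \<in> carrier R" using A pk by (intro finprod_closed) auto
  have vc: "v (p i) \<in> carrier R" using v pk i by blast
  have "(\<Otimes>k\<in>{..<n}. (A(i := v)) k (p k)) = (\<Otimes>k\<in>insert i ({..<n} - {i}). (A(i := v)) k (p k))"
    using i by (simp add: insert_absorb)
  also have "\<dots> = v (p i) \<otimes> (\<Otimes>k\<in>{..<n} - {i}. (A(i := v)) k (p k))"
    using A pk vc by (subst finprod_insert) auto
  also have "(\<Otimes>k\<in>{..<n} - {i}. (A(i := v)) k (p k)) = ?r"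
    using A pk by (intro finprod_cong') auto
  finally have eq: "(\<Otimes>k\<in>{..<n}. (A(i := v)) k (p k)) = v (p i) \<otimes> ?r" .
  let ?s = "add_pow R (sign p :: int) \<one>"
  have sc: "?s \<in> carrier R" by (simp add: add_pow_int_closed)
  have "add_pow R (sign p :: int) (v (p i) \<otimes> ?r) = ?s \<otimes> (v (p i) \<otimes> ?r)"
    using add_pow_ldistr_int[of \<one> "v (p i) \<otimes> ?r" "sign p"] rc vc by simp
  also have "\<dots> = (?s \<otimes> ?r) \<otimes> v (p i)" using sc rc vc by (simp add: m_ac)
  finally show "add_pow R (sign p :: int) (\<Otimes>k\<in>{..<n}. (A(i := v)) k (p k)) = cofactor_term i p \<otimes> v (p i)"
    unfolding eq cofactor_term_def .
qed

lemma row_det_linear: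
  assumes i: "i < n" and v: "\<And>l. l < n \<Longrightarrow> v l \<in> carrier R" and w: "\<And>l. l < n \<Longrightarrow> w l \<in> carrier R"
    and u: "u \<in> carrier R" and x: "\<And>l. l < n \<Longrightarrow> x l = v l \<oplus> u \<otimes> w l"
  shows "row_det i x = row_det i v \<oplus> u \<otimes> row_det i w"
proof -
  let ?P = "{p. p permutes {..<n}}"
  let ?c = "cofactor_term i"
  have pi: "p i < n" if "p \<in> ?P" for p using permutes_less i that by simp
  have xc: "x l \<in> carrier R" if "l < n" for l using x[OF that] v[OF that] w[OF that] u by simp
  have vf: "(\<lambda>p. ?c p \<otimes> v (p i)) \<in> ?P \<rightarrow> carrier R" "(\<lambda>p. ?c p \<otimes> w (p i)) \<in> ?P \<rightarrow> carrier R"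
    using cofactor_closed v w pi by auto
  have "row_det i x = (\<Oplus>p\<in>?P. ?c p \<otimes> x (p i))" by (rule row_det_eq[OF i xc])
  also have "\<dots> = (\<Oplus>p\<in>?P. ?c p \<otimes> v (p i) \<oplus> u \<otimes> (?c p \<otimes> w (p i)))"
  proof (rule finsum_cong'[OF refl])
    show "(\<lambda>p. ?c p \<otimes> v (p i) \<oplus> u \<otimes> (?c p \<otimes> w (p i))) \<in> ?P \<rightarrow> carrier R" using vf u by auto
    fix p assume p: "p \<in> ?P"
    have "?c p \<in> carrier R" "v (p i) \<in> carrier R" "w (p i) \<in> carrier R"
      using cofactor_closed v w pi[OF p] p by auto
    then show "?c p \<otimes> x (p i) = ?c p \<otimes> v (p i) \<oplus> u \<otimes> (?c p \<otimes> w (p i))"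
      unfolding x[OF pi[OF p]] using u by algebra
  qed
  also have "\<dots> = (\<Oplus>p\<in>?P. ?c p \<otimes> v (p i)) \<oplus> (\<Oplus>p\<in>?P. u \<otimes> (?c p \<otimes> w (p i)))"
    using vf u by (intro finsum_addf) auto
  also have "(\<Oplus>p\<in>?P. u \<otimes> (?c p \<otimes> w (p i))) = u \<otimes> (\<Oplus>p\<in>?P. ?c p \<otimes> w (p i))"
    using finsum_rdistr[OF finite_perms u vf(2)] by simp
  finally show ?thesis by (simp add: row_det_eq[OF i] v w)
qed

lemma row_det_in_M:
  assumes i: "i < n" and v: "\<And>l. l < n \<Longrightarrow> v l \<in> M"
  shows "row_det i v \<in> M"
proof -
  have vc: "v l \<in> carrier R" if "l < n" for l using v[OF that] by simp
  have "row_det i v = (\<Oplus>p\<in>{p. p permutes {..<n}}. cofactor_term i p \<otimes> v (p i))"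
    by (rule row_det_eq[OF i vc])
  also have "\<dots> \<in> M"
    using v permutes_less i cofactor_closed ideal_mult[OF M_ideal]
    by (intro ideal_finsum[OF M_ideal finite_perms]) auto
  finally show ?thesis .
qed

text \<open>Composition with the transposition of two equal rows changes the sign of each term.\<close>

lemma row_det_equal_rows:
  assumes i: "i < n" and k: "k < n" "k \<noteq> i"
  shows "row_det i (A k) = \<zero>"
proof -
  let ?P = "{p. p permutes {..<n}}" and ?t = "transpose i k"
  define B where "B = A(i := A k)"
  define t where "t p = add_pow R (sign p :: int) (\<Otimes>j\<in>{..<n}. B j (p j))" for p
  have Bc: "B j l \<in> carrier R" if "j < n" "l < n" for j l using A that k by (auto simp: B_def)
  have prodc: "(\<Otimes>j\<in>{..<n}. B j (p j)) \<in> carrier R" if "p \<in> ?P" for p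
    using that Bc permutes_less by (intro finprod_closed) auto
  then have tc: "t p \<in> carrier R" if "p \<in> ?P" for p
    using that by (simp add: t_def add_pow_int_closed)
  have tp: "?t permutes {..<n}" using i k by (intro permutes_swap_id) auto
  have tt: "?t (?t j) = j" for j by simp
  have Bt: "B (?t j) = B j" for j using k by (auto simp: B_def transpose_def)
  have inv: "t (p \<circ> ?t) = \<ominus> t p" if p: "p \<in> ?P" for p
  proof -
    have pp: "p permutes {..<n}" using p by simp
    have perm: "permutation p" "permutation ?t"
      using pp tp permutation_permutes finite_lessThan by blast+
    have "sign ?t = (- 1 :: int)" using k(2) by (simp add: sign_swap_id)
    then have sg: "sign (p \<circ> ?t) = - (sign p :: int)" using sign_compose[OF perm] by simp
    have "(\<Otimes>j\<in>{..<n}. B j (p j)) = (\<Otimes>j\<in>?t ` {..<n}. B j (p j))"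
      using permutes_image[OF tp] by simp
    also have "\<dots> = (\<Otimes>j\<in>{..<n}. B (?t j) (p (?t j)))"
      using Bc permutes_less[OF pp] permutes_image[OF tp] permutes_inj_on[OF tp]
      by (intro finprod_reindex) auto
    also have "\<dots> = (\<Otimes>j\<in>{..<n}. B j ((p \<circ> ?t) j))" by (simp add: Bt)
    finally have "t (p \<circ> ?t) = add_pow R (- (sign p :: int)) (\<Otimes>j\<in>{..<n}. B j (p j))"
      unfolding t_def sg by simp
    also have "\<dots> = \<ominus> t p"
      using add.int_pow_neg[OF prodc[OF p], of "sign p"] by (simp add: t_def)
    finally show ?thesis .
  qed
  have bij: "(\<lambda>p. p \<circ> ?t) ` ?P = ?P" "inj_on (\<lambda>p. p \<circ> ?t) ?P"
  proof -
    have id: "p \<circ> ?t \<circ> ?t = p" for p :: "nat \<Rightarrow> nat" by (auto simp: fun_eq_iff)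
    show "inj_on (\<lambda>p. p \<circ> ?t) ?P" by (rule inj_onI) (metis id)
    have "p \<circ> ?t \<in> ?P" if "p \<in> ?P" for p using permutes_compose[OF tp, of p] that by simp
    then show "(\<lambda>p. p \<circ> ?t) ` ?P = ?P" using id by (auto simp: image_iff) (metis id)
  qed
  define s where "s = (\<Oplus>p\<in>?P. t p)"
  have sc: "s \<in> carrier R" unfolding s_def using tc by (intro finsum_closed) auto
  have "s = (\<Oplus>p\<in>(\<lambda>p. p \<circ> ?t) ` ?P. t p)" unfolding s_def bij ..
  also have "\<dots> = (\<Oplus>p\<in>?P. t (p \<circ> ?t))"
    using tc bij by (intro finsum_reindex) auto
  also have "\<dots> = (\<Oplus>p\<in>?P. \<zero> \<oplus> (\<ominus> \<one>) \<otimes> t p)"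
    using inv tc by (intro finsum_cong') (auto simp: l_minus)
  also have "\<dots> = (\<Oplus>p\<in>?P. (\<ominus> \<one>) \<otimes> t p)"
    using tc by (intro finsum_cong') auto
  also have "\<dots> = (\<ominus> \<one>) \<otimes> s"
    unfolding s_def using finsum_rdistr[OF finite_perms, of "\<ominus> \<one>" t] tc by simp
  finally have "s = \<ominus> s" using sc by (simp add: l_minus)
  \<comment> \<open>As \<open>2\<close> is a unit, \<open>s + s = 0\<close> suffices.\<close>
  then have "s \<oplus> s = \<zero>" using sc by (metis r_neg)
  then have "add_pow R (Suc 1) s \<in> {\<zero>}" using sc by simp
  then have "s = \<zero>" using add_pow_Suc_ideal[OF zeroideal sc] by blast
  then show ?thesis unfolding row_det_def ring_det_def s_def t_def B_def .
qed

end

end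

text \<open>Gauss elimination. The induction keeps the derivations \<open>d\<^sub>j\<close> in the span of
  \<open>D\<^sub>0, \<dots>, D\<^bsub>t-1\<^esub>\<close>, in the form that replacing row \<open>i \<ge> t\<close> by \<open>(d\<^sub>j F\<^sub>l)\<^sub>l\<close> makes the determinant
  vanish modulo \<open>M\<close>.\<close>

theorem coordinates_exist:
  assumes gen: "Y \<subseteq> M" "Idl Y = M" "finite Y" "card Y \<le> n"
    and D: "\<And>i. i < n \<Longrightarrow> D i \<in> derivs R C" and F: "\<And>j. j < n \<Longrightarrow> F j \<in> M"
    and det: "ring_det R n (\<lambda>i j. D i (F j)) \<notin> M"
  shows "\<exists>f d. coordinates n f d"
proof -
  define A where "A = (\<lambda>i j. D i (F j))"
  have Fc: "F j \<in> carrier R" if "j < n" for j using F[OF that] by simp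
  have A: "A i j \<in> carrier R" if "i < n" "j < n" for i j
    unfolding A_def using deriv_closed[OF D[OF that(1)] Fc[OF that(2)]] .
  \<comment> \<open>The derivations whose values at the \<open>F\<^sub>l\<close>, in place of row \<open>i\<close>, give a determinant in \<open>M\<close>.\<close>
  define V where "V i = {E \<in> derivs R C. row_det n A i (\<lambda>l. E (F l)) \<in> M}" for i
  have Vlin: "G \<in> V i"
    if "i < n" "E \<in> V i" "E' \<in> V i" "u \<in> carrier R" "G \<in> derivs R C"
      "\<And>x. x \<in> carrier R \<Longrightarrow> G x = E x \<oplus> u \<otimes> E' x" for i E E' G u
  proof -
    have E: "E (F l) \<in> carrier R" "E' (F l) \<in> carrier R" if "l < n" for l
      using \<open>E \<in> V i\<close> \<open>E' \<in> V i\<close> deriv_closed[OF _ Fc[OF that]] by (auto simp: V_def)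
    have "row_det n A i (\<lambda>l. G (F l)) = row_det n A i (\<lambda>l. E (F l)) \<oplus> u \<otimes> row_det n A i (\<lambda>l. E' (F l))"
      using that Fc E by (intro row_det_linear[OF A]) (auto simp: V_def)
    then show ?thesis
      using that ideal_add[OF M_ideal] ideal_mult[OF M_ideal] by (auto simp: V_def)
  qed
  have VE: "E \<in> derivs R C" "x \<in> carrier R \<Longrightarrow> E x \<in> carrier R" if "E \<in> V i" for E i x
    using that deriv_closed[of E R C x] by (auto simp: V_def)
  have V0: "(\<lambda>x. \<zero>) \<in> V i" if "i < n" for i
    using row_det_in_M[OF A that] ideal_zero[OF M_ideal] deriv_null by (auto simp: V_def)
  have Vcmult: "(\<lambda>x. u \<otimes> E x) \<in> V i" if "i < n" "E \<in> V i" "u \<in> carrier R" for i E u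
    by (rule Vlin[OF that(1) V0[OF that(1)] that(2,3)])
      (use that deriv_cmult[OF VE(1)] VE(2) in auto)
  have Vsub: "(\<lambda>x. E x \<ominus> u \<otimes> E' x) \<in> V i" if "i < n" "E \<in> V i" "E' \<in> V i" "u \<in> carrier R" for i E E' u
    by (rule Vlin[OF that(1,2,3), of "\<ominus> u"])
      (use that deriv_sub[OF VE(1) VE(1)] VE(2) in \<open>auto simp: minus_eq l_minus\<close>)
  have Vsum: "(\<lambda>x. \<Oplus>j\<in>T. u j \<otimes> E j x) \<in> V i"
    if "i < n" "finite T" "\<And>j. j \<in> T \<Longrightarrow> E j \<in> V i" "\<And>j. j \<in> T \<Longrightarrow> u j \<in> carrier R" for i T u E
    using that(2-)
  proof (induct T)
    case (insert k T)
    have E: "E j \<in> derivs R C" if "j \<in> insert k T" for j using insert.prems(1)[OF that] by (simp add: V_def)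
    have "(\<Oplus>j\<in>insert k T. u j \<otimes> E j x) = (\<Oplus>j\<in>T. u j \<otimes> E j x) \<oplus> u k \<otimes> E k x" if x: "x \<in> carrier R" for x
    proof -
      have c: "u j \<otimes> E j x \<in> carrier R" if "j \<in> insert k T" for j
        using that insert.prems(2) deriv_closed[OF E x] by blast
      then have "(\<Oplus>j\<in>insert k T. u j \<otimes> E j x) = u k \<otimes> E k x \<oplus> (\<Oplus>j\<in>T. u j \<otimes> E j x)"
        using insert.hyps by (intro finsum_insert) auto
      also have "\<dots> = (\<Oplus>j\<in>T. u j \<otimes> E j x) \<oplus> u k \<otimes> E k x"
        using c by (intro a_comm finsum_closed) auto
      finally show ?thesis .
    qed
    moreover have "(\<lambda>x. \<Oplus>j\<in>insert k T. u j \<otimes> E j x) \<in> derivs R C"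
      using insert E by (intro deriv_finsum) auto
    ultimately show ?case
      using Vlin[OF that(1), of "\<lambda>x. \<Oplus>j\<in>T. u j \<otimes> E j x" "E k" "u k"] insert by blast
  qed (use V0[OF that(1)] in simp)
  have VD: "D k \<in> V i" if "i < n" "k < n" "k \<noteq> i" for i k
  proof -
    have "row_det n A i (A k) = \<zero>" by (rule row_det_equal_rows) (use A that in auto)
    then show ?thesis using D that ideal_zero[OF M_ideal] by (simp add: V_def A_def)
  qed
  have VDi: "D i \<notin> V i" if "i < n" for i
  proof -
    have "A(i := \<lambda>l. D i (F l)) = A" by (auto simp: A_def)
    then show ?thesis using det unfolding V_def row_det_def by (simp add: A_def)
  qed
  have Yc: "Y \<subseteq> carrier R" using gen M_subset by blast
  have "\<exists>f d. (\<forall>i<t. f i \<in> Y \<and> d i \<in> derivs R C \<and> (\<forall>k. t \<le> k \<and> k < n \<longrightarrow> d i \<in> V k)) \<and>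
      (\<forall>i<t. \<forall>j<t. d i (f j) = (if i = j then \<one> else \<zero>))" if "t \<le> n" for t
    using that
  proof (induct t)
    case (Suc t)
    from Suc.hyps[OF Suc_leD[OF Suc.prems]] obtain f d where fd0:
      "\<forall>i<t. f i \<in> Y \<and> d i \<in> derivs R C \<and> (\<forall>k. t \<le> k \<and> k < n \<longrightarrow> d i \<in> V k)"
      "\<forall>i<t. \<forall>j<t. d i (f j) = (if i = j then \<one> else \<zero>)"
      by (elim exE conjE)
    then have fd: "\<And>i. i < t \<Longrightarrow> f i \<in> Y" "\<And>i. i < t \<Longrightarrow> d i \<in> derivs R C"
      "\<And>i k. i < t \<Longrightarrow> t \<le> k \<Longrightarrow> k < n \<Longrightarrow> d i \<in> V k"
      "\<And>i j. i < t \<Longrightarrow> j < t \<Longrightarrow> d i (f j) = (if i = j then \<one> else \<zero>)"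
      by blast+
    have t: "t < n" using Suc.prems by simp
    have fc: "f i \<in> carrier R" if "i < t" for i using fd(1)[OF that] Yc by blast
    define u where "u j = D t (f j)" for j
    have u: "u j \<in> carrier R" if "j < t" for j using deriv_closed[OF D[OF t] fc[OF that]] by (simp add: u_def)
    define H where "H = (\<lambda>x. \<Oplus>j\<in>{..<t}. u j \<otimes> d j x)"
    have H: "H \<in> derivs R C" unfolding H_def using fd(2) u by (intro deriv_finsum) auto
    have HV: "H \<in> V k" if "t \<le> k" "k < n" for k
      unfolding H_def using fd(3) u that by (intro Vsum) auto
    have Hf: "H (f j) = u j" if j: "j < t" for j
    proof -
      have "H (f j) = (\<Oplus>i\<in>{..<t}. u i \<otimes> (if i = j then \<one> else \<zero>))"
        unfolding H_def using u fd(4)[OF _ j] by (intro finsum_cong') auto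
      then show ?thesis using finsum_delta[of "{..<t}" j u] u j by simp
    qed
    define E where "E = (\<lambda>x. D t x \<ominus> \<one> \<otimes> H x)"
    have E: "E \<in> derivs R C" unfolding E_def using deriv_sub[OF D[OF t] H one_closed] .
    have Ef: "E (f j) = \<zero>" if "j < t" for j
      unfolding E_def Hf[OF that] using u[OF that] by (simp add: u_def[symmetric] minus_eq r_neg)
    have "\<exists>x\<in>Y. E x \<notin> M"
    proof (rule ccontr)
      assume "\<not> (\<exists>x\<in>Y. E x \<notin> M)"
      then have EM: "E x \<in> M" if "x \<in> M" for x
        using deriv_genideal[OF E Yc M_ideal gen(1), of x] gen(2) that by blast
      then have "E \<in> V t" using E F row_det_in_M[OF A t] by (simp add: V_def)
      moreover have "D t x = E x \<oplus> \<one> \<otimes> H x" if x: "x \<in> carrier R" for x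
      proof -
        have "D t x \<in> carrier R" "H x \<in> carrier R" using deriv_closed D[OF t] H x by metis+
        then show ?thesis unfolding E_def by algebra
      qed
      ultimately have "D t \<in> V t" using Vlin[OF t _ HV[OF order_refl t] one_closed D[OF t]] by blast
      then show False using VDi[OF t] by blast
    qed
    then obtain x where x: "x \<in> Y" "E x \<notin> M" by blast
    have xc: "x \<in> carrier R" using x Yc by blast
    have ExU: "E x \<in> Units R" using unit_if_notin_M[OF deriv_closed[OF E xc] x(2)] .
    define c where "c = inv (E x)"
    have c: "c \<in> carrier R" "c \<otimes> E x = \<one>" using ExU by (auto simp: c_def)
    define G where "G = (\<lambda>y. c \<otimes> E y)"
    have G: "G \<in> derivs R C" "G x = \<one>" "\<And>j. j < t \<Longrightarrow> G (f j) = \<zero>"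
      unfolding G_def using deriv_cmult[OF E c(1)] c Ef by auto
    have GV: "G \<in> V k" if "Suc t \<le> k" "k < n" for k
      unfolding G_def E_def
      by (intro Vcmult Vsub VD HV one_closed c(1)) (use that t in auto)
    define d' where "d' i = (if i = t then G else (\<lambda>y. d i y \<ominus> d i x \<otimes> G y))" for i
    have dx: "d i x \<in> carrier R" if "i < t" for i using deriv_closed[OF fd(2)[OF that] xc] .
    have "(f(t := x)) i \<in> Y" if "i < Suc t" for i using that fd(1) x by (auto simp: less_Suc_eq)
    moreover have "d' i \<in> derivs R C" if "i < Suc t" for i
      using that G(1) deriv_sub[OF fd(2) G(1) dx] by (auto simp: d'_def less_Suc_eq)
    moreover have "d' i \<in> V k" if "i < Suc t" "Suc t \<le> k" "k < n" for i k
      using that GV Vsub[OF that(3) fd(3) GV dx] by (auto simp: d'_def less_Suc_eq)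
    moreover have "d' i ((f(t := x)) j) = (if i = j then \<one> else \<zero>)" if "i < Suc t" "j < Suc t" for i j
      using that G fd(4)[of i j] dx[of i]
      by (auto simp: d'_def less_Suc_eq minus_eq r_neg)
    ultimately show ?case by (intro exI[of _ "f(t := x)"] exI[of _ d']) blast
  qed simp
  from this[OF order_refl] obtain f d where fd: "\<And>i. i < n \<Longrightarrow> f i \<in> Y \<and> d i \<in> derivs R C"
    "\<And>i j. i < n \<Longrightarrow> j < n \<Longrightarrow> d i (f j) = (if i = j then \<one> else \<zero>)"
    by blast
  \<comment> \<open>The \<open>f\<^sub>i\<close> are distinct, and \<open>Y\<close> has at most \<open>n\<close> elements, so they exhaust \<open>Y\<close>.\<close>
  have "inj_on f {..<n}"
  proof (rule inj_onI, rule ccontr)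
    fix i j assume ij: "i \<in> {..<n}" "j \<in> {..<n}" "f i = f j" "i \<noteq> j"
    then have "\<one> = \<zero>" using fd(2)[of i i] fd(2)[of i j] by auto
    then show False using one_notin_M ideal_zero[OF M_ideal] by simp
  qed
  then have "card (f ` {..<n}) = n" by (simp add: card_image)
  moreover have "f ` {..<n} \<subseteq> Y" using fd by blast
  ultimately have "f ` {..<n} = Y" using gen(3,4) by (metis card_seteq)
  then have "coordinates n f d" using fd gen unfolding coordinates_def by auto
  then show ?thesis by blast
qed

end


section \<open>Lengths of quotients under a Lie algebroid\<close>

text \<open>The constants of a \<open>K\<close>-algebra.\<close>

abbreviation constants :: "('k, 'z) ring_scheme \<Rightarrow> ('k, 'a, 'y) module_scheme \<Rightarrow> 'a set" where
  "constants K A \<equiv> (\<lambda>c. c \<odot>\<^bsub>A\<^esub> \<one>\<^bsub>A\<^esub>) ` carrier K"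

lemma derivations_subset_derivs:
  assumes "algebra K A"
  shows "derivations K A \<subseteq> derivs A (constants K A)"
proof
  interpret A: cring A by (rule algebra.M_cring[OF assms])
  fix D assume D: "D \<in> derivations K A"
  note D' = D[unfolded derivations_def mem_Collect_eq]
  have c: "D a \<in> carrier A" if "a \<in> carrier A" for a using D' that by blast
  have "D \<one>\<^bsub>A\<^esub> = (D \<one>\<^bsub>A\<^esub> \<otimes>\<^bsub>A\<^esub> \<one>\<^bsub>A\<^esub>) \<oplus>\<^bsub>A\<^esub> (\<one>\<^bsub>A\<^esub> \<otimes>\<^bsub>A\<^esub> D \<one>\<^bsub>A\<^esub>)"
    using D' A.one_closed A.l_one by metis
  then have "D \<one>\<^bsub>A\<^esub> = \<zero>\<^bsub>A\<^esub>" using c[of "\<one>\<^bsub>A\<^esub>"] by (simp add: A.add.r_cancel_one)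
  then have "D (r \<odot>\<^bsub>A\<^esub> \<one>\<^bsub>A\<^esub>) = \<zero>\<^bsub>A\<^esub>" if "r \<in> carrier K" for r
    using D' that module.smult_r_null[OF algebra.axioms(1)[OF assms]] by simp
  then show "D \<in> derivs A (constants K A)"
    using D' c by (auto simp: derivs_def)
qed

lemma (in cring) deriv_ideal_prod:
  assumes D: "D \<in> derivs R C" and I: "ideal I R" "\<And>a. a \<in> I \<Longrightarrow> D a \<in> I"
    and J: "ideal J R" "\<And>a. a \<in> J \<Longrightarrow> D a \<in> J" and x: "x \<in> ideal_prod R I J"
  shows "D x \<in> ideal_prod R I J"
  using x
proof induct
  case (prod i j)
  have "i \<in> carrier R" "j \<in> carrier R" using prod ideal_subset[OF I(1)] ideal_subset[OF J(1)] by auto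
  then show ?case
    using deriv_mult[OF D, of i j] prod I(2) J(2) by (simp add: ideal_prod.intros)
next
  case (sum s t)
  have "s \<in> carrier R" "t \<in> carrier R" using sum ideal_prod_in_carrier[OF I(1) J(1)] by auto
  then show ?case using deriv_add[OF D, of s t] sum by (simp add: ideal_prod.sum)
qed

context lie_algebroid
begin

lemma A_cring: "cring A"
  using algebra by (simp add: algebra.M_cring)

interpretation A: cring A by (rule A_cring)

lemma anchor_deriv: "\<delta> \<in> carrier g \<Longrightarrow> \<alpha> \<delta> \<in> derivs A (constants K A)"
  using anchor_derivation derivations_subset_derivs[OF algebra] by blast

text \<open>Sets, in practice ideals, that are preserved by the image of the anchor.\<close>

definition anchor_stable :: "'a set \<Rightarrow> bool" where
  "anchor_stable I \<longleftrightarrow> (\<forall>\<delta>\<in>carrier g. \<forall>a\<in>I. \<alpha> \<delta> a \<in> I)"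

text \<open>The submodules that \<open>lie_length\<close> counts in the quotient \<open>A/J\<close>.\<close>

abbreviation stable_submodules :: "'a set \<Rightarrow> 'a set set set" where
  "stable_submodules J \<equiv> {N. submodule N A (quotient_module A J) \<and>
     (\<forall>\<delta>\<in>carrier g. \<forall>x\<in>N. quotient_map A J (\<alpha> \<delta>) x \<in> N)}"

lemma quotient_module_simps [simp]:
  "carrier (quotient_module A J) = carrier (A Quot J)"
  "(\<oplus>\<^bsub>quotient_module A J\<^esub>) = (\<oplus>\<^bsub>A Quot J\<^esub>)"
  "\<zero>\<^bsub>quotient_module A J\<^esub> = \<zero>\<^bsub>A Quot J\<^esub>"
  "a \<odot>\<^bsub>quotient_module A J\<^esub> y = (J +>\<^bsub>A\<^esub> a) \<otimes>\<^bsub>A Quot J\<^esub> y"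
  by (simp_all add: quotient_module_def ring.defs module.defs)

lemma zero_Quot: "\<zero>\<^bsub>R Quot I\<^esub> = I"
  unfolding FactRing_def by simp

lemma carrier_Quot: "carrier (R Quot I) = (\<lambda>a. I +>\<^bsub>R\<^esub> a) ` carrier R"
  by (auto simp: FactRing_simps)

lemma subgroup_quotient_module:
  "subgroup H (add_monoid (quotient_module A J)) \<longleftrightarrow> subgroup H (add_monoid (A Quot J))"
  by (simp add: subgroup_def m_inv_def)

lemma quotient_map_coset:
  assumes J: "ideal J A" "anchor_stable J" and \<delta>: "\<delta> \<in> carrier g" and a: "a \<in> carrier A"
  shows "quotient_map A J (\<alpha> \<delta>) (J +>\<^bsub>A\<^esub> a) = J +>\<^bsub>A\<^esub> \<alpha> \<delta> a"
proof -
  interpret J: ideal J A by fact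
  note D = anchor_deriv[OF \<delta>]
  have "J +>\<^bsub>A\<^esub> \<alpha> \<delta> x = J +>\<^bsub>A\<^esub> \<alpha> \<delta> a" if x: "x \<in> J +>\<^bsub>A\<^esub> a" for x
  proof -
    obtain j where j: "j \<in> J" "x = j \<oplus>\<^bsub>A\<^esub> a" using x by (auto simp: a_r_coset_def')
    have jc: "j \<in> carrier A" "\<alpha> \<delta> j \<in> J" using j J \<delta> by (auto simp: anchor_stable_def)
    have "\<alpha> \<delta> x = \<alpha> \<delta> j \<oplus>\<^bsub>A\<^esub> \<alpha> \<delta> a" using deriv_add[OF D jc(1) a] j by simp
    then have "\<alpha> \<delta> x \<in> J +>\<^bsub>A\<^esub> \<alpha> \<delta> a" using jc by (auto simp: a_r_coset_def')
    then show ?thesis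
      using J.a_repr_independence'[OF _ deriv_closed[OF D a]] by simp
  qed
  moreover have "a \<in> J +>\<^bsub>A\<^esub> a" using J.a_rcos_self[OF a] .
  ultimately show ?thesis unfolding quotient_map_def by blast
qed

lemma image_stable_submodule:
  assumes J: "ideal J A" "anchor_stable J" and Q: "ideal Q A" "anchor_stable Q"
  shows "(\<lambda>a. J +>\<^bsub>A\<^esub> a) ` Q \<in> stable_submodules J"
proof -
  interpret J: ideal J A by fact
  interpret Q: ideal Q A by fact
  interpret q: ring_hom_ring A "A Quot J" "(+>\<^bsub>A\<^esub>) J" by (rule J.rcos_ring_hom_ring)
  have "subgroup ((\<lambda>a. J +>\<^bsub>A\<^esub> a) ` Q) (add_monoid (A Quot J))"
    by (rule q.img_is_add_subgroup[OF Q.a_subgroup])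
  then have "submodule ((\<lambda>a. J +>\<^bsub>A\<^esub> a) ` Q) A (quotient_module A J)"
    unfolding submodule_def submodule_axioms_def subgroup_quotient_module
    using Q.I_l_closed Q.Icarr by (auto simp flip: q.hom_mult)
  moreover have "quotient_map A J (\<alpha> \<delta>) x \<in> (\<lambda>a. J +>\<^bsub>A\<^esub> a) ` Q"
    if \<delta>: "\<delta> \<in> carrier g" and x: "x \<in> (\<lambda>a. J +>\<^bsub>A\<^esub> a) ` Q" for \<delta> x
  proof -
    obtain a where a: "a \<in> Q" "x = J +>\<^bsub>A\<^esub> a" using x by blast
    then have "quotient_map A J (\<alpha> \<delta>) x = J +>\<^bsub>A\<^esub> \<alpha> \<delta> a"
      using quotient_map_coset[OF J \<delta> Q.Icarr] by simp
    then show ?thesis using a Q(2) \<delta> by (auto simp: anchor_stable_def)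
  qed
  ultimately show ?thesis by blast
qed

lemma image_strict_mono:
  assumes J: "ideal J A" and P: "ideal P A" "J \<subseteq> P" and Q: "ideal Q A" "P \<subset> Q"
  shows "(\<lambda>a. J +>\<^bsub>A\<^esub> a) ` P \<subset> (\<lambda>a. J +>\<^bsub>A\<^esub> a) ` Q"
proof -
  interpret J: ideal J A by fact
  obtain x where x: "x \<in> Q" "x \<notin> P" using Q by blast
  have "J +>\<^bsub>A\<^esub> x \<notin> (\<lambda>a. J +>\<^bsub>A\<^esub> a) ` P"
  proof
    assume "J +>\<^bsub>A\<^esub> x \<in> (\<lambda>a. J +>\<^bsub>A\<^esub> a) ` P"
    then obtain p where p: "p \<in> P" "J +>\<^bsub>A\<^esub> x = J +>\<^bsub>A\<^esub> p" by blast
    have "x \<in> J +>\<^bsub>A\<^esub> p" using J.a_rcos_self[of x] p x A.ideal_subset[OF Q(1)] by auto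
    then obtain j where "j \<in> J" "x = j \<oplus>\<^bsub>A\<^esub> p" by (auto simp: a_r_coset_def')
    then have "x \<in> P" using p P A.ideal_add[OF P(1)] by blast
    then show False using x by blast
  qed
  then show ?thesis using Q x by blast
qed

lemma vimage_stable_submodule:
  assumes Q: "ideal Q A" "anchor_stable Q" and N: "N \<in> stable_submodules Q"
  defines "I \<equiv> {a \<in> carrier A. Q +>\<^bsub>A\<^esub> a \<in> N}"
  shows "ideal I A" "anchor_stable I" "Q \<subseteq> I" "N = (\<lambda>a. Q +>\<^bsub>A\<^esub> a) ` I"
proof -
  interpret Q: ideal Q A by fact
  interpret q: ring_hom_ring A "A Quot Q" "(+>\<^bsub>A\<^esub>) Q" by (rule Q.rcos_ring_hom_ring)
  interpret N: submodule N A "quotient_module A Q" using N by blast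
  have N0: "\<zero>\<^bsub>A Quot Q\<^esub> \<in> N" using N.one_closed by simp
  show I: "ideal I A"
  proof (rule A.ideal_cringI)
    show "\<zero>\<^bsub>A\<^esub> \<in> I" using N0 by (simp add: I_def flip: q.hom_zero)
    show "a \<oplus>\<^bsub>A\<^esub> b \<in> I" if "a \<in> I" "b \<in> I" for a b
      using N.m_closed[of "Q +>\<^bsub>A\<^esub> a" "Q +>\<^bsub>A\<^esub> b"] that by (simp add: I_def)
    show "x \<otimes>\<^bsub>A\<^esub> a \<in> I" if "a \<in> I" "x \<in> carrier A" for a x
      using N.smult_closed[of x "Q +>\<^bsub>A\<^esub> a"] that by (simp add: I_def)
  qed (auto simp: I_def)
  show "anchor_stable I"
    unfolding anchor_stable_def
  proof (intro ballI)
    fix \<delta> a assume \<delta>: "\<delta> \<in> carrier g" and "a \<in> I"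
    then have a: "a \<in> carrier A" "Q +>\<^bsub>A\<^esub> a \<in> N" by (auto simp: I_def)
    then have "quotient_map A Q (\<alpha> \<delta>) (Q +>\<^bsub>A\<^esub> a) \<in> N" using N \<delta> by blast
    then show "\<alpha> \<delta> a \<in> I"
      using quotient_map_coset[OF Q \<delta> a(1)] deriv_closed[OF anchor_deriv[OF \<delta>] a(1)] by (simp add: I_def)
  qed
  show "Q \<subseteq> I"
  proof
    fix a assume "a \<in> Q"
    then have "Q +>\<^bsub>A\<^esub> a = Q" by (rule Q.a_rcos_const)
    moreover have "Q \<in> N" using N0 unfolding zero_Quot .
    ultimately show "a \<in> I" using Q.Icarr[OF \<open>a \<in> Q\<close>] by (simp add: I_def)
  qed
  have "N \<subseteq> (\<lambda>a. Q +>\<^bsub>A\<^esub> a) ` carrier A" using N.subset by (simp add: carrier_Quot)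
  then show "N = (\<lambda>a. Q +>\<^bsub>A\<^esub> a) ` I" unfolding I_def by blast
qed

text \<open>The length of \<open>A/Q\<close> is at most that of \<open>A/J\<close> for \<open>J \<subseteq> Q\<close>.\<close>

lemma defining_ideal_mono:
  assumes J: "defining_ideal A g \<alpha> J" and Q: "ideal Q A" "anchor_stable Q" "J \<subseteq> Q" "Q \<noteq> carrier A"
  shows "defining_ideal A g \<alpha> Q"
proof -
  have Ji: "ideal J A" "anchor_stable J" using J by (auto simp: defining_ideal_def anchor_stable_def)
  have "chain_length (stable_submodules Q) \<le> chain_length (stable_submodules J)"
    unfolding chain_length_def
  proof (rule Sup_mono, safe)
    fix n c assume c: "\<forall>i\<le>n. c i \<in> stable_submodules Q" "\<forall>i<n. c i \<subset> c (Suc i)"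
    define I where "I i = {a \<in> carrier A. Q +>\<^bsub>A\<^esub> a \<in> c i}" for i
    note v = vimage_stable_submodule[OF Q(1,2) c(1)[rule_format], folded I_def]
    define e where "e i = (\<lambda>a. J +>\<^bsub>A\<^esub> a) ` I i" for i
    have e: "e i \<in> stable_submodules J" if "i \<le> n" for i
      unfolding e_def using image_stable_submodule[OF Ji v(1,2)] that by blast
    have "e i \<subset> e (Suc i)" if i: "i < n" for i
      unfolding e_def
    proof (rule image_strict_mono[OF Ji(1)])
      show "ideal (I i) A" "ideal (I (Suc i)) A" "J \<subseteq> I i"
        using v(1)[of i] v(1)[of "Suc i"] v(3)[of i] i Q(3) by auto
      have "I i \<noteq> I (Suc i)" using v(4)[of i] v(4)[of "Suc i"] c(2) i by auto
      moreover have "I i \<subseteq> I (Suc i)" using c(2) i by (auto simp: I_def)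
      ultimately show "I i \<subset> I (Suc i)" by blast
    qed
    then show "\<exists>a\<in>{enat n |n. \<exists>C. (\<forall>i\<le>n. C i \<in> stable_submodules J) \<and> (\<forall>i<n. C i \<subset> C (Suc i))}. enat n \<le> a"
      using e by (intro bexI[of _ "enat n"]) auto
  qed
  then show ?thesis
    using J Q unfolding defining_ideal_def lie_length_def anchor_stable_def by auto
qed

text \<open>In a quotient of finite length, descending chains of stable ideals stop.\<close>

lemma stable_chain_stops:
  assumes J: "defining_ideal A g \<alpha> J"
    and Q: "\<And>k. ideal (Q k) A" "\<And>k. anchor_stable (Q k)" "\<And>k. J \<subseteq> Q k" "\<And>k. Q (Suc k) \<subseteq> Q k"
  shows "\<exists>k. Q (Suc k) = Q (k :: nat)"
proof (rule ccontr)
  assume "\<nexists>k. Q (Suc k) = Q k"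
  then have ss: "Q (Suc k) \<subset> Q k" for k using Q(4) by blast
  have Ji: "ideal J A" "anchor_stable J" using J by (auto simp: defining_ideal_def anchor_stable_def)
  have ge: "enat N \<le> chain_length (stable_submodules J)" for N
  proof -
    define e where "e i = (\<lambda>a. J +>\<^bsub>A\<^esub> a) ` Q (N - i)" for i
    have "e i \<in> stable_submodules J" for i
      unfolding e_def by (rule image_stable_submodule[OF Ji Q(1,2)])
    moreover have "e i \<subset> e (Suc i)" if "i < N" for i
    proof -
      have "N - i = Suc (N - Suc i)" using that by simp
      then show ?thesis unfolding e_def using image_strict_mono[OF Ji(1) Q(1,3) Q(1) ss] by simp
    qed
    ultimately show ?thesis unfolding chain_length_def by (intro Sup_upper) blast
  qed
  have "chain_length (stable_submodules J) < \<infinity>"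
    using J by (simp add: defining_ideal_def lie_length_def)
  then obtain m where "chain_length (stable_submodules J) = enat m" by auto
  then show False using ge[of "Suc m"] by simp
qed

end


section \<open>Allowed algebras\<close>

text \<open>An allowed algebra \<open>A\<close> with a chosen presentation, a surjection \<open>\<phi>\<close> from a regular local algebra
  \<open>S\<close> that satisfies the weak Jacobian condition.\<close>

locale allowed_presentation =
  fixes K :: "('k, 'z) ring_scheme"
    and S :: "('k, 's, 'w) module_scheme"
    and A :: "('k, 'a, 'y) module_scheme"
    and \<phi> :: "'s \<Rightarrow> 'a"
  assumes K: "field K" "char_zero K"
    and S: "algebra K S" "regular_local_ring S" "weak_jacobian K S"
    and A: "algebra K A" "local_ring A"
    and \<phi>: "\<phi> \<in> ring_hom S A" "\<phi> ` carrier S = carrier A"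
      "\<And>c s. c \<in> carrier K \<Longrightarrow> s \<in> carrier S \<Longrightarrow> \<phi> (c \<odot>\<^bsub>S\<^esub> s) = c \<odot>\<^bsub>A\<^esub> \<phi> s"
    and residue: "\<And>a. a \<in> carrier A \<Longrightarrow>
      \<exists>c\<in>carrier K. \<exists>m\<in>max_ideal A. a = (c \<odot>\<^bsub>A\<^esub> \<one>\<^bsub>A\<^esub>) \<oplus>\<^bsub>A\<^esub> m"

lemma add_pow_algebra:
  assumes "algebra K S"
  shows "add_pow K (k :: nat) \<one>\<^bsub>K\<^esub> \<odot>\<^bsub>S\<^esub> \<one>\<^bsub>S\<^esub> = add_pow S k \<one>\<^bsub>S\<^esub>"
proof -
  interpret K: cring K using algebra.R_cring[OF assms] .
  interpret S: cring S using algebra.M_cring[OF assms] .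
  note m = algebra.axioms(1)[OF assms]
  show ?thesis
    by (induct k) (simp_all add: module.smult_l_null[OF m] module.smult_l_distr[OF m] module.smult_one[OF m])
qed

lemma nat_unit_algebra:
  assumes K: "field K" "char_zero K" and S: "algebra K S"
  shows "add_pow S (Suc n) \<one>\<^bsub>S\<^esub> \<in> Units S"
proof -
  interpret K: field K by fact
  interpret S: cring S using algebra.M_cring[OF S] .
  note m = algebra.axioms(1)[OF S]
  let ?x = "add_pow K (Suc n) \<one>\<^bsub>K\<^esub>"
  have xc: "?x \<in> carrier K" by (rule K.add.nat_pow_closed[OF K.one_closed])
  have "?x \<noteq> \<zero>\<^bsub>K\<^esub>" using K(2) unfolding char_zero_def by blast
  then have "?x \<in> Units K" using xc K.field_Units by blast
  then obtain y where y: "y \<in> carrier K" "y \<otimes>\<^bsub>K\<^esub> ?x = \<one>\<^bsub>K\<^esub>" by (auto simp: Units_def)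
  let ?u = "?x \<odot>\<^bsub>S\<^esub> \<one>\<^bsub>S\<^esub>" and ?v = "y \<odot>\<^bsub>S\<^esub> \<one>\<^bsub>S\<^esub>"
  have uv: "?u \<in> carrier S" "?v \<in> carrier S"
    using module.smult_closed[OF m] xc y(1) S.one_closed by blast+
  have "?v \<otimes>\<^bsub>S\<^esub> ?u = y \<odot>\<^bsub>S\<^esub> (\<one>\<^bsub>S\<^esub> \<otimes>\<^bsub>S\<^esub> ?u)"
    using algebra.smult_assoc2[OF S y(1) S.one_closed uv(1)] .
  also have "\<dots> = (y \<otimes>\<^bsub>K\<^esub> ?x) \<odot>\<^bsub>S\<^esub> \<one>\<^bsub>S\<^esub>"
    using uv module.smult_assoc1[OF m y(1) xc S.one_closed] by simp
  also have "\<dots> = \<one>\<^bsub>S\<^esub>" using y(2) module.smult_one[OF m S.one_closed] by simp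
  finally have "?v \<otimes>\<^bsub>S\<^esub> ?u = \<one>\<^bsub>S\<^esub>" .
  then have "?u \<in> Units S" using uv S.m_comm[OF uv] unfolding Units_def by force
  then show ?thesis using add_pow_algebra[OF S, of "Suc n"] by simp
qed

context allowed_presentation
begin

sublocale \<phi>: surjective_ring_hom S A \<phi>
proof -
  have "cring S" "cring A" using S(2) A(2) by (auto simp: regular_local_ring_def local_ring_def)
  then show "surjective_ring_hom S A \<phi>"
    using \<phi> by (intro surjective_ring_hom.intro ring_hom_cring.intro ring_hom_cring_axioms.intro
        surjective_ring_hom_axioms.intro)
qed

sublocale A: noetherian_local_ring A "max_ideal A"
  using noetherian_local_ringI[OF \<phi>.noetherian_image A(2)] S(2)
  by (auto simp: regular_local_ring_def)

lemma S_noetherian_local: "noetherian_local_ring S (max_ideal S)"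
  using S(2) noetherian_local_ringI by (auto simp: regular_local_ring_def)

lemma ker_subset: "\<phi>.ker \<subseteq> max_ideal S"
proof -
  interpret S: noetherian_local_ring S "max_ideal S" by (rule S_noetherian_local)
  have "ideal \<phi>.ker S" using \<phi>.ring.ideal_vimage[OF \<phi>.S.zeroideal] by simp
  moreover have "\<one>\<^bsub>S\<^esub> \<notin> \<phi>.ker" using A.one_notin_M \<phi>.S.ideal_zero[OF A.M_ideal] by auto
  ultimately show ?thesis by (rule S.proper_ideal_subset_M)
qed

lemma max_ideal_A: "max_ideal A = \<phi> ` max_ideal S"
  using \<phi>.noetherian_local_image[OF S_noetherian_local ker_subset] noetherian_local_ring.max_ideal_eq
  by blast

sublocale S: local_algebra S "max_ideal S" "constants K S"
proof -
  interpret S: noetherian_local_ring S "max_ideal S" by (rule S_noetherian_local)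
  note m = algebra.axioms(1)[OF S(1)]
  show "local_algebra S (max_ideal S) (constants K S)"
  proof (rule local_algebra.intro[OF S_noetherian_local local_algebra_axioms.intro])
    show "constants K S \<subseteq> carrier S" using module.smult_closed[OF m] \<phi>.R.one_closed by blast
    show "add_pow S (Suc n) \<one>\<^bsub>S\<^esub> \<in> Units S" for n by (rule nat_unit_algebra[OF K S(1)])
    fix s assume s: "s \<in> carrier S"
    then obtain c a where c: "c \<in> carrier K" "a \<in> max_ideal A" "\<phi> s = (c \<odot>\<^bsub>A\<^esub> \<one>\<^bsub>A\<^esub>) \<oplus>\<^bsub>A\<^esub> a"
      using residue[of "\<phi> s"] by auto
    define b where "b = c \<odot>\<^bsub>S\<^esub> \<one>\<^bsub>S\<^esub>"
    have b: "b \<in> carrier S" "\<phi> b = c \<odot>\<^bsub>A\<^esub> \<one>\<^bsub>A\<^esub>"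
      using module.smult_closed[OF m c(1)] \<phi>(3)[OF c(1), of "\<one>\<^bsub>S\<^esub>"] by (auto simp: b_def)
    have \<phi>b: "\<phi> b \<in> carrier A" using \<phi>.hom_closed[OF b(1)] .
    have "\<phi> (s \<ominus>\<^bsub>S\<^esub> b) = (\<phi> b \<oplus>\<^bsub>A\<^esub> a) \<ominus>\<^bsub>A\<^esub> \<phi> b" using s b c(3) by (simp add: \<phi>.R.minus_eq \<phi>.S.minus_eq)
    also have "\<dots> = a" using \<phi>b A.M_closed[OF c(2)] by algebra
    finally have "\<phi> (s \<ominus>\<^bsub>S\<^esub> b) \<in> \<phi> ` max_ideal S" using c(2) max_ideal_A by simp
    then have "s \<ominus>\<^bsub>S\<^esub> b \<in> max_ideal S"
      using \<phi>.mem_image_iff[OF S.M_ideal ker_subset \<phi>.R.minus_closed[OF s b(1)]] by blast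
    moreover have "s = b \<oplus>\<^bsub>S\<^esub> (s \<ominus>\<^bsub>S\<^esub> b)" using s b(1) by algebra
    ultimately show "\<exists>c\<in>constants K S. \<exists>y\<in>max_ideal S. s = c \<oplus>\<^bsub>S\<^esub> y"
      using c(1) unfolding b_def by blast
  qed
qed

lemma coordinates_of_weak_jacobian:
  obtains n f d where "S.coordinates n f d" "krull_dim S = enat n"
proof -
  obtain n D F where jac: "enat n = krull_dim S" "\<forall>i<n. D i \<in> derivations K S"
    "\<forall>j<n. F j \<in> max_ideal S" "ring_det S n (\<lambda>i j. D i (F j)) \<notin> max_ideal S"
    using S(3) unfolding weak_jacobian_def by blast
  obtain xs where xs: "set xs \<subseteq> carrier S" "enat (length xs) = krull_dim S"
    "genideal S (set xs) = max_ideal S"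
    using S(2) by (auto simp: regular_local_ring_def regular_system_of_parameters_def)
  have "card (set xs) \<le> n" using jac(1) xs(2) card_length[of xs] by (metis enat.inject)
  then have "\<exists>f d. S.coordinates n f d"
    using jac xs derivations_subset_derivs[OF S(1)] \<phi>.R.genideal_self[OF xs(1)]
    by (intro S.coordinates_exist[of "set xs" n D F]) auto
  then show ?thesis using that jac(1) by auto
qed

text \<open>The derivations \<open>d\<^sub>i\<close> dual to coordinates allow one to lift derivations from \<open>A\<close> to \<open>S\<close>.\<close>

lemma derivation_lift:
  assumes c: "S.coordinates n f d" and E: "E \<in> derivs A (constants K A)"
  shows "\<exists>D\<in>derivs S (constants K S). \<forall>s\<in>carrier S. \<phi> (D s) = E (\<phi> s)"
proof -
  note fc = S.coord_closed[OF c] and Ec = deriv_closed[OF E]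
  have "\<exists>e. e \<in> carrier S \<and> \<phi> e = E (\<phi> (f i))" if "i < n" for i
    using \<phi>.surjE[of "E (\<phi> (f i))"] Ec fc[OF that] \<phi>.hom_closed by metis
  then obtain e where e: "\<And>i. i < n \<Longrightarrow> e i \<in> carrier S \<and> \<phi> (e i) = E (\<phi> (f i))" by metis
  define D where "D = (\<lambda>s. \<Oplus>\<^bsub>S\<^esub>i\<in>{..<n}. e i \<otimes>\<^bsub>S\<^esub> d i s)"
  have D: "D \<in> derivs S (constants K S)" unfolding D_def
    using S.coord_deriv[OF c] e by (intro \<phi>.R.deriv_finsum) auto
  note Dc = deriv_closed[OF D]
  have Df: "D (f j) = e j" if j: "j < n" for j
  proof -
    have "D (f j) = (\<Oplus>\<^bsub>S\<^esub>i\<in>{..<n}. e i \<otimes>\<^bsub>S\<^esub> (if i = j then \<one>\<^bsub>S\<^esub> else \<zero>\<^bsub>S\<^esub>))"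
      unfolding D_def using e S.coord_dual[OF c _ j] by (intro \<phi>.R.finsum_cong') auto
    then show ?thesis using \<phi>.R.finsum_delta[of "{..<n}" j e] e j by simp
  qed
  define \<Delta> where "\<Delta> s = \<phi> (D s) \<ominus>\<^bsub>A\<^esub> E (\<phi> s)" for s
  have \<Delta>0: "\<Delta> s = \<zero>\<^bsub>A\<^esub>" if s: "s \<in> carrier S" for s
  proof (rule S.derivation_unique[OF A.noetherian_local_ring_axioms \<phi>(1), where \<Delta> = \<Delta> and Y = "f ` {..<n}"])
    show "\<phi> ` max_ideal S \<subseteq> max_ideal A" using max_ideal_A by simp
    show "\<Delta> a \<in> carrier A" if "a \<in> carrier S" for a
      using that Dc Ec by (simp add: \<Delta>_def)
    fix a b assume ab: "a \<in> carrier S" "b \<in> carrier S"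
    have cc: "\<phi> (D a) \<in> carrier A" "\<phi> (D b) \<in> carrier A" "E (\<phi> a) \<in> carrier A" "E (\<phi> b) \<in> carrier A"
      "\<phi> a \<in> carrier A" "\<phi> b \<in> carrier A" "D a \<in> carrier S" "D b \<in> carrier S"
      using ab Dc Ec by auto
    have "(\<phi> (D a) \<oplus>\<^bsub>A\<^esub> \<phi> (D b)) \<ominus>\<^bsub>A\<^esub> (E (\<phi> a) \<oplus>\<^bsub>A\<^esub> E (\<phi> b))
        = (\<phi> (D a) \<ominus>\<^bsub>A\<^esub> E (\<phi> a)) \<oplus>\<^bsub>A\<^esub> (\<phi> (D b) \<ominus>\<^bsub>A\<^esub> E (\<phi> b))"
      using cc by algebra
    then show "\<Delta> (a \<oplus>\<^bsub>S\<^esub> b) = \<Delta> a \<oplus>\<^bsub>A\<^esub> \<Delta> b"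
      using ab cc by (simp add: \<Delta>_def deriv_add[OF D] deriv_add[OF E])
    have "(\<phi> (D a) \<otimes>\<^bsub>A\<^esub> \<phi> b \<oplus>\<^bsub>A\<^esub> \<phi> a \<otimes>\<^bsub>A\<^esub> \<phi> (D b)) \<ominus>\<^bsub>A\<^esub> (E (\<phi> a) \<otimes>\<^bsub>A\<^esub> \<phi> b \<oplus>\<^bsub>A\<^esub> \<phi> a \<otimes>\<^bsub>A\<^esub> E (\<phi> b))
        = (\<phi> (D a) \<ominus>\<^bsub>A\<^esub> E (\<phi> a)) \<otimes>\<^bsub>A\<^esub> \<phi> b \<oplus>\<^bsub>A\<^esub> \<phi> a \<otimes>\<^bsub>A\<^esub> (\<phi> (D b) \<ominus>\<^bsub>A\<^esub> E (\<phi> b))"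
      using cc by algebra
    then show "\<Delta> (a \<otimes>\<^bsub>S\<^esub> b) = \<Delta> a \<otimes>\<^bsub>A\<^esub> \<phi> b \<oplus>\<^bsub>A\<^esub> \<phi> a \<otimes>\<^bsub>A\<^esub> \<Delta> b"
      using ab cc by (simp add: \<Delta>_def deriv_mult[OF D] deriv_mult[OF E])
  next
    fix k assume "k \<in> constants K S"
    then obtain c where k: "k = c \<odot>\<^bsub>S\<^esub> \<one>\<^bsub>S\<^esub>" "c \<in> carrier K" by blast
    then have "E (\<phi> k) = \<zero>\<^bsub>A\<^esub>" using deriv_const[OF E, of "\<phi> k"] \<phi>(3)[of c "\<one>\<^bsub>S\<^esub>"] by simp
    then show "\<Delta> k = \<zero>\<^bsub>A\<^esub>" using deriv_const[OF D \<open>k \<in> constants K S\<close>] by (simp add: \<Delta>_def \<phi>.S.minus_eq)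
  next
    show "max_ideal S = genideal S (f ` {..<n})" by (rule S.coord_gen[OF c])
    show "f ` {..<n} \<subseteq> carrier S" using fc by blast
    fix y assume "y \<in> f ` {..<n}"
    then obtain j where "j < n" "y = f j" by blast
    then show "\<Delta> y = \<zero>\<^bsub>A\<^esub>" using Df e Ec fc by (simp add: \<Delta>_def \<phi>.S.minus_eq \<phi>.S.r_neg)
  qed (rule s)
  have "\<phi> (D s) = E (\<phi> s)" if s: "s \<in> carrier S" for s
  proof -
    have "\<phi> (D s) \<in> carrier A" "E (\<phi> s) \<in> carrier A" using Dc Ec s by auto
    then show ?thesis using \<Delta>0[OF s] unfolding \<Delta>_def by simp
  qed
  then show ?thesis using D by blast
qed

end

section \<open>Maximal defining ideals\<close>

text \<open>A Lie algebroid over an allowed algebra with a given presentation.\<close>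

locale allowed_lie_algebroid =
  allowed_presentation K S A \<phi> + lie_algebroid K A g br \<alpha>
  for K :: "('k, 'z) ring_scheme"
    and S :: "('k, 's, 'w) module_scheme"
    and A :: "('k, 'a, 'y) module_scheme"
    and \<phi> :: "'s \<Rightarrow> 'a"
    and g :: "('a, 'g, 'x) module_scheme"
    and br :: "'g \<Rightarrow> 'g \<Rightarrow> 'g"
    and \<alpha> :: "'g \<Rightarrow> 'a \<Rightarrow> 'a"
begin

lemma defining_idealD:
  assumes "defining_ideal A g \<alpha> J"
  shows "ideal J A" "J \<noteq> carrier A" "anchor_stable J" "J \<subseteq> max_ideal A"
proof -
  show *: "ideal J A" "J \<noteq> carrier A" "anchor_stable J"
    using assms by (auto simp: defining_ideal_def anchor_stable_def)
  show "J \<subseteq> max_ideal A"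
    using A.proper_ideal_subset_M[OF *(1)] \<phi>.S.ideal_proper_iff[OF *(1)] *(2) by blast
qed

text \<open>The preimage in \<open>S\<close> of a maximal defining ideal is generated by coordinates, which can be
  chosen to extend given ones.\<close>

lemma maximal_defining_vimage:
  assumes J: "maximal_defining_ideal A g \<alpha> J" and c: "S.coordinates n f d"
    and T: "T \<subseteq> {..<n}" "\<phi> ` f ` T \<subseteq> J"
  shows "\<exists>f' d' T'. S.coordinates n f' d' \<and> T \<subseteq> T' \<and> T' \<subseteq> {..<n} \<and> (\<forall>i\<in>T. f' i = f i) \<and>
    {s \<in> carrier S. \<phi> s \<in> J} = S.coord_ideal f' T'"
proof -
  define P where "P = {s \<in> carrier S. \<phi> s \<in> J}"
  have Jd: "defining_ideal A g \<alpha> J" using J by (simp add: maximal_defining_ideal_def)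
  note J' = defining_idealD[OF Jd]
  have P: "ideal P S" unfolding P_def by (rule \<phi>.ring.ideal_vimage[OF J'(1)])
  have "\<one>\<^bsub>S\<^esub> \<notin> P" using J'(1,2) \<phi>.S.ideal_proper_iff by (auto simp: P_def)
  then have PM: "P \<subseteq> max_ideal S" by (rule S.proper_ideal_subset_M[OF P])
  have kerP: "\<phi>.ker \<subseteq> P" unfolding P_def by (rule \<phi>.ker_subset_vimage[OF J'(1)])
  obtain f' d' T' where *: "S.coordinates n f' d'" "T \<subseteq> T'" "T' \<subseteq> {..<n}" "\<forall>i\<in>T. f' i = f i"
    "\<forall>i\<in>T' - T. f' i \<in> P" "\<forall>j<n. j \<notin> T' \<longrightarrow> (\<forall>x\<in>P. d' j x \<in> max_ideal S)"
    using S.coord_exchange[OF c T(1) PM] by blast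
  have fT: "f' ` T' \<subseteq> P"
  proof
    fix y assume "y \<in> f' ` T'"
    then obtain i where i: "i \<in> T'" "y = f' i" by blast
    show "y \<in> P"
    proof (cases "i \<in> T")
      case True
      then have "y = f i" "i < n" using * i T by auto
      then show ?thesis using T(2) True S.coord_closed[OF c] by (auto simp: P_def)
    qed (use * i in blast)
  qed
  \<comment> \<open>The derivations of \<open>S\<close> that lift derivations in the image of the anchor.\<close>
  define \<L> where "\<L> = {D \<in> derivs S (constants K S). \<exists>\<delta>\<in>carrier g. \<forall>s\<in>carrier S. \<phi> (D s) = \<alpha> \<delta> (\<phi> s)}"
  have "P = S.coord_ideal f' T'"
  proof (rule S.maximal_stable_eq_coord_ideal[OF *(1,3) P PM fT, of \<L>])
    show "d' j p \<in> max_ideal S" if "j < n" "j \<notin> T'" "p \<in> P" for j p using * that by blast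
    show "\<L> \<subseteq> derivs S (constants K S)" by (auto simp: \<L>_def)
    show "E p \<in> P" if "E \<in> \<L>" "p \<in> P" for E p
      using that J'(3) deriv_closed[of E S "constants K S" p] by (auto simp: \<L>_def P_def anchor_stable_def)
    fix Q assume Q: "ideal Q S" "P \<subseteq> Q" "Q \<subseteq> max_ideal S" "\<And>E q. E \<in> \<L> \<Longrightarrow> q \<in> Q \<Longrightarrow> E q \<in> Q"
    have QA: "ideal (\<phi> ` Q) A" by (rule \<phi>.ideal_image[OF Q(1)])
    have "\<phi> ` Q \<subseteq> max_ideal A" using Q(3) max_ideal_A by blast
    then have QA1: "\<phi> ` Q \<noteq> carrier A" using A.one_notin_M \<phi>.S.one_closed by blast
    have "anchor_stable (\<phi> ` Q)"
      unfolding anchor_stable_def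
    proof (intro ballI)
      fix \<delta> a assume \<delta>: "\<delta> \<in> carrier g" and "a \<in> \<phi> ` Q"
      then obtain q where q: "q \<in> Q" "a = \<phi> q" by blast
      obtain D where "D \<in> derivs S (constants K S)" "\<forall>s\<in>carrier S. \<phi> (D s) = \<alpha> \<delta> (\<phi> s)"
        using derivation_lift[OF c anchor_deriv[OF \<delta>]] by blast
      then have "D q \<in> Q" "\<phi> (D q) = \<alpha> \<delta> a"
        using Q(4) \<delta> q \<phi>.R.ideal_subset[OF Q(1)] by (auto simp: \<L>_def)
      then show "\<alpha> \<delta> a \<in> \<phi> ` Q" by force
    qed
    moreover have JQ: "J \<subseteq> \<phi> ` Q"
    proof
      fix a assume a: "a \<in> J"
      then obtain s where "s \<in> carrier S" "a = \<phi> s" using \<phi>.surjE \<phi>.S.ideal_subset[OF J'(1)] by blast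
      then show "a \<in> \<phi> ` Q" using a Q(2) by (auto simp: P_def)
    qed
    ultimately have "defining_ideal A g \<alpha> (\<phi> ` Q)"
      using defining_ideal_mono[OF Jd QA] QA1 by blast
    then have "\<phi> ` Q = J" using J JQ unfolding maximal_defining_ideal_def by blast
    then show "Q = P" using Q(2) \<phi>.R.ideal_subset[OF Q(1)] by (auto simp: P_def)
  qed
  then show ?thesis using * unfolding P_def by blast
qed

lemma maximal_defining_prime:
  assumes J: "maximal_defining_ideal A g \<alpha> J" shows "primeideal J A"
proof -
  have Ji: "ideal J A" using J defining_idealD by (auto simp: maximal_defining_ideal_def)
  obtain n f d where c: "S.coordinates n f d" using coordinates_of_weak_jacobian by blast
  obtain f' d' T' where *: "S.coordinates n f' d'" "T' \<subseteq> {..<n}"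
    "{s \<in> carrier S. \<phi> s \<in> J} = S.coord_ideal f' T'"
    using maximal_defining_vimage[OF J c, of "{}"] by auto
  have "primeideal (\<phi> ` {s \<in> carrier S. \<phi> s \<in> J}) A"
    by (rule \<phi>.primeideal_image)
      (use * S.coord_ideal_prime[OF *(1,2)] \<phi>.ker_subset_vimage[OF Ji] in auto)
  then show ?thesis using \<phi>.image_vimage[OF \<phi>.S.ideal_subset[OF Ji]] by simp
qed

theorem maximal_defining_quotient_regular:
  assumes J: "maximal_defining_ideal A g \<alpha> J" shows "regular_local_ring (A Quot J)"
proof -
  have Ji: "ideal J A" using J defining_idealD by (auto simp: maximal_defining_ideal_def)
  interpret J: ideal J A by fact
  obtain n f d where c: "S.coordinates n f d" and dim: "krull_dim S = enat n"
    using coordinates_of_weak_jacobian by blast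
  obtain f' d' T where *: "S.coordinates n f' d'" "T \<subseteq> {..<n}"
    "{s \<in> carrier S. \<phi> s \<in> J} = S.coord_ideal f' T"
    using maximal_defining_vimage[OF J c, of "{}"] by auto
  let ?h = "\<lambda>s. J +>\<^bsub>A\<^esub> \<phi> s"
  have h: "surjective_ring_hom S (A Quot J) ?h"
  proof (intro surjective_ring_hom.intro ring_hom_cring.intro ring_hom_cring_axioms.intro
        surjective_ring_hom_axioms.intro)
    show "cring S" by (rule \<phi>.R.is_cring)
    show "cring (A Quot J)" by (rule J.quotient_is_cring[OF \<phi>.S.is_cring])
    have "((+>\<^bsub>A\<^esub>) J) \<circ> \<phi> \<in> ring_hom S (A Quot J)"
      by (rule ring_hom_trans[OF \<phi>(1) J.rcos_ring_hom])
    then show "?h \<in> ring_hom S (A Quot J)" by (simp add: comp_def)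
    have "?h ` carrier S = (+>\<^bsub>A\<^esub>) J ` carrier A" unfolding \<phi>(2)[symmetric] by (simp add: image_image)
    then show "?h ` carrier S = carrier (A Quot J)" by (auto simp: FactRing_simps)
  qed
  have "J +>\<^bsub>A\<^esub> a = \<zero>\<^bsub>A Quot J\<^esub> \<longleftrightarrow> a \<in> J" if "a \<in> carrier A" for a
    using J.a_rcos_const[of a] J.rcos_const_imp_mem[OF that] by (auto simp: FactRing_def)
  then have "{s \<in> carrier S. ?h s = \<zero>\<^bsub>A Quot J\<^esub>} = {s \<in> carrier S. \<phi> s \<in> J}"
    by (intro Collect_cong conj_cong refl) simp
  then have "{s \<in> carrier S. ?h s = \<zero>\<^bsub>A Quot J\<^esub>} = S.coord_ideal f' T" using *(3) by simp
  moreover obtain l where "distinct l" "set l = {..<n} - T"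
    using finite_distinct_list[of "{..<n} - T"] by auto
  ultimately show ?thesis using S.coord_quotient_regular(1)[OF *(1) dim *(2) h] by blast
qed

text \<open>If \<open>A\<close> is regular, the kernel of \<open>\<phi>\<close> is generated by coordinates, which extend to coordinates
  generating the preimage of \<open>J\<close>.\<close>

theorem maximal_defining_generators:
  assumes J: "maximal_defining_ideal A g \<alpha> J" and reg: "regular_local_ring A"
  shows "\<exists>xs r. regular_system_of_parameters A xs \<and> r \<le> length xs \<and> J = genideal A (set (take r xs))"
proof -
  have Ji: "ideal J A" using J defining_idealD by (auto simp: maximal_defining_ideal_def)
  obtain n f0 d0 where c0: "S.coordinates n f0 d0" and dim: "krull_dim S = enat n"
    using coordinates_of_weak_jacobian by blast
  have h: "surjective_ring_hom S A \<phi>" ..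
  obtain f d T where c: "S.coordinates n f d" "T \<subseteq> {..<n}" "\<phi>.ker = S.coord_ideal f T"
    using S.regular_quotient_kernel[OF c0 dim h reg] by blast
  have fT0: "\<phi> (f i) = \<zero>\<^bsub>A\<^esub>" if "i \<in> T" for i
    using S.coord_ideal_ideal(2)[OF c(1,2)] c(3) that by blast
  have "\<phi> ` f ` T \<subseteq> J" using fT0 \<phi>.S.ideal_zero[OF Ji] by auto
  from maximal_defining_vimage[OF J c(1,2) this] obtain f' d' T' where
    *: "S.coordinates n f' d'" "T \<subseteq> T'" "T' \<subseteq> {..<n}" "\<forall>i\<in>T. f' i = f i"
      "{s \<in> carrier S. \<phi> s \<in> J} = S.coord_ideal f' T'"
    by blast
  have "f' ` T = f ` T" using *(4) by auto
  then have ker: "\<phi>.ker = S.coord_ideal f' T" using c(3) by simp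
  have fin: "finite T'" using *(3) finite_subset by blast
  obtain l1 where l1: "distinct l1" "set l1 = T' - T" using finite_distinct_list[of "T' - T"] fin by auto
  obtain l2 where l2: "distinct l2" "set l2 = {..<n} - T'" using finite_distinct_list[of "{..<n} - T'"] by auto
  let ?l = "l1 @ l2"
  have l: "distinct ?l" "set ?l = {..<n} - T" using l1 l2 * by auto
  let ?xs = "map (\<lambda>i. \<phi> (f' i)) ?l"
  have rsp: "regular_system_of_parameters A ?xs"
    by (rule S.coord_quotient_regular(2)[OF *(1) dim c(2) h ker l])
  have fc: "f' ` T' \<subseteq> carrier S" using S.coord_ideal_ideal(3)[OF *(1,3)] .
  \<comment> \<open>The coordinates with index in \<open>T\<close> have image \<open>0\<close> in \<open>A\<close>.\<close>
  have "J = genideal A (\<phi> ` f' ` T')"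
    using \<phi>.image_vimage[OF \<phi>.S.ideal_subset[OF Ji]] \<phi>.image_genideal[OF fc] *(5) by simp
  also have "\<dots> = genideal A (\<phi> ` f' ` (T' - T))"
  proof
    have Bc: "\<phi> ` f' ` T' \<subseteq> carrier A" using fc by auto
    then have Bc': "\<phi> ` f' ` (T' - T) \<subseteq> carrier A" by auto
    note I = \<phi>.S.genideal_ideal[OF Bc'] \<phi>.S.genideal_self[OF Bc']
    show "genideal A (\<phi> ` f' ` (T' - T)) \<subseteq> genideal A (\<phi> ` f' ` T')"
      by (rule \<phi>.S.genideal_mono[OF _ Bc]) auto
    show "genideal A (\<phi> ` f' ` T') \<subseteq> genideal A (\<phi> ` f' ` (T' - T))"
    proof (rule \<phi>.S.genideal_minimal[OF I(1)])
      show "\<phi> ` f' ` T' \<subseteq> genideal A (\<phi> ` f' ` (T' - T))"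
      proof clarify
        fix i assume "i \<in> T'"
        then show "\<phi> (f' i) \<in> genideal A (\<phi> ` f' ` (T' - T))"
          using I(2) fT0 *(4) \<phi>.S.ideal_zero[OF I(1)] by (cases "i \<in> T") auto
      qed
    qed
  qed
  also have "\<phi> ` f' ` (T' - T) = set (take (length l1) ?xs)" using l1(2) by (simp add: image_image)
  finally show ?thesis using rsp by (intro exI[of _ ?xs] exI[of _ "length l1"]) auto
qed

text \<open>A power of a stable ideal \<open>I \<subseteq> max_ideal A\<close> that contains a defining ideal \<open>J\<close> lies in \<open>J\<close>:
  the chain \<open>I^k + J\<close> stops, and Nakayama's lemma applies.\<close>

lemma defining_ideal_radical:
  assumes J: "defining_ideal A g \<alpha> J" and I: "ideal I A" "anchor_stable I" "I \<subseteq> max_ideal A" "J \<subseteq> I"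
  shows "I \<subseteq> radical A J"
proof -
  note J' = defining_idealD[OF J]
  define pw where "pw k = ((\<lambda>Q. ideal_prod A I Q) ^^ k) (carrier A)" for k
  have pw_Suc: "pw (Suc k) = ideal_prod A I (pw k)" for k by (simp add: pw_def)
  have pw: "ideal (pw k) A \<and> anchor_stable (pw k)" for k
  proof (induct k)
    case 0
    then show ?case
      using \<phi>.S.oneideal deriv_closed[OF anchor_deriv] by (auto simp: pw_def anchor_stable_def)
  next
    case (Suc k)
    then have "ideal (pw (Suc k)) A" unfolding pw_Suc using \<phi>.S.ideal_prod_is_ideal I(1) by blast
    moreover have "\<alpha> \<delta> x \<in> pw (Suc k)" if "\<delta> \<in> carrier g" "x \<in> pw (Suc k)" for \<delta> x
      unfolding pw_Suc
      by (rule \<phi>.S.deriv_ideal_prod[OF anchor_deriv[OF that(1)]])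
        (use that I Suc pw_Suc in \<open>auto simp: anchor_stable_def\<close>)
    ultimately show ?case by (auto simp: anchor_stable_def)
  qed
  define Q where "Q k = pw k <+>\<^bsub>A\<^esub> J" for k
  have Q: "ideal (Q k) A" "J \<subseteq> Q k" "pw k \<subseteq> Q k" for k
    unfolding Q_def using pw J'(1) \<phi>.S.add_ideals \<phi>.S.ideal_sum_left \<phi>.S.ideal_sum_right by blast+
  have Qs: "anchor_stable (Q k)" for k
    unfolding anchor_stable_def
  proof (intro ballI)
    fix \<delta> x assume \<delta>: "\<delta> \<in> carrier g" and "x \<in> Q k"
    then obtain a b where ab: "a \<in> pw k" "b \<in> J" "x = a \<oplus>\<^bsub>A\<^esub> b"
      unfolding Q_def \<phi>.S.set_add_iff by blast
    have c: "a \<in> carrier A" "b \<in> carrier A"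
      using ab pw \<phi>.S.ideal_subset[OF J'(1)] \<phi>.S.ideal_subset by blast+
    have "\<alpha> \<delta> x = \<alpha> \<delta> a \<oplus>\<^bsub>A\<^esub> \<alpha> \<delta> b" using deriv_add[OF anchor_deriv[OF \<delta>] c] ab by simp
    moreover have "\<alpha> \<delta> a \<in> pw k" "\<alpha> \<delta> b \<in> J" using ab pw J'(3) \<delta> by (auto simp: anchor_stable_def)
    ultimately show "\<alpha> \<delta> x \<in> Q k" unfolding Q_def \<phi>.S.set_add_iff by blast
  qed
  have Qdec: "Q (Suc k) \<subseteq> Q k" for k
  proof -
    have "pw (Suc k) \<subseteq> pw k" unfolding pw_Suc using \<phi>.S.ideal_prod_inter[OF I(1)] pw by blast
    then show ?thesis
      using \<phi>.S.ideal_sum_least[OF Q(1), of "pw (Suc k)" k J] Q(2,3) unfolding Q_def[of "Suc k"] by blast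
  qed
  obtain k where k: "Q (Suc k) = Q k" using stable_chain_stops[where Q = Q, OF J Q(1) Qs Q(2) Qdec] by blast
  have "pw k \<subseteq> ideal_prod A (max_ideal A) (pw k) <+>\<^bsub>A\<^esub> J"
  proof -
    have pk: "ideal (pw k) A" using pw by blast
    have L: "ideal (ideal_prod A (max_ideal A) (pw k)) A" by (rule \<phi>.S.ideal_prod_is_ideal[OF A.M_ideal pk])
    have "pw (Suc k) \<subseteq> ideal_prod A (max_ideal A) (pw k)"
      unfolding pw_Suc using I(3) by (intro \<phi>.S.ideal_prod_least[OF L] ideal_prod.prod) auto
    then have "Q (Suc k) \<subseteq> ideal_prod A (max_ideal A) (pw k) <+>\<^bsub>A\<^esub> J"
      using \<phi>.S.ideal_sum_least[OF \<phi>.S.add_ideals[OF L J'(1)], of "pw (Suc k)" J]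
        \<phi>.S.ideal_sum_left[OF L J'(1)] \<phi>.S.ideal_sum_right[OF L J'(1)]
      unfolding Q_def by blast
    then show ?thesis using Q(3)[of k] k by blast
  qed
  then have pJ: "pw k \<subseteq> J" using A.nakayama[OF _ J'(1)] pw by blast
  show ?thesis
  proof
    fix a assume a: "a \<in> I"
    have ac: "a \<in> carrier A" using a \<phi>.S.ideal_subset[OF I(1)] by blast
    have "a [^]\<^bsub>A\<^esub> j \<in> pw j" for j :: nat
    proof (induct j)
      case (Suc j)
      have "a \<otimes>\<^bsub>A\<^esub> a [^]\<^bsub>A\<^esub> j \<in> pw (Suc j)" unfolding pw_Suc using ideal_prod.prod[OF a Suc] .
      then show ?case using ac by (simp add: \<phi>.S.m_comm)
    qed (simp add: pw_def)
    then show "a \<in> radical A J" using pJ ac unfolding radical_def by blast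
  qed
qed

lemma maximal_defining_eq_radical:
  assumes J: "defining_ideal A g \<alpha> J" and I: "maximal_defining_ideal A g \<alpha> I" "J \<subseteq> I"
  shows "I = radical A J"
proof
  have Id: "defining_ideal A g \<alpha> I" using I by (simp add: maximal_defining_ideal_def)
  show "I \<subseteq> radical A J"
    using defining_ideal_radical[OF J] defining_idealD[OF Id] I(2) by blast
  interpret I: primeideal I A by (rule maximal_defining_prime[OF I(1)])
  show "radical A J \<subseteq> I"
  proof
    fix a assume "a \<in> radical A J"
    then obtain k :: nat where a: "a \<in> carrier A" "a [^]\<^bsub>A\<^esub> k \<in> I" using I(2) by (auto simp: radical_def)
    from a(2) show "a \<in> I"
    proof (induct k)
      case 0
      then show ?case using I.one_imp_carrier I.I_notcarr by simp
    next
      case (Suc k)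
      then show ?case using I.I_prime[of "a [^]\<^bsub>A\<^esub> k" a] a(1) by auto
    qed
  qed
qed

lemma maximal_defining_exists:
  assumes J: "defining_ideal A g \<alpha> J"
  obtains I where "maximal_defining_ideal A g \<alpha> I" "J \<subseteq> I"
proof -
  let ?P = "\<lambda>I. defining_ideal A g \<alpha> I \<and> J \<subseteq> I"
  have "\<exists>I. ?P I \<and> (\<forall>I'. ?P I' \<longrightarrow> I \<subseteq> I' \<longrightarrow> I' = I)"
    by (rule A.ideal_maximal_element) (use J defining_idealD(1) in auto)
  then obtain I where "?P I" "\<forall>I'. ?P I' \<longrightarrow> I \<subseteq> I' \<longrightarrow> I' = I" by (elim exE conjE) blast
  then show ?thesis using that[of I] unfolding maximal_defining_ideal_def by (meson order_trans)
qed

end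

theorem proposition2p33:
  fixes K :: "('k, 'z) ring_scheme"
    and S :: "('k, 's, 'w) module_scheme"
    and A :: "('k, 'a, 'y) module_scheme"
    and g :: "('a, 'g, 'x) module_scheme"
    and br :: "'g \<Rightarrow> 'g \<Rightarrow> 'g"
    and \<alpha> :: "'g \<Rightarrow> 'a \<Rightarrow> 'a"
  assumes "algebraically_closed K"
    and "char_zero K"
    and "allowed_algebra K S A"
    and "lie_algebroid K A g br \<alpha>"
  shows "(\<forall>J. maximal_defining_ideal A g \<alpha> J \<longrightarrow>
            regular_local_ring (A Quot J) \<and>
            (regular_local_ring A \<longrightarrow>
              (\<exists>xs r. regular_system_of_parameters A xs \<and> r \<le> length xs \<and>
                 J = genideal A (set (take r xs))))) \<and>
         (\<forall>J. defining_ideal A g \<alpha> J \<longrightarrow>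
            maximal_defining_ideal A g \<alpha> (radical A J) \<and> J \<subseteq> radical A J \<and>
            (\<forall>J'. maximal_defining_ideal A g \<alpha> J' \<and> J \<subseteq> J' \<longrightarrow> J' = radical A J))"
proof -
  obtain \<phi> where \<phi>: "\<phi> \<in> ring_hom S A" "\<phi> ` carrier S = carrier A"
    "\<forall>c\<in>carrier K. \<forall>s\<in>carrier S. \<phi> (c \<odot>\<^bsub>S\<^esub> s) = c \<odot>\<^bsub>A\<^esub> \<phi> s"
    using assms(3) unfolding allowed_algebra_def by blast
  have "allowed_presentation K S A \<phi>"
    using assms(2,3) \<phi> algebraically_closed.axioms(1)[OF assms(1)]
    unfolding allowed_algebra_def by (intro allowed_presentation.intro) auto
  then interpret allowed_lie_algebroid K S A \<phi> g br \<alpha>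
    by (rule allowed_lie_algebroid.intro[OF _ assms(4)])
  have "maximal_defining_ideal A g \<alpha> (radical A J) \<and> J \<subseteq> radical A J \<and>
      (\<forall>J'. maximal_defining_ideal A g \<alpha> J' \<and> J \<subseteq> J' \<longrightarrow> J' = radical A J)"
    if J: "defining_ideal A g \<alpha> J" for J
  proof -
    obtain I where "maximal_defining_ideal A g \<alpha> I" "J \<subseteq> I" using maximal_defining_exists[OF J] by blast
    moreover from this have "I = radical A J" by (rule maximal_defining_eq_radical[OF J])
    ultimately show ?thesis using maximal_defining_eq_radical[OF J] by blast
  qed
  then show ?thesis using maximal_defining_quotient_regular maximal_defining_generators by blast
qed

end
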